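(* Let $\Lambda$ be a sequence in $\mathbb{D}$ satisfying the Blaschke condition $\sum_{\lambda\in\Lambda}(1-|\lambda|)<\infty$. (a) If $\Lambda\in\mathrm{Int}\,N^+$, then $\displaystyle\lim_{|\lambda|\to1,\ \lambda\in\Lambda}(1-|\lambda|)\log|B_\lambda(\lambda)|^{-1}=0$. (b) If $\Lambda\in\mathrm{Int}\,N$, then $\displaystyle\sup_{\lambda\in\Lambda}(1-|\lambda|)\log|B_\lambda(\lambda)|^{-1}<\infty$. (c) If $\displaystyle\sum_{\lambda\in\Lambda}(1-|\lambda|)\log|B_\lambda(\lambda)|^{-1}<\infty$, then $\Lambda\in\mathrm{Int}\,N^+$ (and so also $\Lambda\in\mathrm{Int}\,N$).
   Context: $\mathbb{D}$ is the open unit disc. A sequence $\Lambda\subset\mathbb{D}$ means a discrete sequence of (distinct) points. For $\lambda\in\mathbb{D}$, $b_\lambda(z)=\frac{|\lambda|}{\lambda}\frac{\lambda-z}{1-\overline{\lambda}z}$ ($b_0(z)=z$); for $\lambda\in\Lambda$, $B_\lambda=\prod_{\lambda'\in\Lambda\setminus\{\lambda\}}b_{\lambda'}$. The Nevanlinna class is $N=\{f\in\mathrm{Hol}(\mathbb{D}):\lim_{r\to1}\frac1{2\pi}\int_0^{2\pi}\log^+|f(re^{i\theta})|\,d\theta<\infty\}$, and the Smirnov class $N^+$ is the set of $f\in N$ with $\lim_{r\to1}\frac1{2\pi}\int_0^{2\pi}\log^+|f(re^{i\theta})|\,d\theta=\frac1{2\pi}\int_0^{2\pi}\log^+|f(e^{i\theta})|\,d\theta$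 (non-tangential boundary values). For a space $X$ of holomorphic functions on $\mathbb{D}$, $X|\Lambda=\{(f(\lambda))_{\lambda\in\Lambda}:f\in X\}$, and $\Lambda\in\mathrm{Int}\,X$ ($\Lambda$ is free interpolating for $X$) means that $X|\Lambda$ is ideal: $(a_\lambda)\in X|\Lambda$ and $(\omega_\lambda)\in\ell^\infty$ imply $(\omega_\lambda a_\lambda)\in X|\Lambda$. *)

theory Defs
  imports "HOL-Analysis.Analysis"
begin

text \<open>A (discrete) sequence of distinct points of the unit disc is represented by the set of its
  points. A numerical family indexed by the sequence is a function that is used on this set only,
  and series over the sequence are unordered sums over the set.\<close>

definition disc_sequence :: "complex set \<Rightarrow> bool" where
  "disc_sequence \<Lambda> \<longleftrightarrow> \<Lambda> \<subseteq> ball 0 1 \<and> \<Lambda> sparse_in ball 0 1"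

definition blaschke_condition :: "complex set \<Rightarrow> bool" where
  "blaschke_condition \<Lambda> \<longleftrightarrow> (\<lambda>l. 1 - cmod l) summable_on \<Lambda>"

definition blaschke_factor :: "complex \<Rightarrow> complex \<Rightarrow> complex" where
  "blaschke_factor l z =
     (if l = 0 then z else (of_real (cmod l) / l) * ((l - z) / (1 - cnj l * z)))"

text \<open>The library's infinite products run over the natural numbers only. The product below is
  unordered, in the same way as \<^const>\<open>infsum\<close>: it is the limit of the finite subproducts. Under
  the Blaschke condition it converges at every point of the disc.\<close>

definition blaschke_product_without :: "complex set \<Rightarrow> complex \<Rightarrow> complex \<Rightarrow> complex" where
  "blaschke_product_without \<Lambda> l z =
     Lim (finite_subsets_at_top (\<Lambda> - {l})) (\<lambda>F. \<Prod>l'\<in>F. blaschke_factor l' z)"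

text \<open>Since \<^term>\<open>ln (0::real) = 0\<close> in HOL, the usual convention that the positive part of the
  logarithm vanishes at 0 is respected.\<close>

definition log_plus :: "real \<Rightarrow> real" where
  "log_plus x = max 0 (ln x)"

definition circle_mean :: "(complex \<Rightarrow> real) \<Rightarrow> real" where
  "circle_mean u = 1 / (2 * pi) * (LINT \<theta>:{0..2 * pi}|lebesgue. u (cis \<theta>))"

text \<open>Functions on the disc are total functions of which only the values on \<^term>\<open>ball (0::complex) 1\<close>
  matter. The integral means below are nondecreasing in \<open>r\<close>, so that they have a limit in
  \<open>[0, \<infinity>]\<close>; finiteness of the limit is convergence to a real number.\<close>

definition nevanlinna :: "(complex \<Rightarrow> complex) set" where
  "nevanlinna = {f. f holomorphic_on ball 0 1 \<and>
     (\<exists>L::real. ((\<lambda>r. circle_mean (\<lambda>\<zeta>. log_plus (cmod (f (of_real r * \<zeta>))))) \<longlongrightarrow> L) (at_left 1))}"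

definition stolz_region :: "real \<Rightarrow> complex \<Rightarrow> complex set" where
  "stolz_region \<alpha> \<zeta> = {z \<in> ball 0 1. cmod (z - \<zeta>) < \<alpha> * (1 - cmod z)}"

definition nontangential_limit :: "(complex \<Rightarrow> complex) \<Rightarrow> complex \<Rightarrow> complex \<Rightarrow> bool" where
  "nontangential_limit f \<zeta> w \<longleftrightarrow> (\<forall>\<alpha>>1. (f \<longlongrightarrow> w) (at \<zeta> within stolz_region \<alpha> \<zeta>))"

definition boundary_value :: "(complex \<Rightarrow> complex) \<Rightarrow> complex \<Rightarrow> complex" where
  "boundary_value f \<zeta> = (THE w. nontangential_limit f \<zeta> w)"

text \<open>For \<open>f\<close> in the Nevanlinna class, the boundary value exists at almost every point of the circle,
  and \<open>log_plus \<bar>f\<bar>\<close> is integrable there (Fatou). Hence neither the junk values of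
  \<^const>\<open>boundary_value\<close> nor the default value of the integral play a role.\<close>

definition smirnov :: "(complex \<Rightarrow> complex) set" where
  "smirnov = {f \<in> nevanlinna.
     ((\<lambda>r. circle_mean (\<lambda>\<zeta>. log_plus (cmod (f (of_real r * \<zeta>)))))
        \<longlongrightarrow> circle_mean (\<lambda>\<zeta>. log_plus (cmod (boundary_value f \<zeta>)))) (at_left 1)}"

definition trace_space :: "(complex \<Rightarrow> complex) set \<Rightarrow> complex set \<Rightarrow> (complex \<Rightarrow> complex) set" where
  "trace_space X \<Lambda> = (\<lambda>f. restrict f \<Lambda>) ` X"

definition free_interpolating :: "(complex \<Rightarrow> complex) set \<Rightarrow> complex set \<Rightarrow> bool" where
  "free_interpolating X \<Lambda> \<longleftrightarrow>
     (\<forall>a \<in> trace_space X \<Lambda>. \<forall>\<omega>::complex \<Rightarrow> complex. bounded (\<omega> ` \<Lambda>) \<longrightarrow>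
        restrict (\<lambda>l. \<omega> l * a l) \<Lambda> \<in> trace_space X \<Lambda>)"

end

theory Submission
  imports Defs "HOL-Complex_Analysis.Complex_Analysis"
begin

text \<open>Write \<open>K(c, L)\<close> for the functions \<open>f\<close> with \<open>circle_mean (log_plus (c \<bar>f\<bar>)) \<le> L\<close> on all circles of
  radius less than 1. These are normal families, they are stable under division by Blaschke factors,
  and \<open>f \<in> K(c, L)\<close> satisfies \<open>c \<bar>f(z)\<bar> \<le> exp (2 L / (1 - \<bar>z\<bar>))\<close>. The Nevanlinna class is the union of the
  \<open>K(1, L)\<close>, and the Smirnov class consists of the \<open>f\<close> which for every \<open>\<epsilon> > 0\<close> lie in some \<open>K(c, \<epsilon>)\<close>; the
  latter rests on Fatou's theorem for quotients of bounded functions.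

  Necessity: all indicators of subsets of \<open>\<Lambda>\<close> are interpolated, hence by Baire's theorem there is one
  bound \<open>K(c, L)\<close> and, for all but finitely many \<open>\<lambda> \<in> \<Lambda>\<close>, a function within it that is 1 at \<open>\<lambda>\<close> and 0 on the
  rest of \<open>\<Lambda>\<close>. Dividing by the Blaschke product and evaluating at \<open>\<lambda>\<close> bounds \<open>\<bar>B(\<lambda>)\<bar>\<close> from below. In the
  Smirnov case \<open>L\<close> can be prescribed as small as desired, at the expense of \<open>c\<close>.

  Sufficiency: the given series yields a harmonic function \<open>u = Re g \<ge> 0\<close> with
  \<open>u(\<lambda>) \<ge> ln (1 / \<bar>B(\<lambda>)\<bar>)\<close> and uniformly integrable means. The interpolating function is \<open>exp g\<close> times a
  sum of Blaschke products and squared Cauchy kernels, which is bounded in mean as soon as \<open>\<Lambda>\<close>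
  satisfies the Blaschke condition. It is enough to do so for finite subsets with uniform bounds.\<close>

section \<open>Averages over the unit circle\<close>

text \<open>The definition of the Smirnov class involves boundary values, which locally uniform
  limits do not control. Bounds on the means over interior circles do survive such limits, and this
  is why everything is phrased with \<open>log_bounded\<close>. The parameter \<open>c\<close>
  stands inside the logarithm so that constants can be absorbed without raising \<open>L\<close>: a
  difference costs a factor 1/2 in \<open>c\<close> but no ln 2 in \<open>L\<close>, which allows
  \<open>L\<close> to be arbitrarily small in the Smirnov case. Subharmonicity is obtained from real
  parts of polynomials: by Stone-Weierstrass they approximate \<open>log_plus\<close> of the modulus
  on a circle from above, and the maximum modulus principle for exponentials then gives majorants in
  the disc. Only finite Blaschke products are ever divided out or multiplied; \<open>B l\<close>
  enters as the infimum of the moduli of its finite subproducts. The Cauchy kernels are squared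
  because on the circle the modulus of \<open>peak_kernel l\<close> is 1 - |l|^2 times a Poisson
  kernel, so that its mean is 1 - |l|^2, a summable quantity under the Blaschke condition.\<close>

abbreviation circ :: "real measure" where
  "circ \<equiv> lebesgue_on {0..2 * pi}"

text \<open>Vector-valued, so that the complex Cauchy and Poisson integrals and the real logarithmic
  means obey one set of rules; the real case is \<open>circle_mean\<close>.\<close>

definition circle_average :: "(complex \<Rightarrow> 'a::euclidean_space) \<Rightarrow> 'a" where
  "circle_average u = (1 / (2 * pi)) *\<^sub>R (LINT \<theta>|circ. u (cis \<theta>))"

lemma circle_mean_eq_average: "circle_mean u = circle_average u"
  by (simp add: circle_mean_def circle_average_def set_lebesgue_integral_def integral_restrict_space)

lemma finite_measure_circ: "finite_measure circ"
  by (rule finite_measure_lebesgue_on) simp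

lemma measure_circ: "measure circ (space circ) = 2 * pi"
  by (simp add: measure_restrict_space)

lemma continuous_on_compose_cis:
  "continuous_on (sphere 0 1) u \<Longrightarrow> continuous_on A (\<lambda>\<theta>. u (cis \<theta>))"
  by (rule continuous_on_compose2[where t = "sphere 0 1"]) (auto intro!: continuous_intros)

lemma integrable_circ:
  fixes u :: "complex \<Rightarrow> 'a::euclidean_space"
  assumes "continuous_on (sphere 0 1) u"
  shows "integrable circ (\<lambda>\<theta>. u (cis \<theta>))"
  by (intro continuous_imp_integrable_real continuous_on_compose_cis assms)

lemma circle_average_const [simp]: "circle_average (\<lambda>_. c) = c"
  using measure_circ by (simp add: circle_average_def)

lemma circle_average_add:
  assumes "continuous_on (sphere 0 1) u" "continuous_on (sphere 0 1) v"
  shows "circle_average (\<lambda>z. u z + v z) = circle_average u + circle_average v"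
  using integrable_circ[OF assms(1)] integrable_circ[OF assms(2)]
  by (simp add: circle_average_def algebra_simps)

lemma circle_average_diff:
  assumes "continuous_on (sphere 0 1) u" "continuous_on (sphere 0 1) v"
  shows "circle_average (\<lambda>z. u z - v z) = circle_average u - circle_average v"
  using integrable_circ[OF assms(1)] integrable_circ[OF assms(2)]
  by (simp add: circle_average_def algebra_simps)

lemma circle_average_sum:
  assumes "\<And>i. i \<in> I \<Longrightarrow> continuous_on (sphere 0 1) (u i)"
  shows "circle_average (\<lambda>z. \<Sum>i\<in>I. u i z) = (\<Sum>i\<in>I. circle_average (u i))"
  using integrable_circ[OF assms]
  by (simp add: circle_average_def scaleR_sum_right Bochner_Integration.integral_sum)

lemma circle_average_bounded_linear:
  assumes "bounded_linear T" "continuous_on (sphere 0 1) u"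
  shows "circle_average (\<lambda>z. T (u z)) = T (circle_average u)"
  using integral_bounded_linear[OF assms(1) integrable_circ[OF assms(2)]]
  by (simp add: circle_average_def linear_cmul[OF bounded_linear.linear[OF assms(1)]])

lemma circle_average_mult_left:
  fixes u :: "complex \<Rightarrow> real"
  shows "circle_average (\<lambda>z. c * u z) = c * circle_average u"
  by (simp add: circle_average_def)

lemma circle_average_mono:
  fixes u v :: "complex \<Rightarrow> real"
  assumes "continuous_on (sphere 0 1) u" "continuous_on (sphere 0 1) v"
    and "\<And>z. cmod z = 1 \<Longrightarrow> u z \<le> v z"
  shows "circle_average u \<le> circle_average v"
  unfolding circle_average_def using assms
  by (intro scaleR_left_mono integral_mono integrable_circ) auto

lemma circle_average_cong:
  assumes "\<And>z. cmod z = 1 \<Longrightarrow> u z = v z"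
  shows "circle_average u = circle_average v"
  unfolding circle_average_def using assms by simp

lemma circle_average_nonneg:
  fixes u :: "complex \<Rightarrow> real"
  assumes "\<And>z. cmod z = 1 \<Longrightarrow> 0 \<le> u z"
  shows "0 \<le> circle_average u"
  unfolding circle_average_def using assms by (simp add: integral_nonneg_AE)

lemma circle_average_upper:
  fixes u :: "complex \<Rightarrow> real"
  assumes "continuous_on (sphere 0 1) u" and "\<And>z. cmod z = 1 \<Longrightarrow> u z \<le> c"
  shows "circle_average u \<le> c"
  using circle_average_mono[of u "\<lambda>_. c"] assms by simp

lemma norm_circle_average_le:
  fixes u :: "complex \<Rightarrow> 'a::euclidean_space"
  shows "norm (circle_average u) \<le> circle_average (\<lambda>z. norm (u z))"
  unfolding circle_average_def by (auto intro!: divide_right_mono integral_norm_bound)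

lemma circle_average_uniform_limit:
  fixes u :: "nat \<Rightarrow> complex \<Rightarrow> real"
  assumes cont: "\<And>n. continuous_on (sphere 0 1) (u n)"
    and lim: "uniform_limit (sphere 0 1) u v sequentially"
  shows "(\<lambda>n. circle_average (u n)) \<longlonglongrightarrow> circle_average v"
proof -
  have contv: "continuous_on (sphere 0 1) v"
    by (rule uniform_limit_theorem[OF _ lim]) (auto simp: cont)
  have "\<bar>circle_average (u n) - circle_average v\<bar> \<le> e" if "\<forall>z\<in>sphere 0 1. dist (u n z) (v z) < e" for n e
  proof -
    have "\<bar>circle_average (u n) - circle_average v\<bar> = \<bar>circle_average (\<lambda>z. u n z - v z)\<bar>"
      by (simp add: circle_average_diff cont contv)
    also have "\<dots> \<le> circle_average (\<lambda>z. \<bar>u n z - v z\<bar>)"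
      using norm_circle_average_le[of "\<lambda>z. u n z - v z"] by simp
    also have "\<dots> \<le> e"
      using that by (intro circle_average_upper continuous_intros cont contv) (force simp: dist_real_def)
    finally show ?thesis .
  qed
  then have le: "dist (circle_average (u n)) (circle_average v) \<le> e"
    if "\<forall>z\<in>sphere 0 1. dist (u n z) (v z) < e" for n e
    using that by (simp add: dist_real_def)
  show ?thesis
  proof (rule tendstoI)
    fix e :: real assume "0 < e"
    then have "\<forall>\<^sub>F n in sequentially. \<forall>z\<in>sphere 0 1. dist (u n z) (v z) < e / 2"
      by (intro uniform_limitD[OF lim]) simp
    then show "\<forall>\<^sub>F n in sequentially. dist (circle_average (u n)) (circle_average v) < e"
    proof eventually_elim
      case (elim n)
      then show ?case using le[OF elim] \<open>0 < e\<close> by linarith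
    qed
  qed
qed

text \<open>With w = cis \<theta>, the form dw / (2 pi i (w - z)) becomes d\<theta> / (2 pi) times w
  / (w - z).\<close>

lemma Cauchy_formula_circle_average:
  assumes h: "h holomorphic_on ball 0 R" and R: "1 < R" and z: "cmod z < 1"
  shows "circle_average (\<lambda>w. h w * (w / (w - z))) = h z"
proof -
  have hc: "h holomorphic_on cball 0 1"
    by (rule holomorphic_on_subset[OF h]) (use R in auto)
  have "((\<lambda>u. h u / (u - z)) has_contour_integral (2 * of_real pi * \<i> * h z)) (circlepath 0 1)"
    by (rule Cauchy_integral_circlepath_simple[OF hc]) (use z in auto)
  then have "((\<lambda>t. h (0 + 1 * cis t) / (0 + 1 * cis t - z) * of_real 1 * \<i> * cis t) has_integral
      (2 * of_real pi * \<i> * h z)) {0..2*pi}"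
    unfolding circlepath_def by (subst (asm) has_contour_integral_part_circlepath_iff) auto
  then have "((\<lambda>t. (1 / \<i>) * (h (cis t) / (cis t - z) * \<i> * cis t)) has_integral
      (1 / \<i>) * (2 * of_real pi * \<i> * h z)) {0..2*pi}"
    by (intro has_integral_mult_right) simp
  then have hi: "((\<lambda>t. h (cis t) * (cis t / (cis t - z))) has_integral 2 * of_real pi * h z) {0..2*pi}"
    by (simp add: field_simps)
  have cont: "continuous_on (sphere 0 1) (\<lambda>w. h w * (w / (w - z)))"
    using z by (intro continuous_intros holomorphic_on_imp_continuous_on holomorphic_on_subset[OF hc]) auto
  have "(LINT t|circ. h (cis t) * (cis t / (cis t - z))) = 2 * of_real pi * h z"
    using lebesgue_integral_eq_integral[OF integrable_circ[OF cont]] integral_unique[OF hi] by simp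
  then show ?thesis
    by (simp add: circle_average_def scaleR_conv_of_real)
qed

lemma mean_value_property:
  assumes "h holomorphic_on ball 0 R" and "1 < R"
  shows "circle_average h = h 0"
proof -
  have "circle_average h = circle_average (\<lambda>w. h w * (w / (w - 0)))"
    by (rule circle_average_cong) auto
  then show ?thesis
    using Cauchy_formula_circle_average[OF assms, of 0] by simp
qed

section \<open>The Poisson kernel\<close>

definition poisson_kernel :: "complex \<Rightarrow> complex \<Rightarrow> real" where
  "poisson_kernel z w = (1 - (cmod z)\<^sup>2) / (cmod (w - z))\<^sup>2"

lemma poisson_kernel_nonneg: "cmod z < 1 \<Longrightarrow> 0 \<le> poisson_kernel z w"
  by (simp add: poisson_kernel_def abs_square_le_1)

lemma continuous_on_poisson_kernel: "cmod z < 1 \<Longrightarrow> continuous_on (sphere 0 1) (poisson_kernel z)"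
  unfolding poisson_kernel_def by (intro continuous_intros) auto

lemma poisson_kernel_upper:
  assumes z: "cmod z < 1" and w: "cmod w = 1"
  shows "poisson_kernel z w \<le> (1 + cmod z) / (1 - cmod z)"
proof -
  have "1 - cmod z \<le> cmod (w - z)"
    using norm_triangle_ineq2[of w z] w by simp
  then have "(1 - cmod z)\<^sup>2 \<le> (cmod (w - z))\<^sup>2"
    using z by (intro power_mono) auto
  then have "poisson_kernel z w \<le> (1 - (cmod z)\<^sup>2) / (1 - cmod z)\<^sup>2"
    unfolding poisson_kernel_def
    by (rule divide_left_mono) (use z w in \<open>auto simp: abs_square_le_1 intro!: mult_pos_pos\<close>)
  also have "\<dots> = (1 + cmod z) / (1 - cmod z)"
  proof -
    have "1 - (cmod z)\<^sup>2 = (1 - cmod z) * (1 + cmod z)"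
      by (simp add: power2_eq_square algebra_simps)
    then show ?thesis
      using z by (simp add: power2_eq_square)
  qed
  finally show ?thesis .
qed

lemma norm_one_minus_cnj_mult:
  assumes "cmod w = 1"
  shows "cmod (1 - cnj z * w) = cmod (w - z)"
proof -
  have "1 - cnj z * w = w * cnj (w - z)"
    using assms complex_norm_square[of w] by (simp add: algebra_simps)
  then have "cmod (1 - cnj z * w) = cmod w * cmod (cnj (w - z))"
    by (metis norm_mult)
  then show ?thesis
    using assms by (simp only: complex_mod_cnj mult_1_left)
qed

text \<open>Divided by the left-hand side, this identity is the formula for 1 - |b|^2 of a Blaschke
  factor b, and so the source of the estimates of |b| below.\<close>

lemma one_minus_mult_cnj:
  fixes z w :: complex
  shows "(cmod (1 - cnj z * w))\<^sup>2 = (1 - (cmod z)\<^sup>2) * (1 - (cmod w)\<^sup>2) + (cmod (w - z))\<^sup>2"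
  by (cases z, cases w) (simp add: cmod_power2, simp add: power2_eq_square algebra_simps)

text \<open>The Poisson formula for \<open>h\<close> at \<open>z\<close> is the Cauchy formula for
  \<open>w \<mapsto> h w (1 - \<bar>z\<bar>\<^sup>2) / (1 - cnj z w)\<close> at \<open>z\<close>.\<close>

lemma Poisson_formula:
  assumes h: "h holomorphic_on ball 0 R" and R: "1 < R" and z: "cmod z < 1"
  shows "circle_average (\<lambda>w. poisson_kernel z w *\<^sub>R h w) = h z"
proof -
  \<comment> \<open>The added factor 1 / (1 - cnj z w) has its pole at modulus 1 / |z| > 1; the case
    \<open>z = 0\<close> is separate because division by 0 gives 0.\<close>
  define R' where "R' = (if z = 0 then R else min R (1 / cmod z))"
  have R': "1 < R'" "R' \<le> R"
    using R z by (auto simp: R'_def)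
  define H where "H w = h w * (of_real (1 - (cmod z)\<^sup>2) / (1 - cnj z * w))" for w
  have nz: "1 - cnj z * w \<noteq> 0" if "cmod w < R'" for w
  proof
    assume "1 - cnj z * w = 0"
    then have "cmod (cnj z * w) = 1" by (metis eq_iff_diff_eq_0 norm_one)
    then have "cmod z * cmod w = 1" by (simp add: norm_mult)
    moreover from this have "z \<noteq> 0" by auto
    ultimately show False
      using that by (auto simp: R'_def field_simps)
  qed
  have "H holomorphic_on ball 0 R'"
    unfolding H_def using R' nz by (intro holomorphic_intros holomorphic_on_subset[OF h]) auto
  from Cauchy_formula_circle_average[OF this R'(1) z]
  have "circle_average (\<lambda>w. H w * (w / (w - z))) = H z" .
  moreover have "H z = h z"
  proof -
    have "(cmod z)\<^sup>2 \<noteq> 1"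
      using z norm_ge_zero[of z] unfolding power2_eq_1_iff by linarith
    then have "complex_of_real (1 - (cmod z)\<^sup>2) \<noteq> 0"
      by (simp only: of_real_eq_0_iff)
    moreover have "1 - cnj z * z = of_real (1 - (cmod z)\<^sup>2)"
      using complex_norm_square[of z] by (simp add: mult.commute)
    ultimately have "of_real (1 - (cmod z)\<^sup>2) / (1 - cnj z * z) = (1::complex)"
      by simp
    then show ?thesis
      unfolding H_def by simp
  qed
  moreover have "H w * (w / (w - z)) = poisson_kernel z w *\<^sub>R h w" if w: "cmod w = 1" for w
  proof -
    have "w \<noteq> z" using w z by auto
    have w2: "w * cnj w = 1" using w complex_norm_square[of w] by simp
    \<comment> \<open>Here |w| = 1 enters: it turns the product of the two denominators into w |w -
      z|^2, which contains the denominator of the Poisson kernel.\<close>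
    have "(1 - cnj z * w) * (w - z) = w * ((w - z) * cnj (w - z))"
      using w2 by (simp add: algebra_simps)
    then have eq: "(1 - cnj z * w) * (w - z) = w * of_real ((cmod (w - z))\<^sup>2)"
      by (simp only: complex_norm_square)
    have "H w * (w / (w - z)) = h w * (of_real (1 - (cmod z)\<^sup>2) * w / ((1 - cnj z * w) * (w - z)))"
      by (simp add: H_def mult.assoc)
    moreover have "w \<noteq> 0" using w by auto
    ultimately show ?thesis
      unfolding poisson_kernel_def scaleR_conv_of_real of_real_divide eq by (simp add: mult.commute)
  qed
  ultimately show ?thesis
    using circle_average_cong[of "\<lambda>w. H w * (w / (w - z))" "\<lambda>w. poisson_kernel z w *\<^sub>R h w"] by simp
qed

lemma circle_average_poisson_kernel:
  assumes "cmod z < 1"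
  shows "circle_average (poisson_kernel z) = 1"
proof -
  have "circle_average (\<lambda>w. poisson_kernel z w *\<^sub>R (1::complex)) = 1"
    by (rule Poisson_formula[where R=2]) (use assms in auto)
  moreover have "circle_average (\<lambda>w. Re (poisson_kernel z w *\<^sub>R (1::complex))) = Re (circle_average (\<lambda>w. poisson_kernel z w *\<^sub>R (1::complex)))"
    by (intro circle_average_bounded_linear bounded_linear_Re continuous_intros continuous_on_poisson_kernel assms)
  ultimately show ?thesis by simp
qed

section \<open>Harmonic majorants\<close>

text \<open>Induction removes the constant coefficients of both polynomials. The cross terms involve
  only one polynomial each, so they are holomorphic up to a conjugation that Re does not see, and z
  cnj z = 1 reduces the rest to lower degree. This closes real parts of polynomials under
  multiplication on the circle.\<close>

lemma sphere_Re_mult_poly: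
  fixes p q :: "complex poly"
  shows "\<exists>s. \<forall>z\<in>sphere 0 1. Re (poly p z * cnj (poly q z)) = Re (poly s z)"
proof (induction p arbitrary: q)
  case 0
  then show ?case by (intro exI[of _ 0]) simp
next
  case (pCons a p)
  obtain b q' where q: "q = pCons b q'" by (cases q)
  obtain s where s: "\<And>z. z \<in> sphere 0 1 \<Longrightarrow> Re (poly p z * cnj (poly q' z)) = Re (poly s z)"
    using pCons.IH by metis
  show ?case
  proof (intro exI ballI)
    fix z :: complex assume z: "z \<in> sphere 0 1"
    have zz: "z * cnj z = 1" using z complex_norm_square[of z] by simp
    have "poly (pCons a p) z * cnj (poly q z)
        = a * cnj (poly q z) + z * poly p z * cnj b + (z * cnj z) * (poly p z * cnj (poly q' z))"
      unfolding q by (simp add: algebra_simps)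
    also have "Re \<dots> = Re (cnj a * poly q z) + Re (cnj b * (z * poly p z)) + Re (poly s z)"
    proof -
      have "Re (a * cnj (poly q z)) = Re (cnj a * poly q z)"
        by simp
      moreover have "z * poly p z * cnj b = cnj b * (z * poly p z)"
        by (simp only: mult_ac)
      ultimately show ?thesis
        using s[OF z] by (simp only: zz plus_complex.sel mult_1_left)
    qed
    also have "\<dots> = Re (cnj a * poly q z + cnj b * (z * poly p z) + poly s z)"
      by (simp only: plus_complex.sel)
    also have "cnj a * poly q z + cnj b * (z * poly p z) + poly s z
        = poly (smult (cnj a) q + smult (cnj b) (pCons 0 p) + s) z"
      by simp
    finally show "Re (poly (pCons a p) z * cnj (poly q z))
        = Re (poly (smult (cnj a) q + smult (cnj b) (pCons 0 p) + s) z)" .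
  qed
qed

text \<open>Stone-Weierstrass is applied to real parts of polynomials because such approximants
  extend harmonically to the disc, with a known value at 0. This replaces solving a Dirichlet
  problem.\<close>

lemma circle_real_part_approx:
  fixes \<phi> :: "complex \<Rightarrow> real"
  assumes "continuous_on (sphere 0 1) \<phi>" and "0 < e"
  obtains p :: "complex poly" where "\<And>z. cmod z = 1 \<Longrightarrow> \<bar>\<phi> z - Re (poly p z)\<bar> < e"
proof -
  define A :: "(complex \<Rightarrow> real) set"
    where "A = {f. \<exists>p. \<forall>z\<in>sphere 0 1. f z = Re (poly p z)}"
  interpret ring: function_ring_on A "sphere (0::complex) 1"
  proof
    show "compact (sphere (0::complex) 1)" by simp
    show "continuous_on (sphere 0 1) f" if "f \<in> A" for f
    proof -
      from that obtain p where "\<forall>z\<in>sphere 0 1. f z = Re (poly p z)" by (auto simp: A_def)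
      then show ?thesis
        by (subst continuous_on_cong[OF refl, of _ f "\<lambda>z. Re (poly p z)"]) (auto intro!: continuous_intros)
    qed
    show "(\<lambda>x. f x + g x) \<in> A" if "f \<in> A" "g \<in> A" for f g
    proof -
      from that obtain p q where "\<forall>z\<in>sphere 0 1. f z = Re (poly p z)" "\<forall>z\<in>sphere 0 1. g z = Re (poly q z)"
        by (auto simp: A_def)
      then have "\<forall>z\<in>sphere 0 1. f z + g z = Re (poly (p + q) z)" by simp
      then show ?thesis unfolding A_def by blast
    qed
    show "(\<lambda>x. f x * g x) \<in> A" if "f \<in> A" "g \<in> A" for f g
    proof -
      from that obtain p q where pq: "\<forall>z\<in>sphere 0 1. f z = Re (poly p z)" "\<forall>z\<in>sphere 0 1. g z = Re (poly q z)"
        by (auto simp: A_def)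
      obtain s where s: "\<forall>z\<in>sphere 0 1. Re (poly p z * cnj (poly q z)) = Re (poly s z)"
        using sphere_Re_mult_poly by blast
      \<comment> \<open>From Re p Re q = (Re (p q) + Re (p cnj q)) / 2.\<close>
      have "\<forall>z\<in>sphere 0 1. f z * g z = Re (poly (smult (1/2) (p * q + s)) z)"
        using pq s by (auto simp: field_simps)
      then show ?thesis unfolding A_def by blast
    qed
    show "(\<lambda>_. c) \<in> A" for c
      unfolding A_def by (intro CollectI exI[of _ "[:of_real c:]"]) simp
    show "\<exists>f\<in>A. f x \<noteq> f y" if "x \<in> sphere 0 1" "y \<in> sphere 0 1" "x \<noteq> y" for x y
    proof (cases "Re x = Re y")
      case False
      have "Re \<in> A" unfolding A_def by (intro CollectI exI[of _ "[:0,1:]"]) simp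
      then show ?thesis using False by blast
    next
      case True
      with that have "Im x \<noteq> Im y" by (auto simp: complex_eq_iff)
      moreover have "Im \<in> A" unfolding A_def by (intro CollectI exI[of _ "[:0,-\<i>:]"]) simp
      ultimately show ?thesis by blast
    qed
  qed
  obtain g where "g \<in> A" "\<forall>x\<in>sphere 0 1. \<bar>\<phi> x - g x\<bar> < e"
    using ring.Stone_Weierstrass_basic[OF assms] by blast
  then obtain p where "\<And>z. z \<in> sphere 0 1 \<Longrightarrow> \<bar>\<phi> z - Re (poly p z)\<bar> < e"
    by (force simp: A_def)
  then show ?thesis by (intro that[of p]) simp
qed

section \<open>The positive part of the logarithm\<close>

lemma log_plus_eq: "0 \<le> x \<Longrightarrow> log_plus x = ln (max 1 x)"
  unfolding log_plus_def by (cases "x = 0") (auto simp: max_def)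

lemma log_plus_nonneg: "0 \<le> log_plus x"
  by (simp add: log_plus_def)

lemma log_plus_mono: "0 \<le> x \<Longrightarrow> x \<le> y \<Longrightarrow> log_plus x \<le> log_plus y"
  by (simp add: log_plus_eq)

lemma log_plus_le_iff: "0 \<le> x \<Longrightarrow> 0 \<le> c \<Longrightarrow> log_plus x \<le> c \<longleftrightarrow> x \<le> exp c"
  using exp_le_cancel_iff[of "ln (max 1 x)" c] by (simp add: log_plus_eq)

lemma le_exp_log_plus: "0 \<le> x \<Longrightarrow> x \<le> exp (log_plus x)"
  by (simp add: log_plus_eq)

lemma log_plus_le_self: "0 \<le> x \<Longrightarrow> log_plus x \<le> x"
  by (subst log_plus_le_iff) (use exp_ge_add_one_self[of x] in linarith)+

lemma log_plus_mult_le: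
  assumes "0 \<le> x" "0 \<le> y"
  shows "log_plus (x * y) \<le> log_plus x + log_plus y"
proof -
  have "x * y \<le> exp (log_plus x) * exp (log_plus y)"
    using assms by (intro mult_mono le_exp_log_plus) auto
  then show ?thesis
    using assms by (subst log_plus_le_iff) (auto simp: log_plus_nonneg exp_add)
qed

text \<open>The mean of x and y is at most their maximum, so no additive ln 2 appears. This keeps
  arbitrarily small bounds \<open>L\<close> available for differences; only the factor
  \<open>c\<close> is halved.\<close>

lemma log_plus_add_le:
  assumes "0 \<le> x" "0 \<le> y"
  shows "log_plus ((x + y) / 2) \<le> log_plus x + log_plus y"
proof -
  have "log_plus ((x + y) / 2) \<le> log_plus (max x y)"
    using assms by (intro log_plus_mono) auto
  also have "\<dots> \<le> log_plus x + log_plus y"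
    using log_plus_nonneg[of x] log_plus_nonneg[of y] by (auto simp: max_def)
  finally show ?thesis .
qed

lemma continuous_on_log_plus [continuous_intros]:
  assumes "continuous_on A f" "\<And>x. x \<in> A \<Longrightarrow> 0 \<le> f x"
  shows "continuous_on A (\<lambda>x. log_plus (f x))"
proof -
  have "continuous_on A (\<lambda>x. ln (max 1 (f x)))"
    by (intro continuous_intros assms) auto
  then show ?thesis
    by (rule continuous_on_eq) (simp add: assms log_plus_eq)
qed

lemma disc_maximum_modulus:
  assumes h: "h holomorphic_on ball 0 R" and R: "1 < R"
    and le: "\<And>z. cmod z = 1 \<Longrightarrow> cmod (h z) \<le> B" and z: "cmod z \<le> 1"
  shows "cmod (h z) \<le> B"
proof (rule maximum_modulus_frontier[of h "cball 0 1"])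
  have hc: "h holomorphic_on cball 0 1"
    by (rule holomorphic_on_subset[OF h]) (use R in auto)
  then show "h holomorphic_on interior (cball 0 1)"
    by (rule holomorphic_on_subset) auto
  show "continuous_on (closure (cball 0 1)) h"
    using holomorphic_on_imp_continuous_on[OF hc] by simp
qed (use le z in auto)

lemma circle_average_poly: "circle_average (poly p) = poly p 0"
  by (rule mean_value_property[of _ 2]) (auto intro!: holomorphic_intros)

text \<open>The polynomial is chosen so that its real part lies between log+ |F| and log+ |F| + e on
  the circle. The maximum modulus principle for exp (-p) and F exp (-p) carries both lower bounds
  into the disc, and the mean value property gives the value at 0.\<close>

lemma harmonic_majorant:
  assumes F: "F holomorphic_on ball 0 R" and R: "1 < R" and e: "0 < e"
  obtains p :: "complex poly" where
    "\<And>z. cmod z \<le> 1 \<Longrightarrow> 0 \<le> Re (poly p z)"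
    "\<And>z. cmod z \<le> 1 \<Longrightarrow> cmod (F z) \<le> exp (Re (poly p z))"
    "Re (poly p 0) \<le> circle_average (\<lambda>z. log_plus (cmod (F z))) + e"
proof -
  have Fc: "continuous_on (sphere 0 1) F"
    by (intro holomorphic_on_imp_continuous_on holomorphic_on_subset[OF F]) (use R in auto)
  have lc: "continuous_on (sphere 0 1) (\<lambda>z. log_plus (cmod (F z)))"
    by (intro continuous_intros Fc) auto
  \<comment> \<open>The shift by e / 2 makes an approximation within e / 2 a majorant.\<close>
  then have "continuous_on (sphere 0 1) (\<lambda>z. log_plus (cmod (F z)) + e / 2)"
    by (rule continuous_on_add) (rule continuous_on_const)
  then obtain p :: "complex poly" where
    p: "\<And>z. cmod z = 1 \<Longrightarrow> \<bar>log_plus (cmod (F z)) + e / 2 - Re (poly p z)\<bar> < e / 2"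
    by (rule circle_real_part_approx[of _ "e / 2"]) (use e in auto)
  have lower: "log_plus (cmod (F z)) \<le> Re (poly p z)"
    and upper: "Re (poly p z) \<le> log_plus (cmod (F z)) + e" if "cmod z = 1" for z
    using p[OF that] by linarith+
  have "cmod (exp (- poly p z)) \<le> 1" if "cmod z \<le> 1" for z
  proof (rule disc_maximum_modulus[OF _ R _ that])
    show "(\<lambda>z. exp (- poly p z)) holomorphic_on ball 0 R"
      by (intro holomorphic_intros)
  qed (use lower log_plus_nonneg in \<open>auto intro: order_trans\<close>)
  then have 1: "0 \<le> Re (poly p z)" if "cmod z \<le> 1" for z
    using that by simp
  have "cmod (F z * exp (- poly p z)) \<le> 1" if "cmod z \<le> 1" for z
  proof (rule disc_maximum_modulus[OF _ R _ that])
    show "(\<lambda>z. F z * exp (- poly p z)) holomorphic_on ball 0 R"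
      by (intro holomorphic_intros F)
    fix z :: complex assume z: "cmod z = 1"
    have "cmod (F z) \<le> exp (log_plus (cmod (F z)))"
      by (simp add: le_exp_log_plus)
    also have "\<dots> \<le> exp (Re (poly p z))"
      using lower[OF z] by simp
    finally show "cmod (F z * exp (- poly p z)) \<le> 1"
      by (simp add: norm_mult norm_divide exp_minus field_simps)
  qed
  then have 2: "cmod (F z) \<le> exp (Re (poly p z))" if "cmod z \<le> 1" for z
    using that by (simp add: norm_mult norm_divide exp_minus field_simps)
  have "Re (poly p 0) = circle_average (\<lambda>z. Re (poly p z))"
    by (subst circle_average_bounded_linear[OF bounded_linear_Re])
       (auto simp: circle_average_poly intro!: continuous_intros)
  also have "\<dots> \<le> circle_average (\<lambda>z. log_plus (cmod (F z)) + e)"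
    by (intro circle_average_mono upper continuous_intros lc)
  also have "\<dots> = circle_average (\<lambda>z. log_plus (cmod (F z))) + e"
    by (subst circle_average_add) (auto intro: lc)
  finally have 3: "Re (poly p 0) \<le> circle_average (\<lambda>z. log_plus (cmod (F z))) + e" .
  show ?thesis
    by (rule that[OF 1 2 3])
qed

text \<open>The upper half of Harnack's inequality: in the Poisson formula the kernel is bounded by
  its largest value, and what remains is the mean, which is the value at 0.\<close>

lemma Harnack_poly:
  fixes p :: "complex poly"
  assumes nonneg: "\<And>z. cmod z \<le> 1 \<Longrightarrow> 0 \<le> Re (poly p z)" and z: "cmod z < 1"
  shows "Re (poly p z) \<le> (1 + cmod z) / (1 - cmod z) * Re (poly p 0)"
proof -
  have cont: "continuous_on (sphere 0 1) (poly p)" "continuous_on (sphere 0 1) (poisson_kernel z)"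
    by (auto intro!: continuous_intros continuous_on_poisson_kernel z)
  have "Re (poly p z) = Re (circle_average (\<lambda>w. poisson_kernel z w *\<^sub>R poly p w))"
    by (subst Poisson_formula[of _ 2]) (auto intro!: holomorphic_intros z)
  also have "\<dots> = circle_average (\<lambda>w. Re (poisson_kernel z w *\<^sub>R poly p w))"
    by (rule circle_average_bounded_linear[OF bounded_linear_Re, symmetric])
       (intro continuous_intros cont)
  also have "\<dots> \<le> circle_average (\<lambda>w. (1 + cmod z) / (1 - cmod z) * Re (poly p w))"
  proof (rule circle_average_mono)
    fix w :: complex assume w: "cmod w = 1"
    show "Re (poisson_kernel z w *\<^sub>R poly p w) \<le> (1 + cmod z) / (1 - cmod z) * Re (poly p w)"
      using mult_right_mono[OF poisson_kernel_upper[OF z w] nonneg[of w]] w by simp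
  qed (intro continuous_intros cont)+
  also have "\<dots> = (1 + cmod z) / (1 - cmod z) * Re (circle_average (poly p))"
    by (simp only: circle_average_mult_left circle_average_bounded_linear[OF bounded_linear_Re cont(1)])
  also have "circle_average (poly p) = poly p 0"
    by (rule circle_average_poly)
  finally show ?thesis .
qed

section \<open>Bounds on logarithmic means\<close>

definition log_mean :: "real \<Rightarrow> (complex \<Rightarrow> complex) \<Rightarrow> real \<Rightarrow> real" where
  "log_mean c f r = circle_average (\<lambda>w. log_plus (c * cmod (f (of_real r * w))))"

text \<open>The class \<open>K(c, L)\<close> of the overview.\<close>

definition log_bounded :: "real \<Rightarrow> real \<Rightarrow> (complex \<Rightarrow> complex) set" where
  "log_bounded c L = {f. f holomorphic_on ball 0 1 \<and> (\<forall>r\<in>{0<..<1}. log_mean c f r \<le> L)}"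

lemma log_boundedD: "f \<in> log_bounded c L \<Longrightarrow> 0 < r \<Longrightarrow> r < 1 \<Longrightarrow> log_mean c f r \<le> L"
  by (simp add: log_bounded_def)

lemma log_bounded_holomorphic: "f \<in> log_bounded c L \<Longrightarrow> f holomorphic_on ball 0 1"
  by (simp add: log_bounded_def)

lemma holomorphic_dilate:
  assumes "f holomorphic_on ball 0 1" "0 < r"
  shows "(\<lambda>w. f (of_real r * w)) holomorphic_on ball 0 (1 / r)"
proof -
  have "(f \<circ> (\<lambda>w. of_real r * w)) holomorphic_on ball 0 (1 / r)"
    by (rule holomorphic_on_compose_gen[OF _ assms(1)])
       (use assms(2) in \<open>auto intro!: holomorphic_intros simp: norm_mult field_simps\<close>)
  then show ?thesis by (simp add: o_def)
qed

lemma continuous_on_circle_dilate: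
  assumes "f holomorphic_on ball 0 1" "0 \<le> r" "r < 1"
  shows "continuous_on (sphere 0 1) (\<lambda>w. f (of_real r * w))"
  by (rule continuous_on_compose2[OF holomorphic_on_imp_continuous_on[OF assms(1)]])
     (use assms in \<open>auto intro!: continuous_intros simp: norm_mult\<close>)

lemma continuous_on_circle_log_plus:
  assumes "f holomorphic_on ball 0 1" "0 \<le> r" "r < 1" "0 \<le> c"
  shows "continuous_on (sphere 0 1) (\<lambda>w. log_plus (c * cmod (f (of_real r * w))))"
  by (intro continuous_intros continuous_on_circle_dilate) (use assms in auto)

lemma log_mean_nonneg: "0 \<le> log_mean c f r"
  unfolding log_mean_def by (intro circle_average_nonneg log_plus_nonneg)

lemma log_mean_majorant:
  assumes f: "f holomorphic_on ball 0 1" and r: "0 < r" "r < 1" and c: "0 \<le> c" and e: "0 < e"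
  obtains p :: "complex poly" where
    "\<And>z. cmod z \<le> 1 \<Longrightarrow> 0 \<le> Re (poly p z)"
    "\<And>z. cmod z \<le> 1 \<Longrightarrow> c * cmod (f (of_real r * z)) \<le> exp (Re (poly p z))"
    "Re (poly p 0) \<le> log_mean c f r + e"
proof -
  have "(\<lambda>w. of_real c * f (of_real r * w)) holomorphic_on ball 0 (1 / r)"
    by (intro holomorphic_intros holomorphic_dilate f r)
  moreover have "1 < 1 / r" using r by simp
  ultimately show ?thesis
    by (rule harmonic_majorant[OF _ _ e])
       (use c in \<open>auto intro!: that simp: log_mean_def norm_mult\<close>)
qed

text \<open>Subharmonicity: a majorant that is nearly optimal on the circle of radius s also
  dominates on the smaller circle, where its mean is still its value at 0.\<close>

lemma log_mean_mono:
  assumes f: "f holomorphic_on ball 0 1" and r: "0 \<le> r" "r \<le> s" "s < 1" and c: "0 \<le> c"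
  shows "log_mean c f r \<le> log_mean c f s"
proof (cases "s = 0")
  case True
  then show ?thesis using r by simp
next
  case False
  with r have s: "0 < s" "s < 1" by auto
  show ?thesis
  proof (rule field_le_epsilon)
    fix e :: real assume "0 < e"
    from log_mean_majorant[OF f s c this] obtain p :: "complex poly" where
      nonneg: "\<And>z. cmod z \<le> 1 \<Longrightarrow> 0 \<le> Re (poly p z)"
      and le: "\<And>z. cmod z \<le> 1 \<Longrightarrow> c * cmod (f (of_real s * z)) \<le> exp (Re (poly p z))"
      and p0: "Re (poly p 0) \<le> log_mean c f s + e" by blast
    have cont: "continuous_on (sphere 0 1) (\<lambda>w. poly p (of_real (r / s) * w))"
      by (intro continuous_intros)
    have "log_plus (c * cmod (f (of_real r * w))) \<le> Re (poly p (of_real (r / s) * w))"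
      if w: "cmod w = 1" for w
    proof -
      have le1: "cmod (of_real (r / s) * w) \<le> 1"
        using w r s by (simp add: norm_mult norm_divide)
      show ?thesis
        using le[OF le1] nonneg[OF le1] c s by (subst log_plus_le_iff) auto
    qed
    then have "log_mean c f r \<le> circle_average (\<lambda>w. Re (poly p (of_real (r / s) * w)))"
      unfolding log_mean_def using r s c
      by (intro circle_average_mono continuous_intros continuous_on_circle_log_plus f) auto
    also have "\<dots> = Re (circle_average (\<lambda>w. poly p (of_real (r / s) * w)))"
      by (rule circle_average_bounded_linear[OF bounded_linear_Re cont])
    also have "circle_average (\<lambda>w. poly p (of_real (r / s) * w)) = poly p 0"
      by (subst mean_value_property[of _ 2]) (auto intro!: holomorphic_intros)
    finally show "log_mean c f r \<le> log_mean c f s + e"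
      using p0 by linarith
  qed
qed

text \<open>Harnack's inequality for the majorants on circles of radius r, followed by r
  \<rightarrow> 1.\<close>

lemma log_bounded_pointwise:
  assumes f: "f \<in> log_bounded c L" and c: "0 \<le> c" and z: "cmod z < 1"
  shows "c * cmod (f z) \<le> exp ((1 + cmod z) / (1 - cmod z) * L)"
proof -
  have hol: "f holomorphic_on ball 0 1" using f by (rule log_bounded_holomorphic)
  define r0 where "r0 = (1 + cmod z) / 2"
  have r0: "cmod z < r0" "0 < r0" "r0 < 1" using z by (auto simp: r0_def add_pos_nonneg)
  \<comment> \<open>The error allowed in the majorant is 1 - r, so that it disappears in the
    limit.\<close>
  have ev: "c * cmod (f z) \<le> exp ((1 + cmod z / r) / (1 - cmod z / r) * (L + (1 - r)))"
    if r: "r0 < r" "r < 1" for r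
  proof -
    have r': "0 < r" "r < 1" "0 < 1 - r" using r r0 by auto
    from log_mean_majorant[OF hol r'(1,2) c r'(3)] obtain p :: "complex poly" where
      nonneg: "\<And>z. cmod z \<le> 1 \<Longrightarrow> 0 \<le> Re (poly p z)"
      and le: "\<And>z. cmod z \<le> 1 \<Longrightarrow> c * cmod (f (of_real r * z)) \<le> exp (Re (poly p z))"
      and p0: "Re (poly p 0) \<le> log_mean c f r + (1 - r)" by blast
    have zr: "cmod (z / of_real r) < 1"
      using r r0 by (simp add: norm_divide)
    have nz: "cmod (z / of_real r) = cmod z / r"
      using r' by (simp add: norm_divide)
    have "c * cmod (f z) \<le> exp (Re (poly p (z / of_real r)))"
      using le[of "z / of_real r"] zr r' by simp
    also have "Re (poly p (z / of_real r)) \<le> (1 + cmod z / r) / (1 - cmod z / r) * Re (poly p 0)"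
      using Harnack_poly[OF nonneg zr] by (simp only: nz)
    also have "\<dots> \<le> (1 + cmod z / r) / (1 - cmod z / r) * (L + (1 - r))"
    proof (rule mult_left_mono)
      show "Re (poly p 0) \<le> L + (1 - r)"
        using p0 f r' by (force simp: log_bounded_def)
      show "0 \<le> (1 + cmod z / r) / (1 - cmod z / r)"
        using zr r' unfolding nz by (intro divide_nonneg_pos add_nonneg_nonneg) auto
    qed
    finally show ?thesis by simp
  qed
  have "((\<lambda>r. exp ((1 + cmod z / r) / (1 - cmod z / r) * (L + (1 - r)))) \<longlongrightarrow>
      exp ((1 + cmod z / 1) / (1 - cmod z / 1) * (L + (1 - 1)))) (at_left 1)"
    using z by (intro tendsto_intros) auto
  moreover have "\<forall>\<^sub>F r in at_left 1. c * cmod (f z) \<le> exp ((1 + cmod z / r) / (1 - cmod z / r) * (L + (1 - r)))"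
    using eventually_at_left_real[OF r0(3)] by eventually_elim (use ev in auto)
  ultimately have "c * cmod (f z) \<le> exp ((1 + cmod z / 1) / (1 - cmod z / 1) * (L + (1 - 1)))"
    by (intro tendsto_lowerbound) auto
  then show ?thesis by simp
qed

text \<open>\<open>log_plus\<close> is 1-Lipschitz on the nonnegative reals, so uniform convergence
  on a circle passes to the logarithmic means.\<close>

lemma log_bounded_uniform_limit:
  assumes f: "\<And>n. f n \<in> log_bounded c L" and c: "0 \<le> c"
    and g: "g holomorphic_on ball 0 1"
    and lim: "\<And>K. compact K \<Longrightarrow> K \<subseteq> ball 0 1 \<Longrightarrow> uniform_limit K f g sequentially"
  shows "g \<in> log_bounded c L"
  unfolding log_bounded_def
proof (intro CollectI conjI g ballI)
  fix r :: real assume r: "r \<in> {0<..<1}"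
  have lim_r: "uniform_limit (sphere 0 r) f g sequentially"
    by (rule lim) (use r in auto)
  have lim': "uniform_limit (sphere 0 1) (\<lambda>n w. log_plus (c * cmod (f n (of_real r * w))))
     (\<lambda>w. log_plus (c * cmod (g (of_real r * w)))) sequentially"
  proof (rule uniform_limitI)
    fix e :: real assume e: "0 < e"
    have lip: "\<bar>log_plus x - log_plus y\<bar> \<le> \<bar>x - y\<bar>" if "0 \<le> x" "0 \<le> y" for x y
    proof -
      have *: "log_plus x \<le> log_plus y + (x - y)" if "0 \<le> y" "y \<le> x" for x y
      proof -
        have "ln (max 1 x) - ln (max 1 y) \<le> (max 1 x - max 1 y) / max 1 y"
          by (rule ln_diff_le) auto
        also have "\<dots> \<le> (max 1 x - max 1 y) / 1"
          using that by (intro divide_left_mono) (auto simp: max_def)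
        also have "\<dots> \<le> x - y" using that by (auto simp: max_def)
        finally show ?thesis using that by (simp add: log_plus_eq)
      qed
      show ?thesis
        using *[of y x] *[of x y] log_plus_mono[of x y] log_plus_mono[of y x] that
        by (cases "x \<le> y") auto
    qed
    \<comment> \<open>The denominator is \<open>c + 1\<close> because \<open>c\<close> may be
      0.\<close>
    have "0 < e / (c + 1)" using e c by simp
    then have "\<forall>\<^sub>F n in sequentially. \<forall>z\<in>sphere 0 r. dist (f n z) (g z) < e / (c + 1)"
      by (rule uniform_limitD[OF lim_r])
    then show "\<forall>\<^sub>F n in sequentially. \<forall>w\<in>sphere 0 1.
        dist (log_plus (c * cmod (f n (of_real r * w)))) (log_plus (c * cmod (g (of_real r * w)))) < e"
    proof eventually_elim
      case (elim n)
      show ?case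
      proof
        fix w :: complex assume w: "w \<in> sphere 0 1"
        let ?z = "of_real r * w"
        have "?z \<in> sphere 0 r" using w r by (simp add: norm_mult)
        then have d: "cmod (f n ?z - g ?z) < e / (c + 1)"
          using elim by (simp add: dist_norm)
        have "\<bar>log_plus (c * cmod (f n ?z)) - log_plus (c * cmod (g ?z))\<bar> \<le> \<bar>c * cmod (f n ?z) - c * cmod (g ?z)\<bar>"
          using c by (intro lip) auto
        also have "\<dots> = c * \<bar>cmod (f n ?z) - cmod (g ?z)\<bar>"
          using c by (simp add: abs_mult flip: right_diff_distrib)
        also have "\<dots> \<le> c * (e / (c + 1))"
          using c d norm_triangle_ineq3[of "f n ?z" "g ?z"] by (intro mult_left_mono) auto
        also have "\<dots> < e" using c e by (simp add: field_simps)
        finally show "dist (log_plus (c * cmod (f n ?z))) (log_plus (c * cmod (g ?z))) < e"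
          by (simp add: dist_real_def)
      qed
    qed
  qed
  have "(\<lambda>n. log_mean c (f n) r) \<longlonglongrightarrow> log_mean c g r"
    unfolding log_mean_def
    by (rule circle_average_uniform_limit[OF _ lim'])
       (use r c log_bounded_holomorphic[OF f] in \<open>auto intro!: continuous_on_circle_log_plus\<close>)
  then show "log_mean c g r \<le> L"
    by (rule LIMSEQ_le_const2) (use f r in \<open>auto simp: log_bounded_def\<close>)
qed

text \<open>Positivity of \<open>c\<close> gives local boundedness and hence a normal family. The
  last clause lets one limit inherit all bounds shared by the sequence, not only the one used for
  the extraction: membership in the Smirnov class needs a bound for every \<epsilon>.\<close>

lemma log_bounded_Montel:
  assumes f: "\<And>n. f n \<in> log_bounded c L" and c: "0 < c"
  shows "\<exists>g r. strict_mono (r :: nat \<Rightarrow> nat) \<and> (\<forall>z. cmod z < 1 \<longrightarrow> (\<lambda>n. f (r n) z) \<longlonglongrightarrow> g z) \<and>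
    (\<forall>d M. 0 \<le> d \<longrightarrow> (\<forall>n. f n \<in> log_bounded d M) \<longrightarrow> g \<in> log_bounded d M)"
proof -
  have bdd: "\<exists>B. \<forall>h\<in>log_bounded c L. \<forall>z\<in>K. cmod (h z) \<le> B" if K: "compact K" "K \<subseteq> ball 0 1" for K
  proof -
    have "continuous_on K (\<lambda>z. exp ((1 + cmod z) / (1 - cmod z) * L) / c)"
      using K(2) c by (intro continuous_intros) auto
    then have "compact ((\<lambda>z. exp ((1 + cmod z) / (1 - cmod z) * L) / c) ` K)"
      using K(1) by (rule compact_continuous_image)
    then have "bounded ((\<lambda>z. exp ((1 + cmod z) / (1 - cmod z) * L) / c) ` K)"
      by (rule compact_imp_bounded)
    then obtain B where B: "\<And>z. z \<in> K \<Longrightarrow> \<bar>exp ((1 + cmod z) / (1 - cmod z) * L) / c\<bar> \<le> B"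
      unfolding bounded_iff real_norm_def by blast
    have "cmod (h z) \<le> B" if "h \<in> log_bounded c L" "z \<in> K" for h z
    proof -
      have "cmod z < 1" using that(2) K(2) by auto
      then have "c * cmod (h z) \<le> exp ((1 + cmod z) / (1 - cmod z) * L)"
        using that(1) c by (intro log_bounded_pointwise) auto
      then have "cmod (h z) \<le> exp ((1 + cmod z) / (1 - cmod z) * L) / c"
        using c by (simp add: field_simps)
      then show ?thesis using B[OF that(2)] by linarith
    qed
    then show ?thesis by blast
  qed
  obtain g r where g: "g holomorphic_on ball 0 1" "strict_mono (r :: nat \<Rightarrow> nat)"
    "\<And>z. z \<in> ball 0 1 \<Longrightarrow> (\<lambda>n. f (r n) z) \<longlonglongrightarrow> g z"
    "\<And>K. \<lbrakk>compact K; K \<subseteq> ball 0 1\<rbrakk> \<Longrightarrow> uniform_limit K (f \<circ> r) g sequentially"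
    by (rule Montel[OF open_ball, of "log_bounded c L" 0 1 f])
       (use f log_bounded_holomorphic bdd in auto)
  show ?thesis
  proof (intro exI[of _ g] exI[of _ r] conjI allI impI)
    show "strict_mono r" by (rule g(2))
    show "(\<lambda>n. f (r n) z) \<longlonglongrightarrow> g z" if "cmod z < 1" for z
      using g(3)[of z] that by simp
    show "g \<in> log_bounded d M" if "0 \<le> d" "\<forall>n. f n \<in> log_bounded d M" for d M
      by (rule log_bounded_uniform_limit[of "f \<circ> r", OF _ that(1) g(1) g(4)]) (use that in auto)
  qed
qed

lemma log_bounded_mult:
  assumes f: "f \<in> log_bounded c L" and g: "g \<in> log_bounded d M" and cd: "0 \<le> c" "0 \<le> d"
  shows "(\<lambda>z. f z * g z) \<in> log_bounded (c * d) (L + M)"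
  unfolding log_bounded_def
proof (intro CollectI conjI ballI)
  have hol: "f holomorphic_on ball 0 1" "g holomorphic_on ball 0 1"
    using f g by (auto intro: log_bounded_holomorphic)
  then show "(\<lambda>z. f z * g z) holomorphic_on ball 0 1"
    by (intro holomorphic_intros)
  fix r :: real assume r: "r \<in> {0<..<1}"
  have "log_mean (c * d) (\<lambda>z. f z * g z) r \<le> circle_average
     (\<lambda>w. log_plus (c * cmod (f (of_real r * w))) + log_plus (d * cmod (g (of_real r * w))))"
    unfolding log_mean_def
  proof (rule circle_average_mono)
    fix w
    show "log_plus (c * d * cmod (f (of_real r * w) * g (of_real r * w)))
       \<le> log_plus (c * cmod (f (of_real r * w))) + log_plus (d * cmod (g (of_real r * w)))"
      using log_plus_mult_le[of "c * cmod (f (of_real r * w))" "d * cmod (g (of_real r * w))"] cd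
      by (simp add: norm_mult mult_ac)
  qed (use r cd hol in \<open>auto intro!: continuous_intros continuous_on_circle_log_plus continuous_on_circle_dilate\<close>)
  also have "\<dots> = log_mean c f r + log_mean d g r"
    unfolding log_mean_def
    by (rule circle_average_add) (use r cd hol in \<open>auto intro!: continuous_on_circle_log_plus\<close>)
  also have "\<dots> \<le> L + M" using f g r by (auto simp: log_bounded_def intro!: add_mono)
  finally show "log_mean (c * d) (\<lambda>z. f z * g z) r \<le> L + M" .
qed

lemma log_bounded_diff:
  assumes f: "f \<in> log_bounded c L" and g: "g \<in> log_bounded c M" and c: "0 \<le> c"
  shows "(\<lambda>z. f z - g z) \<in> log_bounded (c / 2) (L + M)"
  unfolding log_bounded_def
proof (intro CollectI conjI ballI)
  have hol: "f holomorphic_on ball 0 1" "g holomorphic_on ball 0 1"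
    using f g by (auto intro: log_bounded_holomorphic)
  then show hd: "(\<lambda>z. f z - g z) holomorphic_on ball 0 1"
    by (intro holomorphic_intros)
  fix r :: real assume r: "r \<in> {0<..<1}"
  have "log_mean (c / 2) (\<lambda>z. f z - g z) r \<le> circle_average
     (\<lambda>w. log_plus (c * cmod (f (of_real r * w))) + log_plus (c * cmod (g (of_real r * w))))"
    unfolding log_mean_def
  proof (rule circle_average_mono)
    fix w
    let ?x = "c * cmod (f (of_real r * w))" and ?y = "c * cmod (g (of_real r * w))"
    have "log_plus (c / 2 * cmod (f (of_real r * w) - g (of_real r * w))) \<le> log_plus ((?x + ?y) / 2)"
      using mult_left_mono[OF norm_triangle_ineq4 c] c
      by (intro log_plus_mono) (auto simp: field_simps)
    also have "\<dots> \<le> log_plus ?x + log_plus ?y"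
      using c by (intro log_plus_add_le) auto
    finally show "log_plus (c / 2 * cmod (f (of_real r * w) - g (of_real r * w))) \<le> log_plus ?x + log_plus ?y" .
  qed (use r c hol in \<open>auto intro!: continuous_intros continuous_on_circle_log_plus continuous_on_circle_dilate\<close>)
  also have "\<dots> = log_mean c f r + log_mean c g r"
    unfolding log_mean_def
    by (rule circle_average_add) (use r c hol in \<open>auto intro!: continuous_on_circle_log_plus\<close>)
  also have "\<dots> \<le> L + M" using f g r by (auto simp: log_bounded_def intro!: add_mono)
  finally show "log_mean (c / 2) (\<lambda>z. f z - g z) r \<le> L + M" .
qed

section \<open>Boundary values of bounded functions\<close>

text \<open>Partial sums are treated by induction; absolute summability makes them converge
  uniformly on the circle, so the means converge.\<close>

lemma Parseval_circle:
  fixes a :: "nat \<Rightarrow> complex"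
  assumes sa: "summable (\<lambda>n. cmod (a n))"
    and h: "\<And>w. cmod w = 1 \<Longrightarrow> (\<lambda>n. a n * w ^ n) sums h w"
  shows "(\<lambda>n. (cmod (a n))\<^sup>2) sums circle_average (\<lambda>w. (cmod (h w))\<^sup>2)"
proof -
  define S where "S N w = (\<Sum>n<N. a n * w ^ n)" for N w
  have contS: "continuous_on A (S N)" for N A
    unfolding S_def by (intro continuous_intros)
  have average: "circle_average (\<lambda>w. (cmod (S N w))\<^sup>2) = (\<Sum>n<N. (cmod (a n))\<^sup>2)" for N
  proof (induction N)
    case 0
    then show ?case by (simp add: S_def)
  next
    case (Suc N)
    \<comment> \<open>The cross term with the new summand: on the circle w^N cnj(w)^n = w^(N - n)
      with n < N, so it is a polynomial that vanishes at 0 and has mean 0.\<close>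
    define Q where "Q w = (\<Sum>n<N. a N * cnj (a n) * w ^ (N - n))" for w
    have contQ: "continuous_on A Q" for A
      unfolding Q_def by (intro continuous_intros)
    have "Q holomorphic_on ball 0 2"
      unfolding Q_def by (intro holomorphic_intros)
    from mean_value_property[OF this] have avQ: "circle_average Q = Q 0" by simp
    have Q0: "Q 0 = 0"
      unfolding Q_def by (intro sum.neutral) auto
    have "(cmod (S (Suc N) w))\<^sup>2 = (cmod (S N w))\<^sup>2 + 2 * Re (Q w) + (cmod (a N))\<^sup>2" if w: "cmod w = 1" for w
    proof -
      have ww: "w * cnj w = 1" using w complex_norm_square[of w] by simp
      have wp: "w ^ N * cnj w ^ n = w ^ (N - n)" if "n < N" for n
      proof -
        have "w ^ N * cnj w ^ n = w ^ (N - n) * (w * cnj w) ^ n"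
          using that by (simp add: power_mult_distrib flip: power_add mult.assoc)
        then show ?thesis by (simp add: ww)
      qed
      have "Q w = (\<Sum>n<N. a N * w ^ N * cnj (a n * w ^ n))"
        unfolding Q_def by (intro sum.cong refl) (simp add: wp[symmetric])
      also have "\<dots> = a N * w ^ N * cnj (S N w)"
        by (simp add: S_def sum_distrib_left)
      finally have Qw: "Q w = a N * w ^ N * cnj (S N w)" .
      have sq: "(cmod (x + y))\<^sup>2 = (cmod x)\<^sup>2 + 2 * Re (y * cnj x) + (cmod y)\<^sup>2" for x y :: complex
        unfolding cmod_power2 by (simp add: power2_eq_square algebra_simps)
      have "S (Suc N) w = S N w + a N * w ^ N"
        by (simp add: S_def)
      then show ?thesis
        using w by (simp add: sq Qw norm_mult norm_power)
    qed
    then have "circle_average (\<lambda>w. (cmod (S (Suc N) w))\<^sup>2)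
       = circle_average (\<lambda>w. ((cmod (S N w))\<^sup>2 + 2 * Re (Q w)) + (cmod (a N))\<^sup>2)"
      by (intro circle_average_cong)
    also have "\<dots> = circle_average (\<lambda>w. (cmod (S N w))\<^sup>2 + 2 * Re (Q w)) + (cmod (a N))\<^sup>2"
      by (subst circle_average_add) (auto intro!: continuous_intros contS contQ)
    also have "circle_average (\<lambda>w. (cmod (S N w))\<^sup>2 + 2 * Re (Q w))
       = circle_average (\<lambda>w. (cmod (S N w))\<^sup>2) + circle_average (\<lambda>w. 2 * Re (Q w))"
      by (rule circle_average_add) (intro continuous_intros contS contQ)+
    also have "circle_average (\<lambda>w. 2 * Re (Q w)) = 2 * Re (circle_average Q)"
      unfolding circle_average_mult_left
      by (subst circle_average_bounded_linear[OF bounded_linear_Re contQ]) simp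
    finally show ?case
      by (simp add: Suc avQ Q0)
  qed
  have "uniform_limit (sphere 0 1) (\<lambda>N w. \<Sum>n<N. a n * w ^ n) (\<lambda>w. \<Sum>n. a n * w ^ n) sequentially"
    by (rule Weierstrass_m_test[OF _ sa]) (simp add: norm_mult norm_power)
  then have lim: "uniform_limit (sphere 0 1) S h sequentially"
    using h unfolding S_def by (subst uniform_limit_cong') (auto simp: sums_iff)
  have conth: "continuous_on (sphere 0 1) h"
    by (rule uniform_limit_theorem[OF _ lim]) (auto simp: contS)
  have bdd: "bounded (h ` sphere 0 1)"
    by (intro compact_imp_bounded compact_continuous_image conth) auto
  have "uniform_limit (sphere 0 1) (\<lambda>N w. S N w * cnj (S N w)) (\<lambda>w. h w * cnj (h w)) sequentially"
  proof (rule uniform_lim_mult[OF lim _ bdd])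
    show "uniform_limit (sphere 0 1) (\<lambda>N w. cnj (S N w)) (\<lambda>w. cnj (h w)) sequentially"
      by (rule bounded_linear.uniform_limit[OF bounded_linear_cnj lim])
    show "bounded ((\<lambda>w. cnj (h w)) ` sphere 0 1)"
      using bdd by (simp add: bounded_iff)
  qed
  then have "uniform_limit (sphere 0 1) (\<lambda>N w. Re (S N w * cnj (S N w))) (\<lambda>w. Re (h w * cnj (h w))) sequentially"
    by (rule bounded_linear.uniform_limit[OF bounded_linear_Re])
  moreover have "Re (x * cnj x) = (cmod x)\<^sup>2" for x :: complex
    unfolding cmod_power2 by (simp add: power2_eq_square)
  ultimately have "uniform_limit (sphere 0 1) (\<lambda>N w. (cmod (S N w))\<^sup>2) (\<lambda>w. (cmod (h w))\<^sup>2) sequentially"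
    by simp
  then have "(\<lambda>N. circle_average (\<lambda>w. (cmod (S N w))\<^sup>2)) \<longlonglongrightarrow> circle_average (\<lambda>w. (cmod (h w))\<^sup>2)"
    by (intro circle_average_uniform_limit continuous_intros contS)
  then show ?thesis
    unfolding sums_def average .
qed

text \<open>Coefficientwise this is (s^n - r^n)^2 \<le> s^(2n) - r^(2n). If f is bounded, the
  right-hand side is an increment of a bounded monotone function, so the dilates are Cauchy in
  L^2.\<close>

lemma circle_dilates_L2:
  assumes f: "f holomorphic_on ball 0 1" and rs: "0 \<le> r" "r \<le> s" "s < 1"
  shows "circle_average (\<lambda>w. (cmod (f (of_real s * w) - f (of_real r * w)))\<^sup>2)
    \<le> circle_average (\<lambda>w. (cmod (f (of_real s * w)))\<^sup>2) - circle_average (\<lambda>w. (cmod (f (of_real r * w)))\<^sup>2)"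
proof -
  define a where "a n = (deriv ^^ n) f 0 / fact n" for n
  have sums: "(\<lambda>n. a n * w ^ n) sums f w" if "cmod w < 1" for w
    using holomorphic_power_series[OF f, of w] that by (simp add: a_def)
  have summ: "summable (\<lambda>n. cmod (a n * of_real t ^ n))" if "0 \<le> t" "t < 1" for t
  proof (rule powser_insidea)
    show "summable (\<lambda>n. a n * of_real ((t + 1) / 2) ^ n)"
      using sums[of "of_real ((t + 1) / 2)"] that by (intro sums_summable) simp
    show "cmod (of_real t) < cmod (of_real ((t + 1) / 2))"
      using that by simp
  qed
  have sumsr: "(\<lambda>n. (a n * of_real t ^ n) * w ^ n) sums f (of_real t * w)"
    if "0 \<le> t" "t < 1" "cmod w = 1" for t w
    using sums[of "of_real t * w"] that by (simp add: norm_mult power_mult_distrib mult.assoc)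
  have r: "0 \<le> r" "r < 1" and s: "0 \<le> s" "s < 1" using rs by auto
  note A = Parseval_circle[OF summ[OF r] sumsr[OF r]]
  note B = Parseval_circle[OF summ[OF s] sumsr[OF s]]
  have C: "(\<lambda>n. (cmod (a n * of_real s ^ n - a n * of_real r ^ n))\<^sup>2) sums
     circle_average (\<lambda>w. (cmod (f (of_real s * w) - f (of_real r * w)))\<^sup>2)"
  proof (rule Parseval_circle)
    show "summable (\<lambda>n. cmod (a n * of_real s ^ n - a n * of_real r ^ n))"
      by (rule summable_comparison_test'[OF summable_add[OF summ[OF s] summ[OF r]]])
         (simp add: norm_triangle_ineq4)
    show "(\<lambda>n. (a n * of_real s ^ n - a n * of_real r ^ n) * w ^ n) sums (f (of_real s * w) - f (of_real r * w))"
      if "cmod w = 1" for w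
      using sums_diff[OF sumsr[OF s that] sumsr[OF r that]] by (simp add: algebra_simps)
  qed
  show ?thesis
  proof (rule sums_le[OF _ C sums_diff[OF B A]])
    fix n
    have le: "r ^ n \<le> s ^ n" "0 \<le> r ^ n" using rs by (auto intro: power_mono)
    have "(cmod (a n * of_real s ^ n - a n * of_real r ^ n))\<^sup>2 = (cmod (a n))\<^sup>2 * (s ^ n - r ^ n)\<^sup>2"
    proof -
      have "a n * of_real s ^ n - a n * of_real r ^ n = a n * of_real (s ^ n - r ^ n)"
        by (simp add: algebra_simps)
      then show ?thesis
        by (simp only: norm_mult norm_of_real power_mult_distrib power2_abs)
    qed
    also have "\<dots> \<le> (cmod (a n))\<^sup>2 * ((s ^ n)\<^sup>2 - (r ^ n)\<^sup>2)"
    proof (rule mult_left_mono)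
      have "(s ^ n)\<^sup>2 - (r ^ n)\<^sup>2 - (s ^ n - r ^ n)\<^sup>2 = 2 * r ^ n * (s ^ n - r ^ n)"
        by (simp add: power2_eq_square algebra_simps)
      also have "\<dots> \<ge> 0" using le by simp
      finally show "(s ^ n - r ^ n)\<^sup>2 \<le> (s ^ n)\<^sup>2 - (r ^ n)\<^sup>2" by simp
    qed simp
    also have "\<dots> = (cmod (a n * of_real s ^ n))\<^sup>2 - (cmod (a n * of_real r ^ n))\<^sup>2"
      using rs by (simp add: norm_mult norm_power power_mult_distrib algebra_simps)
    finally show "(cmod (a n * of_real s ^ n - a n * of_real r ^ n))\<^sup>2
        \<le> (cmod (a n * of_real s ^ n))\<^sup>2 - (cmod (a n * of_real r ^ n))\<^sup>2" .
  qed
qed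

text \<open>The dilates are Cauchy in L^2, hence in L^1, and an L^1 Cauchy sequence has a
  subsequence that converges almost everywhere.\<close>

lemma bounded_dilates_AE_convergent:
  assumes f: "f holomorphic_on ball 0 1" and M: "\<And>z. cmod z < 1 \<Longrightarrow> cmod (f z) \<le> M"
  obtains \<rho> :: "nat \<Rightarrow> real" where "\<And>n. 0 < \<rho> n" "\<And>n. \<rho> n < 1" "\<rho> \<longlonglongrightarrow> 1"
    "AE \<theta> in circ. convergent (\<lambda>n. f (of_real (\<rho> n) * cis \<theta>))"
proof -
  define \<rho> :: "nat \<Rightarrow> real" where "\<rho> n = 1 - 1 / (real n + 2)" for n
  have \<rho>: "0 < \<rho> n" "\<rho> n < 1" for n by (auto simp: \<rho>_def field_simps)
  have \<rho>_lim: "\<rho> \<longlonglongrightarrow> 1" unfolding \<rho>_def by real_asymp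
  have \<rho>_mono: "\<rho> m \<le> \<rho> n" if "m \<le> n" for m n
    using that by (auto simp: \<rho>_def intro!: divide_left_mono)
  define A where "A n = circle_average (\<lambda>w. (cmod (f (of_real (\<rho> n) * w)))\<^sup>2)" for n
  have cont: "continuous_on (sphere 0 1) (\<lambda>w. f (of_real (\<rho> n) * w))" for n
    using \<rho>[of n] by (intro continuous_on_circle_dilate f) auto
  have diff: "circle_average (\<lambda>w. (cmod (f (of_real (\<rho> n) * w) - f (of_real (\<rho> m) * w)))\<^sup>2) \<le> A n - A m"
    if "m \<le> n" for m n
    unfolding A_def using that \<rho>[of m] \<rho>[of n] \<rho>_mono[OF that] by (intro circle_dilates_L2 f) auto
  have "incseq A"
  proof (rule incseq_SucI)
    fix n
    have "0 \<le> circle_average (\<lambda>w. (cmod (f (of_real (\<rho> (Suc n)) * w) - f (of_real (\<rho> n) * w)))\<^sup>2)"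
      by (rule circle_average_nonneg) simp
    then show "A n \<le> A (Suc n)" using diff[of n "Suc n"] by simp
  qed
  moreover have "A n \<le> M\<^sup>2" for n
    unfolding A_def
  proof (intro circle_average_upper continuous_intros cont)
    fix z :: complex assume "cmod z = 1"
    then show "(cmod (f (of_real (\<rho> n) * z)))\<^sup>2 \<le> M\<^sup>2"
      using \<rho>[of n] by (intro power_mono M) (auto simp: norm_mult)
  qed
  ultimately have "convergent A"
    unfolding convergent_def using incseq_convergent by metis
  then have CA: "Cauchy A" by (rule convergent_Cauchy)
  have small: "\<exists>N. \<forall>i\<ge>N. \<forall>j\<ge>N. (LINT \<theta>|circ. cmod (f (of_real (\<rho> i) * cis \<theta>) - f (of_real (\<rho> j) * cis \<theta>))) < e"
    if "e > 0" for e
  proof -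
    define d where "d = e / (2 * pi)"
    have d: "d > 0" using that by (simp add: d_def)
    then obtain N where N: "\<And>i j. i \<ge> N \<Longrightarrow> j \<ge> N \<Longrightarrow> \<bar>A i - A j\<bar> < d\<^sup>2"
      using CA unfolding Cauchy_def dist_real_def by (metis zero_less_power)
    have le: "circle_average (\<lambda>w. cmod (f (of_real (\<rho> i) * w) - f (of_real (\<rho> j) * w))) < d"
      if ij: "N \<le> j" "j \<le> i" for i j
    proof -
      have "circle_average (\<lambda>w. cmod (f (of_real (\<rho> i) * w) - f (of_real (\<rho> j) * w)))
        \<le> circle_average (\<lambda>w. 1 / (2 * d) * (cmod (f (of_real (\<rho> i) * w) - f (of_real (\<rho> j) * w)))\<^sup>2 + d / 2)"
      proof (intro circle_average_mono continuous_intros cont)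
        fix w
        \<comment> \<open>The arithmetic-geometric mean inequality replaces Cauchy-Schwarz in the
          passage from L^2 to L^1.\<close>
        have "x \<le> 1 / (2 * d) * x\<^sup>2 + d / 2" for x :: real
        proof -
          have "0 \<le> (x - d)\<^sup>2 / (2 * d)" using d by simp
          also have "\<dots> = 1 / (2 * d) * x\<^sup>2 + d / 2 - x"
            using d by (simp add: field_simps power2_eq_square)
          finally show ?thesis by simp
        qed
        then show "cmod (f (of_real (\<rho> i) * w) - f (of_real (\<rho> j) * w))
          \<le> 1 / (2 * d) * (cmod (f (of_real (\<rho> i) * w) - f (of_real (\<rho> j) * w)))\<^sup>2 + d / 2" .
      qed
      also have "\<dots> = 1 / (2 * d) * circle_average (\<lambda>w. (cmod (f (of_real (\<rho> i) * w) - f (of_real (\<rho> j) * w)))\<^sup>2) + d / 2"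
        by (subst circle_average_add) (auto intro!: continuous_intros cont simp only: circle_average_mult_left circle_average_const)
      also have "\<dots> \<le> 1 / (2 * d) * (A i - A j) + d / 2"
        using diff[OF ij(2)] d by (intro add_right_mono mult_left_mono) auto
      also have "\<dots> < 1 / (2 * d) * d\<^sup>2 + d / 2"
        using N[of i j] ij d by (intro add_strict_right_mono mult_strict_left_mono) auto
      also have "\<dots> = d" using d by (simp add: power2_eq_square)
      finally show ?thesis .
    qed
    have le': "circle_average (\<lambda>w. cmod (f (of_real (\<rho> i) * w) - f (of_real (\<rho> j) * w))) < d"
      if "N \<le> j" "N \<le> i" for i j
      using le[of j i] le[of i j] that by (cases "j \<le> i") (auto simp: norm_minus_commute)
    show ?thesis
    proof (intro exI[of _ N] allI impI)
      fix i j assume "N \<le> i" "N \<le> j"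
      with le'[of j i] show "(LINT \<theta>|circ. cmod (f (of_real (\<rho> i) * cis \<theta>) - f (of_real (\<rho> j) * cis \<theta>))) < e"
        unfolding circle_average_def d_def by (simp add: divide_less_cancel)
    qed
  qed
  obtain k where k: "strict_mono k" "AE \<theta> in circ. Cauchy (\<lambda>n. f (of_real (\<rho> (k n)) * cis \<theta>))"
    by (rule cauchy_L1_AE_cauchy_subseq[of circ "\<lambda>n \<theta>. f (of_real (\<rho> n) * cis \<theta>)"])
       (use integrable_circ[OF cont] small in auto)
  show ?thesis
  proof (rule that[of "\<rho> \<circ> k"])
    show "(\<rho> \<circ> k) \<longlonglongrightarrow> 1" using \<rho>_lim k(1) by (rule LIMSEQ_subseq_LIMSEQ)
    show "AE \<theta> in circ. convergent (\<lambda>n. f (of_real ((\<rho> \<circ> k) n) * cis \<theta>))"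
      using k(2) by (simp add: Cauchy_convergent_iff)
  qed (use \<rho> in auto)
qed

text \<open>Dominated convergence in the Poisson formulas of the dilates, which are available
  because the dilates are holomorphic beyond the closed disc.\<close>

lemma bounded_Poisson_representation:
  assumes f: "f holomorphic_on ball 0 1" and M: "\<And>z. cmod z < 1 \<Longrightarrow> cmod (f z) \<le> M"
  obtains g :: "real \<Rightarrow> complex" where "g \<in> borel_measurable circ" "\<And>\<theta>. cmod (g \<theta>) \<le> M"
    "\<And>z. cmod z < 1 \<Longrightarrow> (LINT \<theta>|circ. poisson_kernel z (cis \<theta>) *\<^sub>R g \<theta>) = (2 * pi) *\<^sub>R f z"
proof -
  obtain \<rho> :: "nat \<Rightarrow> real" where \<rho>: "\<And>n. 0 < \<rho> n" "\<And>n. \<rho> n < 1" "\<rho> \<longlonglongrightarrow> 1"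
    and conv: "AE \<theta> in circ. convergent (\<lambda>n. f (of_real (\<rho> n) * cis \<theta>))"
    using bounded_dilates_AE_convergent[OF f M] by blast
  have M0: "0 \<le> M" using M[of 0] norm_ge_zero[of "f 0"] by (simp del: norm_ge_zero)
  define G where "G \<theta> = lim (\<lambda>n. f (of_real (\<rho> n) * cis \<theta>))" for \<theta>
  \<comment> \<open>The cut-off makes the bound hold everywhere, also where the limit does not exist
    and \<open>lim\<close> is arbitrary.\<close>
  define g where "g \<theta> = (if cmod (G \<theta>) \<le> M then G \<theta> else 0)" for \<theta>
  have cont: "continuous_on (sphere 0 1) (\<lambda>w. f (of_real (\<rho> n) * w))" for n
    using \<rho>(1,2)[of n] by (intro continuous_on_circle_dilate f) auto
  have fm [measurable]: "(\<lambda>\<theta>. f (of_real (\<rho> n) * cis \<theta>)) \<in> borel_measurable circ" for n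
    using borel_measurable_integrable[OF integrable_circ[OF cont]] .
  have [measurable]: "G \<in> borel_measurable circ"
    unfolding G_def by measurable
  have gm [measurable]: "g \<in> borel_measurable circ"
    unfolding g_def by measurable
  have bound: "cmod (f (of_real (\<rho> n) * cis \<theta>)) \<le> M" for n \<theta>
    using \<rho>(1,2)[of n] by (intro M) (simp add: norm_mult)
  have lim: "AE \<theta> in circ. (\<lambda>n. f (of_real (\<rho> n) * cis \<theta>)) \<longlonglongrightarrow> g \<theta>"
    using conv
  proof eventually_elim
    case (elim \<theta>)
    then have lim: "(\<lambda>n. f (of_real (\<rho> n) * cis \<theta>)) \<longlonglongrightarrow> G \<theta>"
      unfolding G_def by (simp add: convergent_LIMSEQ_iff)
    have "cmod (G \<theta>) \<le> M"
      by (rule Lim_bounded[OF tendsto_norm[OF lim]]) (use bound in auto)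
    then show ?case using lim by (simp add: g_def)
  qed
  have "(LINT \<theta>|circ. poisson_kernel z (cis \<theta>) *\<^sub>R g \<theta>) = (2 * pi) *\<^sub>R f z" if z: "cmod z < 1" for z
  proof -
    note Pc = continuous_on_poisson_kernel[OF z]
    have [measurable]: "(\<lambda>\<theta>. poisson_kernel z (cis \<theta>)) \<in> borel_measurable circ"
      using borel_measurable_integrable[OF integrable_circ[OF Pc]] .
    have "(\<lambda>n. LINT \<theta>|circ. poisson_kernel z (cis \<theta>) *\<^sub>R f (of_real (\<rho> n) * cis \<theta>))
        \<longlonglongrightarrow> (LINT \<theta>|circ. poisson_kernel z (cis \<theta>) *\<^sub>R g \<theta>)"
    proof (rule integral_dominated_convergence[where w = "\<lambda>\<theta>. poisson_kernel z (cis \<theta>) * M"])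
      show "integrable circ (\<lambda>\<theta>. poisson_kernel z (cis \<theta>) * M)"
        by (intro integrable_mult_left integrable_circ Pc)
      show "AE \<theta> in circ. (\<lambda>n. poisson_kernel z (cis \<theta>) *\<^sub>R f (of_real (\<rho> n) * cis \<theta>)) \<longlonglongrightarrow> poisson_kernel z (cis \<theta>) *\<^sub>R g \<theta>"
        using lim by eventually_elim (intro tendsto_intros)
      show "AE \<theta> in circ. norm (poisson_kernel z (cis \<theta>) *\<^sub>R f (of_real (\<rho> n) * cis \<theta>)) \<le> poisson_kernel z (cis \<theta>) * M" for n
        using bound poisson_kernel_nonneg[OF z] by (auto intro!: mult_left_mono)
    qed measurable
    moreover have "(LINT \<theta>|circ. poisson_kernel z (cis \<theta>) *\<^sub>R f (of_real (\<rho> n) * cis \<theta>)) = (2 * pi) *\<^sub>R f (of_real (\<rho> n) * z)" for n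
    proof -
      have "circle_average (\<lambda>w. poisson_kernel z w *\<^sub>R f (of_real (\<rho> n) * w)) = f (of_real (\<rho> n) * z)"
        by (rule Poisson_formula[OF holomorphic_dilate[OF f] _ z]) (use \<rho>(1,2)[of n] in auto)
      from this[symmetric] show ?thesis
        by (simp add: circle_average_def)
    qed
    moreover have "(\<lambda>n. (2 * pi) *\<^sub>R f (of_real (\<rho> n) * z)) \<longlonglongrightarrow> (2 * pi) *\<^sub>R f z"
    proof (intro tendsto_intros)
      have "isCont f z"
        using holomorphic_on_imp_continuous_on[OF f] z by (simp add: continuous_on_eq_continuous_at)
      moreover have "(\<lambda>n. of_real (\<rho> n) * z) \<longlonglongrightarrow> of_real 1 * z"
        by (intro tendsto_intros \<rho>(3))
      ultimately show "(\<lambda>n. f (of_real (\<rho> n) * z)) \<longlonglongrightarrow> f z"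
        using isCont_tendsto_compose[of z f "\<lambda>n. of_real (\<rho> n) * z" sequentially] by simp
    qed
    ultimately show ?thesis
      by (intro LIMSEQ_unique[of "\<lambda>n. (2 * pi) *\<^sub>R f (of_real (\<rho> n) * z)"]) simp_all
  qed
  moreover have "cmod (g \<theta>) \<le> M" for \<theta>
    using M0 by (simp add: g_def)
  ultimately show ?thesis using that gm by blast
qed

text \<open>A Vitali covering argument for a fixed proportion \<open>e\<close>: disjoint balls
  inside an open U \<supseteq> S, each losing more than e r of its length 2 r to U - S, have total
  length at most 2 / e times the measure of U - S.\<close>

lemma Lebesgue_density_real:
  fixes S :: "real set"
  assumes S: "S \<in> sets lebesgue" and e: "0 < e"
  shows "negligible {x \<in> S. \<forall>d>0. \<exists>r. 0 < r \<and> r < d \<and> measure lebesgue (ball x r - S) > e * r}"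
    (is "negligible ?N")
  unfolding negligible_outer_le
proof (intro allI impI)
  fix \<delta> :: real assume \<delta>: "0 < \<delta>"
  \<comment> \<open>Chosen so that 2 / e * \<eta> = \<delta>.\<close>
  define \<eta> where "\<eta> = \<delta> * e / 2"
  have \<eta>: "0 < \<eta>" using \<delta> e by (simp add: \<eta>_def)
  obtain U where U: "open U" "S \<subseteq> U" "U - S \<in> lmeasurable" "emeasure lebesgue (U - S) < ennreal \<eta>"
    using sets_lebesgue_outer_open[OF S \<eta>] by blast
  have mU: "measure lebesgue (U - S) \<le> \<eta>"
    using U(3,4) \<eta> by (simp add: emeasure_eq_measure2 ennreal_less_iff)
  define K where "K = {(x, r). 0 < r \<and> ball x r \<subseteq> U \<and> measure lebesgue (ball x r - S) > e * r}"
  obtain C where C: "countable C" "C \<subseteq> K"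
    "pairwise (\<lambda>i j. disjnt (ball (fst i) (snd i)) (ball (fst j) (snd j))) C"
    "negligible (?N - (\<Union>i\<in>C. ball (fst i) (snd i)))"
  proof (rule Vitali_covering_theorem_balls[of ?N K fst snd])
    fix x d :: real assume x: "x \<in> ?N" and d: "0 < d"
    then have "x \<in> U" using U by auto
    then obtain d' where d': "d' > 0" "ball x d' \<subseteq> U" using U(1) open_contains_ball by blast
    then obtain r where r: "0 < r" "r < min d d'" "measure lebesgue (ball x r - S) > e * r"
      using x d by (auto dest!: spec[of _ "min d d'"])
    then show "\<exists>i. i \<in> K \<and> x \<in> ball (fst i) (snd i) \<and> snd i < d"
      using d' by (intro exI[of _ "(x, r)"]) (auto simp: K_def)
  qed
  let ?B = "\<lambda>i::real \<times> real. ball (fst i) (snd i)"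
  have lm: "?B i \<in> lmeasurable" "?B i - S \<in> lmeasurable" for i
    using S by (auto intro: fmeasurable_Diff)
  have fin: "measure lebesgue (\<Union>i\<in>I. ?B i) \<le> \<delta>" if I: "I \<subseteq> C" "finite I" for I
  proof -
    have IK: "0 < snd i" "?B i \<subseteq> U" "measure lebesgue (?B i - S) > e * snd i" if "i \<in> I" for i
    proof -
      have "i \<in> K" using that I C(2) by blast
      then show "0 < snd i" "?B i \<subseteq> U" "measure lebesgue (?B i - S) > e * snd i"
        unfolding K_def by (auto simp only: mem_Collect_eq split_beta)
    qed
    have "measure lebesgue (\<Union>i\<in>I. ?B i) \<le> (\<Sum>i\<in>I. measure lebesgue (?B i))"
      by (rule measure_UNION_le) (use I in auto)
    also have "\<dots> = (\<Sum>i\<in>I. 2 * snd i)"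
      using IK(1) by (intro sum.cong refl) (simp add: ball_eq_greaterThanLessThan less_imp_le)
    also have "\<dots> \<le> (\<Sum>i\<in>I. 2 / e * measure lebesgue (?B i - S))"
      using IK(3) e by (intro sum_mono) (simp add: field_simps less_imp_le)
    also have "\<dots> = 2 / e * (\<Sum>i\<in>I. measure lebesgue (?B i - S))"
      by (simp add: sum_distrib_left)
    also have "(\<Sum>i\<in>I. measure lebesgue (?B i - S)) = measure lebesgue (\<Union>i\<in>I. ?B i - S)"
    proof (rule measure_UNION'[symmetric])
      show "pairwise (\<lambda>i j. disjnt (?B i - S) (?B j - S)) I"
        using pairwise_subset[OF C(3) I(1)] unfolding pairwise_def disjnt_def by blast
    qed (use I lm in auto)
    also have "\<dots> \<le> measure lebesgue (U - S)"
    proof (rule measure_mono_fmeasurable[OF _ _ U(3)])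
      have "(\<Union>i\<in>I. ?B i - S) \<in> lmeasurable"
        using I(2) lm(2) by (rule fmeasurable.finite_UN)
      then show "(\<Union>i\<in>I. ?B i - S) \<in> sets lebesgue"
        by (rule fmeasurableD)
    qed (use IK(2) in blast)
    also have "2 / e * measure lebesgue (U - S) \<le> \<delta>"
      using mU e by (simp add: \<eta>_def field_simps)
    finally show ?thesis using e by (simp add: divide_right_mono)
  qed
  obtain Z where Z: "?N - (\<Union>i\<in>C. ?B i) = Z" "negligible Z" using C(4) by blast
  let ?T = "Z \<union> (\<Union>i\<in>C. ?B i)"
  have W: "(\<Union>i\<in>C. ?B i) \<in> lmeasurable" "measure lebesgue (\<Union>i\<in>C. ?B i) \<le> \<delta>"
    using fmeasurable_UN_bound[OF C(1) lm(1) fin] measure_UN_bound[OF C(1) lm(1) fin] by auto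
  have Zm: "Z \<in> lmeasurable" "measure lebesgue Z = 0"
    using Z(2) negligible_imp_measurable negligible_imp_measure0 by auto
  show "\<exists>T. ?N \<subseteq> T \<and> T \<in> lmeasurable \<and> measure lebesgue T \<le> \<delta>"
  proof (intro exI[of _ ?T] conjI)
    show "?N \<subseteq> ?T" using Z(1) by auto
    show "?T \<in> lmeasurable" using Zm(1) W(1) by (rule fmeasurable.Un)
    show "measure lebesgue ?T \<le> \<delta>"
      using measure_Un_le[of Z lebesgue "\<Union>i\<in>C. ?B i"] Zm W by (auto dest: fmeasurableD)
  qed
qed

text \<open>A crude Jordan inequality. Up to 1 the mean value theorem gives slope at least cos (pi /
  3) = 1 / 2; beyond 1 the sine stays above sin 1 \<ge> 1 / 2, while y / 4 stays below 1 /
  2.\<close>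

lemma sin_ge_quarter:
  assumes "0 \<le> y" "y \<le> pi / 2"
  shows "y / 4 \<le> sin y"
proof (cases "y \<le> 1")
  case True
  show ?thesis
  proof (cases "y = 0")
    case False
    with assms have y: "0 < y" by simp
    have "\<exists>z>0. z < y \<and> sin y - sin 0 = (y - 0) * cos z"
      by (rule MVT2[OF y]) (auto intro!: derivative_eq_intros)
    then obtain z where z: "0 < z" "z < y" "sin y = y * cos z" by auto
    have "cos (pi / 3) \<le> cos z"
      using z True pi_gt3 by (intro cos_monotone_0_pi_le) auto
    then have "y * (1 / 2) \<le> sin y"
      unfolding z(3) cos_60 using y by (intro mult_left_mono) auto
    then show ?thesis using y by simp
  qed simp
next
  case False
  have "\<exists>z>0. z < 1 \<and> sin 1 - sin 0 = (1 - 0) * cos (z::real)"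
    by (rule MVT2) (auto intro!: derivative_eq_intros)
  then obtain z where z: "0 < z" "z < 1" "sin 1 = cos (z::real)" by auto
  have "cos (pi / 3) \<le> cos z"
    using z pi_gt3 by (intro cos_monotone_0_pi_le) auto
  then have "1 / 2 \<le> sin (1::real)" unfolding cos_60 z(3) .
  also have "sin 1 \<le> sin y"
    using False assms pi_gt3 by (intro sin_monotone_2pi_le) auto
  finally show ?thesis using assms(2) pi_less_4 by linarith
qed

lemma norm_cis_diff: "cmod (cis a - cis b) = 2 * \<bar>sin ((a - b) / 2)\<bar>"
proof -
  have "(cmod (cis a - cis b))\<^sup>2 = (cos a - cos b)\<^sup>2 + (sin a - sin b)\<^sup>2"
    by (simp add: cmod_power2)
  also have "\<dots> = 2 - 2 * cos (a - b)"
    using sin_cos_squared_add[of a] sin_cos_squared_add[of b]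
    by (simp add: cos_diff power2_eq_square algebra_simps)
  also have "\<dots> = (2 * \<bar>sin ((a - b) / 2)\<bar>)\<^sup>2"
  proof -
    have "2 * ((a - b) / 2) = a - b"
      by (rule nonzero_mult_div_cancel_left[of "2::real" "a - b", unfolded times_divide_eq_right[symmetric]]) simp
    then have "cos (a - b) = 1 - 2 * (sin ((a - b) / 2))\<^sup>2"
      using cos_double_sin[of "(a - b) / 2"] by (simp only:)
    then show ?thesis by (simp add: power_mult_distrib)
  qed
  finally show ?thesis
    by (rule power2_eq_imp_eq) auto
qed

text \<open>The constant must depend on \<open>t\<close>: the half-difference \<open>y\<close> can
  reach pi - m, where m is half the distance of t to the nearer endpoint, and sin (pi - m)
  degenerates as t approaches 0 or 2 pi.\<close>

lemma cis_dist_lower: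
  assumes t: "0 < t" "t < 2 * pi"
  obtains c where "0 < c" "\<And>\<theta>. \<theta> \<in> {0..2 * pi} \<Longrightarrow> c * \<bar>\<theta> - t\<bar> \<le> cmod (cis \<theta> - cis t)"
proof -
  define m where "m = min t (2 * pi - t) / 2"
  have m: "0 < m" "m \<le> pi" using t by (auto simp: m_def min_def)
  define c where "c = m / (4 * pi)"
  have c: "0 < c" "c \<le> 1 / 4" using m by (auto simp: c_def)
  show ?thesis
  proof (rule that[OF c(1)])
    fix \<theta> assume \<theta>: "\<theta> \<in> {0..2 * pi}"
    define y where "y = \<bar>\<theta> - t\<bar> / 2"
    have y: "0 \<le> y" "y \<le> pi - m" using \<theta> t by (auto simp: y_def m_def min_def abs_if)
    have "c * y \<le> sin y"
    proof (cases "y \<le> pi / 2")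
      case True
      have "c * y \<le> 1 / 4 * y" using c y by (intro mult_right_mono) auto
      then show ?thesis using sin_ge_quarter[OF y(1) True] by simp
    next
      case False
      have "c * y \<le> c * pi" using c y m by (intro mult_left_mono) auto
      also have "\<dots> = m / 4" by (simp add: c_def)
      also have "\<dots> \<le> (pi - y) / 4" using y by simp
      also have "\<dots> \<le> sin (pi - y)" using False y m by (intro sin_ge_quarter) auto
      finally show ?thesis by simp
    qed
    moreover have "\<bar>sin ((\<theta> - t) / 2)\<bar> = \<bar>sin y\<bar>"
    proof (cases "\<theta> \<ge> t")
      case False
      then have "(\<theta> - t) / 2 = - y" unfolding y_def by linarith
      then show ?thesis by (simp only: sin_minus abs_minus_cancel)
    qed (simp add: y_def)
    ultimately have "2 * (c * y) \<le> cmod (cis \<theta> - cis t)"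
      unfolding norm_cis_diff by linarith
    then show "c * \<bar>\<theta> - t\<bar> \<le> cmod (cis \<theta> - cis t)"
      by (simp add: y_def)
  qed
qed

text \<open>Outside the arc of radius \<open>T (1 - \<bar>z\<bar>)\<close> around \<open>\<zeta>\<close>, the Poisson kernel of \<open>z\<close> is small
  compared to that of the point at depth \<open>T (1 - \<bar>z\<bar>)\<close> below \<open>\<zeta>\<close>. As all Poisson kernels have
  mean 1, this bounds the tails without any integration.\<close>

lemma poisson_kernel_tail:
  assumes z: "cmod z < 1" and \<zeta>: "cmod \<zeta> = 1" and stolz: "cmod (z - \<zeta>) < \<alpha> * (1 - cmod z)"
    and T: "2 * \<alpha> \<le> T" "0 < T" "T * (1 - cmod z) < 1"
    and w: "cmod w = 1" "T * (1 - cmod z) \<le> cmod (w - \<zeta>)"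
  shows "poisson_kernel z w \<le> 32 / T * poisson_kernel (of_real (1 - T * (1 - cmod z)) * \<zeta>) w"
proof -
  define h where "h = 1 - cmod z"
  define z' where "z' = of_real (1 - T * h) * \<zeta>"
  have h: "0 < h" using z by (simp add: h_def)
  have Th: "0 < T * h" "T * h < 1" using T h by (auto simp: h_def)
  have nz': "cmod z' = 1 - T * h"
    unfolding z'_def norm_mult norm_of_real using Th \<zeta> by simp
  have "2 * \<alpha> * h \<le> T * h" using T h by (intro mult_right_mono) auto
  then have zz: "cmod (z - \<zeta>) \<le> cmod (w - \<zeta>) / 2"
    using stolz w(2) by (simp add: h_def)
  have "z' - \<zeta> = - (of_real (T * h) * \<zeta>)" by (simp add: z'_def algebra_simps)
  then have z'\<zeta>: "cmod (z' - \<zeta>) = T * h"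
    using Th \<zeta> by (simp only: norm_minus_cancel norm_mult norm_of_real abs_of_pos mult_1_right)
  have "cmod (w - z') \<le> cmod (w - \<zeta>) + cmod (z' - \<zeta>)"
    using norm_triangle_ineq4[of "w - \<zeta>" "z' - \<zeta>"] by simp
  also have "\<dots> \<le> 2 * cmod (w - \<zeta>)" using z'\<zeta> w(2) by (simp add: h_def)
  finally have 1: "cmod (w - z') \<le> 2 * cmod (w - \<zeta>)" .
  have "cmod (w - \<zeta>) \<le> cmod (w - z) + cmod (z - \<zeta>)"
    using norm_triangle_ineq[of "w - z" "z - \<zeta>"] by simp
  then have 2: "cmod (w - z') \<le> 4 * cmod (w - z)"
    using 1 zz by linarith
  have wz': "0 < cmod (w - z')"
    using nz' Th w(1) by auto
  then have "0 < cmod (w - z)" using 2 by linarith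
  have "(cmod (w - z'))\<^sup>2 \<le> (4 * cmod (w - z))\<^sup>2"
    using 2 by (intro power_mono) auto
  then have sq: "(cmod (w - z'))\<^sup>2 \<le> 16 * (cmod (w - z))\<^sup>2"
    by (simp add: power_mult_distrib)
  have num: "1 - (cmod z)\<^sup>2 \<le> 2 * h"
  proof -
    have "1 - (cmod z)\<^sup>2 = h * (1 + cmod z)" by (simp add: h_def power2_eq_square algebra_simps)
    also have "\<dots> \<le> h * 2" using h z by (intro mult_left_mono) auto
    finally show ?thesis by simp
  qed
  have num': "T * h \<le> 1 - (cmod z')\<^sup>2"
  proof -
    have "1 - (cmod z')\<^sup>2 = T * h * (2 - T * h)" unfolding nz' by (simp add: power2_eq_square algebra_simps)
    also have "\<dots> \<ge> T * h * 1" using Th by (intro mult_left_mono) auto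
    finally show ?thesis by simp
  qed
  have "poisson_kernel z w \<le> 2 * h / (cmod (w - z))\<^sup>2"
    unfolding poisson_kernel_def using num by (intro divide_right_mono) auto
  also have "\<dots> \<le> 32 * h / (cmod (w - z'))\<^sup>2"
    using sq wz' \<open>0 < cmod (w - z)\<close> h by (simp add: field_simps)
  also have "\<dots> = 32 / T * (T * h / (cmod (w - z'))\<^sup>2)"
    using T by simp
  also have "\<dots> \<le> 32 / T * poisson_kernel z' w"
    unfolding poisson_kernel_def using num' T by (intro mult_left_mono divide_right_mono) auto
  finally show ?thesis unfolding z'_def h_def .
qed

text \<open>The Poisson integral of g - g t is split into three parts: on \<open>S\<close> the
  difference is small; off \<open>S\<close> but near \<open>t\<close> the kernel is at most 2 / h
  and the set is small by density; far from \<open>t\<close> the tail estimate applies.\<close>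

lemma nontangential_limit_density_point:
  fixes g :: "real \<Rightarrow> complex"
  assumes gm: "g \<in> borel_measurable circ" and gM: "\<And>\<theta>. cmod (g \<theta>) \<le> M" and M: "0 < M"
    and rep: "\<And>z. cmod z < 1 \<Longrightarrow> (LINT \<theta>|circ. poisson_kernel z (cis \<theta>) *\<^sub>R g \<theta>) = (2 * pi) *\<^sub>R f z"
    and t: "0 < t" "t < 2 * pi"
    and dens: "\<And>\<epsilon>. 0 < \<epsilon> \<Longrightarrow> \<exists>S\<in>sets lebesgue. (\<forall>\<theta>\<in>S. cmod (g \<theta> - g t) \<le> \<epsilon>) \<and>
      (\<forall>e>0. \<exists>d>0. \<forall>r. 0 < r \<and> r < d \<longrightarrow> measure lebesgue (ball t r - S) \<le> e * r)"
  shows "nontangential_limit f (cis t) (g t)"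
  unfolding nontangential_limit_def Lim_within
proof (intro allI impI)
  fix \<alpha> \<epsilon> :: real assume \<alpha>: "1 < \<alpha>" and \<epsilon>: "0 < \<epsilon>"
  obtain c where c: "0 < c" "\<And>\<theta>. \<theta> \<in> {0..2 * pi} \<Longrightarrow> c * \<bar>\<theta> - t\<bar> \<le> cmod (cis \<theta> - cis t)"
    using cis_dist_lower[OF t] by blast
  obtain S where S: "S \<in> sets lebesgue" "\<And>\<theta>. \<theta> \<in> S \<Longrightarrow> cmod (g \<theta> - g t) \<le> \<epsilon> / 4"
    and dS: "\<And>e. e > 0 \<Longrightarrow> \<exists>d>0. \<forall>r. 0 < r \<and> r < d \<longrightarrow> measure lebesgue (ball t r - S) \<le> e * r"
    using dens[of "\<epsilon> / 4"] \<epsilon> by auto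
  \<comment> \<open>The bound 2 \<alpha> is what \<open>poisson_kernel_tail\<close> requires; the
    other one makes the tail term 64 M / T at most \<epsilon> / 4.\<close>
  define T where "T = max (2 * \<alpha>) (256 * M / \<epsilon>)"
  have T: "2 * \<alpha> \<le> T" "256 * M / \<epsilon> \<le> T" "0 < T" using \<alpha> by (auto simp: T_def)
  \<comment> \<open>Chosen so that with r = T h / c the near part 2 M (2 / h) (\<eta> r) equals
    \<epsilon> / 2.\<close>
  define \<eta> where "\<eta> = \<epsilon> * c / (8 * M * T)"
  have \<eta>: "0 < \<eta>" using \<epsilon> c M T by (simp add: \<eta>_def)
  obtain d where d: "0 < d" "\<And>r. 0 < r \<Longrightarrow> r < d \<Longrightarrow> measure lebesgue (ball t r - S) \<le> \<eta> * r"
    using dS[OF \<eta>] by auto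
  \<comment> \<open>Distance below \<delta> forces T h < 1 and T h / c < d, the ranges of the tail
    and density estimates.\<close>
  define \<delta> where "\<delta> = min (d * c / T) (1 / T)"
  have \<delta>: "0 < \<delta>" using d c T by (simp add: \<delta>_def)
  have "dist (f z) (g t) < \<epsilon>" if zS: "z \<in> stolz_region \<alpha> (cis t)" and z\<delta>: "dist z (cis t) < \<delta>" for z
  proof -
    define h where "h = 1 - cmod z"
    have z: "cmod z < 1" and stolz: "cmod (z - cis t) < \<alpha> * (1 - cmod z)"
      using zS by (auto simp: stolz_region_def)
    have h: "0 < h" using z by (simp add: h_def)
    have "h \<le> dist z (cis t)"
      using norm_triangle_ineq2[of "cis t" z] by (simp add: h_def dist_norm norm_minus_commute)
    then have "h < \<delta>" using z\<delta> by simp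
    then have hT: "T * h < 1" "T * h / c < d"
      using T c by (auto simp: \<delta>_def field_simps)
    define r where "r = T * h / c"
    have r: "0 < r" "r < d" using hT T h c by (auto simp: r_def)
    define A where "A = (ball t r - S) \<inter> {0..2 * pi}"
    have A: "A \<in> sets lebesgue" unfolding A_def by (intro sets.Int sets.Diff S(1)) auto
    then have A': "A \<in> sets circ" by (auto simp: sets_restrict_space_iff A_def)
    have "measure circ A = measure lebesgue A"
      by (rule measure_restrict_space) (auto simp: A_def)
    also have "\<dots> \<le> measure lebesgue (ball t r - S)"
      using A S by (intro measure_mono_fmeasurable) (auto simp: A_def intro: fmeasurable_Diff)
    also have "\<dots> \<le> \<eta> * r" by (rule d(2)[OF r])
    finally have mA: "measure circ A \<le> \<eta> * r" .
    have AI: "A \<inter> {0..2 * pi} = A" by (auto simp: A_def)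
    have Aint: "integrable circ (indicator A :: real \<Rightarrow> real)"
      using A' finite_measure_circ
      by (simp add: integrable_indicator_iff finite_measure.emeasure_finite less_top[symmetric] AI)
    have LA: "(LINT \<theta>|circ. indicator A \<theta>) = measure circ A"
      by (simp add: AI)
    define z' where "z' = of_real (1 - T * h) * cis t"
    have z': "cmod z' < 1"
      unfolding z'_def norm_mult norm_of_real using hT T h by simp
    let ?P = "\<lambda>\<theta>. poisson_kernel z (cis \<theta>)" and ?P' = "\<lambda>\<theta>. poisson_kernel z' (cis \<theta>)"
    have Pint: "integrable circ ?P" "integrable circ ?P'"
      by (intro integrable_circ continuous_on_poisson_kernel z z')+
    have P1: "(LINT \<theta>|circ. ?P \<theta>) = 2 * pi" "(LINT \<theta>|circ. ?P' \<theta>) = 2 * pi"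
      using circle_average_poisson_kernel[OF z] circle_average_poisson_kernel[OF z']
      by (auto simp: circle_average_def field_simps)
    have Pm [measurable]: "?P \<in> borel_measurable circ"
      using Pint(1) by (rule borel_measurable_integrable)
    note gm [measurable]
    have Pg: "integrable circ (\<lambda>\<theta>. ?P \<theta> *\<^sub>R g \<theta>)"
    proof (rule Bochner_Integration.integrable_bound)
      show "integrable circ (\<lambda>\<theta>. ?P \<theta> * M)" using Pint(1) by simp
      show "AE \<theta> in circ. norm (?P \<theta> *\<^sub>R g \<theta>) \<le> norm (?P \<theta> * M)"
        using gM M by (auto simp: abs_mult intro!: mult_left_mono)
    qed measurable
    have Pgt: "integrable circ (\<lambda>\<theta>. ?P \<theta> *\<^sub>R g t)"
      using Pint(1) by simp
    have "(2 * pi) *\<^sub>R (f z - g t) = (LINT \<theta>|circ. ?P \<theta> *\<^sub>R g \<theta>) - (LINT \<theta>|circ. ?P \<theta> *\<^sub>R g t)"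
      using rep[OF z] P1(1) integral_scaleR_left[OF Pint(1), of "g t"]
      by (simp add: scaleR_diff_right)
    also have "\<dots> = (LINT \<theta>|circ. ?P \<theta> *\<^sub>R (g \<theta> - g t))"
      by (simp add: Bochner_Integration.integral_diff[OF Pg Pgt, symmetric] scaleR_diff_right)
    finally have eq: "(2 * pi) *\<^sub>R (f z - g t) = (LINT \<theta>|circ. ?P \<theta> *\<^sub>R (g \<theta> - g t))" .
    have int: "integrable circ (\<lambda>\<theta>. ?P \<theta> *\<^sub>R (g \<theta> - g t))"
      using Bochner_Integration.integrable_diff[OF Pg Pgt] by (simp add: scaleR_diff_right)
    \<comment> \<open>The three summands dominate the integrand on \<open>S\<close>, on the
      exceptional set \<open>A\<close> near \<open>t\<close>, and on the far arc.\<close>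
    let ?R = "\<lambda>\<theta>. \<epsilon> / 4 * ?P \<theta> + 2 * M * (2 / h * indicator A \<theta> + 32 / T * ?P' \<theta>)"
    have "2 * pi * cmod (f z - g t) = norm (LINT \<theta>|circ. ?P \<theta> *\<^sub>R (g \<theta> - g t))"
      unfolding eq[symmetric] by simp
    also have "\<dots> \<le> (LINT \<theta>|circ. norm (?P \<theta> *\<^sub>R (g \<theta> - g t)))"
      by (rule integral_norm_bound)
    also have "\<dots> \<le> (LINT \<theta>|circ. ?R \<theta>)"
    proof (rule integral_mono)
      show "integrable circ (\<lambda>\<theta>. norm (?P \<theta> *\<^sub>R (g \<theta> - g t)))" using int by (rule integrable_norm)
      show "integrable circ ?R" using Pint Aint by simp
      fix \<theta> assume "\<theta> \<in> space circ"
      then have \<theta>: "\<theta> \<in> {0..2 * pi}" by simp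
      have P0: "0 \<le> ?P \<theta>" "0 \<le> ?P' \<theta>" using poisson_kernel_nonneg z z' by auto
      show "norm (?P \<theta> *\<^sub>R (g \<theta> - g t)) \<le> ?R \<theta>"
      proof (cases "\<theta> \<in> S")
        case True
        have "norm (?P \<theta> *\<^sub>R (g \<theta> - g t)) = ?P \<theta> * cmod (g \<theta> - g t)"
          using P0 by simp
        also have "\<dots> \<le> ?P \<theta> * (\<epsilon> / 4)"
          using S(2)[OF True] P0 by (intro mult_left_mono) auto
        also have "\<dots> \<le> ?R \<theta>"
          using M h T P0 by (simp add: mult.commute)
        finally show ?thesis .
      next
        case False
        have P_le: "?P \<theta> \<le> 2 / h * indicator A \<theta> + 32 / T * ?P' \<theta>"
        proof (cases "\<theta> \<in> ball t r")
          case True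
          then have "\<theta> \<in> A" using False \<theta> by (auto simp: A_def)
          have "?P \<theta> \<le> (1 + cmod z) / (1 - cmod z)" by (rule poisson_kernel_upper[OF z]) simp
          also have "\<dots> \<le> 2 / h" unfolding h_def using z by (intro divide_right_mono) auto
          finally have "?P \<theta> \<le> 2 / h" .
          moreover have "0 \<le> 32 / T * ?P' \<theta>" using P0 T by simp
          ultimately show ?thesis using \<open>\<theta> \<in> A\<close> by simp
        next
          case False
          then have "r \<le> \<bar>\<theta> - t\<bar>" by (simp add: dist_real_def abs_minus_commute)
          then have "c * r \<le> cmod (cis \<theta> - cis t)"
            using c(2)[OF \<theta>] c(1) by (meson mult_left_mono less_imp_le order_trans)
          then have "T * (1 - cmod z) \<le> cmod (cis \<theta> - cis t)"
            using c(1) by (simp add: r_def h_def)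
          then have "?P \<theta> \<le> 32 / T * ?P' \<theta>"
            unfolding z'_def h_def using hT
            by (intro poisson_kernel_tail[OF z _ stolz T(1,3)]) (auto simp: h_def)
          moreover have "0 \<le> 2 / h * indicator A \<theta>" using h by simp
          ultimately show ?thesis by linarith
        qed
        have "norm (?P \<theta> *\<^sub>R (g \<theta> - g t)) = ?P \<theta> * norm (g \<theta> - g t)"
          using P0 by simp
        also have "\<dots> \<le> ?P \<theta> * (2 * M)"
          using norm_triangle_ineq4[of "g \<theta>" "g t"] gM[of \<theta>] gM[of t] P0 by (intro mult_left_mono) auto
        also have "\<dots> \<le> (2 / h * indicator A \<theta> + 32 / T * ?P' \<theta>) * (2 * M)"
          using P_le M by (intro mult_right_mono) auto
        also have "\<dots> \<le> ?R \<theta>" using \<epsilon> P0 by (simp add: mult.commute)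
        finally show ?thesis .
      qed
    qed
    also have "\<dots> = \<epsilon> / 4 * (2 * pi) + 2 * M * (2 / h * measure circ A + 32 / T * (2 * pi))"
      using Pint Aint P1 LA by simp
    also have "\<dots> \<le> \<epsilon> / 4 * (2 * pi) + 2 * M * (2 / h * (\<eta> * r) + 32 / T * (2 * pi))"
      using mA h M by (intro add_left_mono mult_left_mono add_right_mono) auto
    also have "2 / h * (\<eta> * r) = \<epsilon> / (4 * M)"
      using h T c M by (simp add: \<eta>_def r_def field_simps)
    also have "\<epsilon> / 4 * (2 * pi) + 2 * M * (\<epsilon> / (4 * M) + 32 / T * (2 * pi))
       = \<epsilon> / 4 * (2 * pi) + \<epsilon> / 2 + 64 * M / T * (2 * pi)"
      using M by (simp add: field_simps)
    also have "\<dots> \<le> \<epsilon> / 4 * (2 * pi) + \<epsilon> / 4 * (2 * pi) + \<epsilon> / 4 * (2 * pi)"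
    proof (intro add_mono mult_right_mono order_refl)
      show "\<epsilon> / 2 \<le> \<epsilon> / 4 * (2 * pi)" using \<epsilon> pi_gt3 by (simp add: field_simps)
      show "64 * M / T \<le> \<epsilon> / 4" using T(2,3) \<epsilon> by (simp add: field_simps)
    qed auto
    also have "\<dots> < 2 * pi * \<epsilon>" using \<epsilon> by simp
    finally have "2 * pi * cmod (f z - g t) < 2 * pi * \<epsilon>" .
    then show ?thesis by (simp add: dist_norm)
  qed
  then show "\<exists>d>0. \<forall>z\<in>stolz_region \<alpha> (cis t). 0 < dist z (cis t) \<and> dist z (cis t) < d \<longrightarrow> dist (f z) (g t) < \<epsilon>"
    using \<delta> by blast
qed

text \<open>The boundary function is only measurable, so its points of approximate continuity are
  found through countably many level sets around a dense set of values: almost every t is a density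
  point of each level set containing it.\<close>

theorem Fatou_bounded:
  assumes f: "f holomorphic_on ball 0 1" and M: "\<And>z. cmod z < 1 \<Longrightarrow> cmod (f z) \<le> M"
  shows "AE \<theta> in circ. \<exists>w. nontangential_limit f (cis \<theta>) w"
proof -
  have M': "cmod (f z) \<le> M + 1" if "cmod z < 1" for z using M[OF that] by simp
  have "0 \<le> M" using M[of 0] norm_ge_zero[of "f 0"] by (simp del: norm_ge_zero)
  then have Mpos: "0 < M + 1" by simp
  obtain g where gm: "g \<in> borel_measurable circ" and gM: "\<And>\<theta>. cmod (g \<theta>) \<le> M + 1"
    and rep: "\<And>z. cmod z < 1 \<Longrightarrow> (LINT \<theta>|circ. poisson_kernel z (cis \<theta>) *\<^sub>R g \<theta>) = (2 * pi) *\<^sub>R f z"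
    using bounded_Poisson_representation[OF f M'] by blast
  obtain D :: "complex set" where D: "countable D" "\<And>X. open X \<Longrightarrow> X \<noteq> {} \<Longrightarrow> \<exists>d\<in>D. d \<in> X"
    using countable_dense_setE by blast
  define S where "S q k = {\<theta> \<in> {0..2 * pi}. cmod (g \<theta> - q) < 1 / (real k + 1)}" for q k
  have S: "S q k \<in> sets lebesgue" for q k
  proof -
    note gm [measurable]
    have "{\<theta> \<in> space circ. cmod (g \<theta> - q) < 1 / (real k + 1)} \<in> sets circ" by measurable
    then show ?thesis by (simp add: S_def sets_restrict_space_iff)
  qed
  define N where "N q k j = {x \<in> S q k. \<forall>d>0. \<exists>r. 0 < r \<and> r < d \<and> measure lebesgue (ball x r - S q k) > 1 / (real j + 1) * r}" for q k and j :: nat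
  have N: "negligible (N q k j)" for q k j
    unfolding N_def by (rule Lebesgue_density_real[OF S]) simp
  \<comment> \<open>The endpoints are removed because the density argument needs \<open>t\<close> in
    the interior of the parameter interval.\<close>
  define Z where "Z = (\<Union>q\<in>D. \<Union>k. \<Union>j. N q k j) \<union> {0, 2 * pi}"
  have "negligible Z"
    unfolding Z_def using D(1) N by (intro negligible_Un negligible_countable_Union) 
       (auto intro!: negligible_Union_nat)
  have "\<exists>w. nontangential_limit f (cis t) w" if t: "t \<in> {0..2 * pi}" "t \<notin> Z" for t
  proof
    show "nontangential_limit f (cis t) (g t)"
    proof (rule nontangential_limit_density_point[OF gm gM Mpos rep])
      show "0 < t" "t < 2 * pi" using t by (auto simp: Z_def less_le)
      fix \<epsilon> :: real assume \<epsilon>: "0 < \<epsilon>"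
      obtain k where k: "2 / \<epsilon> < real k" using reals_Archimedean2 by blast
      have k': "2 / (real k + 1) \<le> \<epsilon>"
      proof -
        have "2 < real k * \<epsilon>" using k \<epsilon> by (simp add: field_simps)
        then show ?thesis using \<epsilon> by (simp add: field_simps) 
      qed
      obtain q where q: "q \<in> D" "q \<in> ball (g t) (1 / (real k + 1))"
        using D(2)[of "ball (g t) (1 / (real k + 1))"] by auto
      have tS: "t \<in> S q k" using q(2) t(1) by (simp add: S_def dist_norm)
      show "\<exists>S\<in>sets lebesgue. (\<forall>\<theta>\<in>S. cmod (g \<theta> - g t) \<le> \<epsilon>) \<and>
          (\<forall>e>0. \<exists>d>0. \<forall>r. 0 < r \<and> r < d \<longrightarrow> measure lebesgue (ball t r - S) \<le> e * r)"
      proof (rule bexI[OF _ S[of q k]], intro conjI ballI allI impI)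
        fix \<theta> assume "\<theta> \<in> S q k"
        then have "cmod (g \<theta> - q) < 1 / (real k + 1)" "cmod (g t - q) < 1 / (real k + 1)"
          using tS by (auto simp: S_def)
        moreover have "cmod (g \<theta> - g t) \<le> cmod (g \<theta> - q) + cmod (g t - q)"
          using norm_triangle_ineq4[of "g \<theta> - q" "g t - q"] by simp
        moreover have "1 / (real k + 1) + 1 / (real k + 1) \<le> \<epsilon>" using k' by simp
        ultimately show "cmod (g \<theta> - g t) \<le> \<epsilon>" by linarith
      next
        fix e :: real assume e: "0 < e"
        obtain j where j: "1 / e < real j" using reals_Archimedean2 by blast
        have j': "1 / (real j + 1) \<le> e"
        proof -
          have "1 < real j * e" using j e by (simp add: field_simps)
          then show ?thesis using e by (simp add: field_simps)
        qed
        have "t \<notin> N q k j" using t(2) q(1) by (auto simp: Z_def)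
        then obtain d where d: "d > 0" "\<And>r. 0 < r \<Longrightarrow> r < d \<Longrightarrow> measure lebesgue (ball t r - S q k) \<le> 1 / (real j + 1) * r"
          using tS unfolding N_def mem_Collect_eq not_less[symmetric] by blast
        show "\<exists>d>0. \<forall>r. 0 < r \<and> r < d \<longrightarrow> measure lebesgue (ball t r - S q k) \<le> e * r"
        proof (intro exI[of _ d] conjI allI impI d(1))
          fix r assume r: "0 < r \<and> r < d"
          have "measure lebesgue (ball t r - S q k) \<le> 1 / (real j + 1) * r" using r d(2) by blast
          also have "\<dots> \<le> e * r" using j' r by (intro mult_right_mono) auto
          finally show "measure lebesgue (ball t r - S q k) \<le> e * r" .
        qed
      qed
    qed
  qed
  then have "AE \<theta> in lebesgue. \<theta> \<in> {0..2 * pi} \<longrightarrow> (\<exists>w. nontangential_limit f (cis \<theta>) w)"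
    using \<open>negligible Z\<close> unfolding negligible_iff_null_sets by (intro AE_I'[of Z]) auto
  then show ?thesis
    by (subst AE_restrict_space_iff) auto
qed

section \<open>Boundary values in the Nevanlinna class\<close>

lemma radial_filterlim_stolz:
  assumes "cmod \<zeta> = 1" "1 < \<alpha>"
  shows "filterlim (\<lambda>r. of_real r * \<zeta>) (at \<zeta> within stolz_region \<alpha> \<zeta>) (at_left 1)"
  unfolding filterlim_at
proof
  have "((\<lambda>r. of_real r * \<zeta>) \<longlongrightarrow> of_real 1 * \<zeta>) (at_left 1)"
    by (intro tendsto_intros)
  then show "((\<lambda>r. of_real r * \<zeta>) \<longlongrightarrow> \<zeta>) (at_left 1)" by simp
  have "\<forall>\<^sub>F r in at_left (1::real). r \<in> {0<..<1}"
    by (rule eventually_at_left_real) simp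
  then show "\<forall>\<^sub>F r in at_left 1. of_real r * \<zeta> \<in> stolz_region \<alpha> \<zeta> \<and> of_real r * \<zeta> \<noteq> \<zeta>"
  proof eventually_elim
    case (elim r)
    have eq: "of_real r * \<zeta> - \<zeta> = - (of_real (1 - r) * \<zeta>)" by (simp add: algebra_simps)
    have "cmod (of_real r * \<zeta> - \<zeta>) = 1 - r"
      unfolding eq norm_minus_cancel norm_mult norm_of_real using elim assms by simp
    moreover have "cmod (of_real r * \<zeta>) = r"
      using elim assms by (simp add: norm_mult)
    moreover have "1 * (1 - r) < \<alpha> * (1 - r)"
      using elim assms by (intro mult_strict_right_mono) auto
    ultimately show ?case
      using elim by (auto simp: stolz_region_def)
  qed
qed

lemma nontangential_imp_radial_limit:
  assumes "nontangential_limit f \<zeta> w" "cmod \<zeta> = 1"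
  shows "((\<lambda>r. f (of_real r * \<zeta>)) \<longlongrightarrow> w) (at_left 1)"
  by (rule filterlim_compose[OF _ radial_filterlim_stolz[OF assms(2), of 2]])
     (use assms(1) in \<open>auto simp: nontangential_limit_def\<close>)

text \<open>A nontangential limit is also a radial limit, and this makes it unique.\<close>

lemma boundary_value_eq:
  assumes "nontangential_limit f \<zeta> w" "cmod \<zeta> = 1"
  shows "boundary_value f \<zeta> = w"
  unfolding boundary_value_def
proof (rule the_equality)
  fix w' assume "nontangential_limit f \<zeta> w'"
  then show "w' = w"
    using nontangential_imp_radial_limit assms tendsto_unique[OF trivial_limit_at_left_real] by blast
qed (rule assms(1))

lemma boundary_value_radial_limit:
  assumes "\<exists>w. nontangential_limit f (cis \<theta>) w"
  shows "((\<lambda>r. f (of_real r * cis \<theta>)) \<longlongrightarrow> boundary_value f (cis \<theta>)) (at_left 1)"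
  using assms nontangential_imp_radial_limit boundary_value_eq by fastforce

lemma stolz_region_subset: "stolz_region \<alpha> \<zeta> \<subseteq> ball 0 1"
  by (auto simp: stolz_region_def)

lemma nontangential_limit_divide:
  assumes f: "nontangential_limit f \<zeta> a" and g: "nontangential_limit g \<zeta> b" "b \<noteq> 0"
    and eq: "\<And>z. cmod z < 1 \<Longrightarrow> h z = f z / g z"
  shows "nontangential_limit h \<zeta> (a / b)"
  unfolding nontangential_limit_def
proof (intro allI impI)
  fix \<alpha> :: real assume "1 < \<alpha>"
  with f g have "((\<lambda>z. f z / g z) \<longlongrightarrow> a / b) (at \<zeta> within stolz_region \<alpha> \<zeta>)"
    unfolding nontangential_limit_def by (intro tendsto_divide) auto
  then show "(h \<longlongrightarrow> a / b) (at \<zeta> within stolz_region \<alpha> \<zeta>)"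
    by (rule Lim_transform_eventually)
       (use stolz_region_subset[of \<alpha> \<zeta>] eq in \<open>auto simp: eventually_at_filter intro!: always_eventually\<close>)
qed

lemma radius_sequence:
  "\<exists>\<rho>::nat \<Rightarrow> real. (\<forall>n. 0 < \<rho> n \<and> \<rho> n < 1) \<and> filterlim \<rho> (at_left 1) sequentially"
proof (intro exI conjI allI)
  define \<rho> :: "nat \<Rightarrow> real" where "\<rho> n = 1 - 1 / (real n + 2)" for n
  show \<rho>: "0 < \<rho> n" "\<rho> n < 1" for n by (auto simp: \<rho>_def field_simps)
  have "\<rho> \<longlonglongrightarrow> 1" unfolding \<rho>_def by real_asymp
  moreover have "\<forall>\<^sub>F n in sequentially. \<rho> n \<in> {..<1} \<and> \<rho> n \<noteq> 1"
    using \<rho>(2) by (intro always_eventually allI) (simp add: less_imp_neq)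
  ultimately show "filterlim \<rho> (at_left 1) sequentially"
    by (simp add: filterlim_at)
qed

text \<open>Writing h = exp g, the function -ln |h| = -Re g is nonnegative with mean -Re (g 0) on
  every circle. A boundary zero set of positive measure would make these means unbounded.\<close>

lemma zero_free_boundary_nonzero:
  assumes h: "h holomorphic_on ball 0 1" and le1: "\<And>z. cmod z < 1 \<Longrightarrow> cmod (h z) \<le> 1"
    and nz: "\<And>z. cmod z < 1 \<Longrightarrow> h z \<noteq> 0"
  shows "AE \<theta> in circ. \<exists>w. w \<noteq> 0 \<and> nontangential_limit h (cis \<theta>) w"
proof -
  obtain \<rho> :: "nat \<Rightarrow> real" where \<rho>: "\<And>n. 0 < \<rho> n" "\<And>n. \<rho> n < 1" "filterlim \<rho> (at_left 1) sequentially"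
    using radius_sequence by metis
  obtain g where g: "g holomorphic_on ball 0 1" "\<And>z. z \<in> ball 0 1 \<Longrightarrow> h z = exp (g z)"
    using contractible_imp_holomorphic_log[OF h convex_imp_contractible] nz by auto
  define m where "m = - Re (g 0)"
  have ln_h: "ln (cmod (h z)) = Re (g z)" if "cmod z < 1" for z
    using g(2)[of z] that by simp
  have ln_le: "Re (g z) \<le> 0" if "cmod z < 1" for z
    using le1[OF that] nz[OF that] by (simp flip: ln_h[OF that])
  have limits: "AE \<theta> in circ. \<exists>w. nontangential_limit h (cis \<theta>) w"
    by (rule Fatou_bounded[OF h le1])
  define F where "F \<theta> = lim (\<lambda>n. h (of_real (\<rho> n) * cis \<theta>))" for \<theta>
  have cont: "continuous_on (sphere 0 1) (\<lambda>w. h (of_real (\<rho> n) * w))"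
    and contg: "continuous_on (sphere 0 1) (\<lambda>w. g (of_real (\<rho> n) * w))" for n
    using \<rho>(1,2)[of n] by (intro continuous_on_circle_dilate h g; simp)+
  have hm [measurable]: "(\<lambda>\<theta>. h (of_real (\<rho> n) * cis \<theta>)) \<in> borel_measurable circ" for n
    using borel_measurable_integrable[OF integrable_circ[OF cont]] .
  have Fm [measurable]: "F \<in> borel_measurable circ"
    unfolding F_def by measurable
  have radial: "(\<lambda>n. h (of_real (\<rho> n) * cis \<theta>)) \<longlonglongrightarrow> w" if "nontangential_limit h (cis \<theta>) w" for \<theta> w
    using filterlim_compose[OF nontangential_imp_radial_limit[OF that] \<rho>(3)] by simp
  have bound: "cmod (h (of_real (\<rho> n) * cis \<theta>)) \<le> 1" for n \<theta>
    using \<rho>(1,2)[of n] by (intro le1) (simp add: norm_mult)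
  have F: "nontangential_limit h (cis \<theta>) (F \<theta>)" if "\<exists>w. nontangential_limit h (cis \<theta>) w" for \<theta>
  proof -
    from that obtain w where w: "nontangential_limit h (cis \<theta>) w" by blast
    then have "F \<theta> = w" unfolding F_def using radial[OF w] by (rule_tac limI)
    then show ?thesis using w by simp
  qed
  define Z where "Z = {\<theta> \<in> space circ. F \<theta> = 0}"
  have Z: "Z \<in> sets circ" unfolding Z_def by measurable
  have Zfin: "emeasure circ Z < \<infinity>"
    using finite_measure.emeasure_finite[OF finite_measure_circ] by (simp add: less_top[symmetric])
  have K: "K * measure circ Z \<le> 2 * pi * m" if "0 < K" for K
  proof -
    \<comment> \<open>This is -ln |w| truncated at \<open>K\<close>: continuous and bounded on the
      closed disc, so that its integrals pass to the boundary, and equal to \<open>K\<close> at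
      0.\<close>
    define \<psi> :: "complex \<Rightarrow> real" where "\<psi> w = - ln (max (cmod w) (exp (- K)))" for w
    have pos: "0 < max (cmod w) (exp (- K))" for w :: complex
      by (simp add: less_max_iff_disj)
    have \<psi>_cont: "continuous_on A \<psi>" for A
      unfolding \<psi>_def using pos by (intro continuous_intros) (auto simp: less_imp_neq[symmetric] simp del: max_less_iff_conj)
    have \<psi>_iso: "isCont \<psi> w" for w
      using \<psi>_cont[of UNIV] by (simp add: continuous_on_eq_continuous_at)
    have \<psi>0: "\<psi> 0 = K" by (simp add: \<psi>_def max_def)
    have \<psi>_bounds: "0 \<le> \<psi> w" "\<psi> w \<le> K" if "cmod w \<le> 1" for w
    proof -
      have "max (cmod w) (exp (- K)) \<le> 1" using that \<open>0 < K\<close> by simp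
      then show "0 \<le> \<psi> w" unfolding \<psi>_def using pos[of w] by simp
      have "ln (exp (- K)) \<le> ln (max (cmod w) (exp (- K)))" by (subst ln_le_cancel_iff) (auto simp: pos)
      then show "\<psi> w \<le> K" unfolding \<psi>_def by simp
    qed
    have \<psi>_le: "\<psi> w \<le> - ln (cmod w)" if "w \<noteq> 0" for w
      unfolding \<psi>_def using that pos[of w] by (simp del: max_less_iff_conj)
    have [measurable]: "\<psi> \<in> borel_measurable borel"
      by (rule borel_measurable_continuous_onI[OF \<psi>_cont])
    have lim: "(\<lambda>n. LINT \<theta>|circ. \<psi> (h (of_real (\<rho> n) * cis \<theta>))) \<longlonglongrightarrow> (LINT \<theta>|circ. \<psi> (F \<theta>))"
    proof (rule integral_dominated_convergence[where w = "\<lambda>_. K"])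
      show "integrable circ (\<lambda>_. K)"
        using finite_measure.integrable_const[OF finite_measure_circ] .
      show "AE \<theta> in circ. (\<lambda>n. \<psi> (h (of_real (\<rho> n) * cis \<theta>))) \<longlonglongrightarrow> \<psi> (F \<theta>)"
        using limits
      proof eventually_elim
        case (elim \<theta>)
        show ?case
          by (rule isCont_tendsto_compose[OF \<psi>_iso radial[OF F[OF elim]]])
      qed
      show "AE \<theta> in circ. norm (\<psi> (h (of_real (\<rho> n) * cis \<theta>))) \<le> K" for n
        using \<psi>_bounds[OF bound] by (simp add: abs_of_nonneg)
    qed measurable
    have "(LINT \<theta>|circ. \<psi> (h (of_real (\<rho> n) * cis \<theta>))) \<le> 2 * pi * m" for n
    proof -
      have "circle_average (\<lambda>w. \<psi> (h (of_real (\<rho> n) * w))) \<le> circle_average (\<lambda>w. - Re (g (of_real (\<rho> n) * w)))"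
      proof (rule circle_average_mono)
        show "continuous_on (sphere 0 1) (\<lambda>w. \<psi> (h (of_real (\<rho> n) * w)))"
          by (rule continuous_on_compose2[OF \<psi>_cont cont]) auto
        show "continuous_on (sphere 0 1) (\<lambda>w. - Re (g (of_real (\<rho> n) * w)))"
          by (intro continuous_intros contg)
        fix w :: complex assume "cmod w = 1"
        then have w: "cmod (of_real (\<rho> n) * w) < 1" using \<rho>(1,2)[of n] by (simp add: norm_mult)
        show "\<psi> (h (of_real (\<rho> n) * w)) \<le> - Re (g (of_real (\<rho> n) * w))"
          using \<psi>_le[OF nz[OF w]] ln_h[OF w] by simp
      qed
      also have "\<dots> = - Re (circle_average (\<lambda>w. g (of_real (\<rho> n) * w)))"
        using circle_average_bounded_linear[OF bounded_linear_minus[OF bounded_linear_Re] contg] .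
      also have "circle_average (\<lambda>w. g (of_real (\<rho> n) * w)) = g (of_real (\<rho> n) * 0)"
        by (rule mean_value_property[OF holomorphic_dilate[OF g(1)]]) (use \<rho>(1,2)[of n] in auto)
      finally show ?thesis by (simp add: circle_average_def m_def field_simps)
    qed
    then have "(LINT \<theta>|circ. \<psi> (F \<theta>)) \<le> 2 * pi * m"
      by (intro LIMSEQ_le_const2[OF lim]) auto
    moreover have "(LINT \<theta>|circ. K * indicator Z \<theta>) \<le> (LINT \<theta>|circ. \<psi> (F \<theta>))"
    proof (rule integral_mono_AE)
      show "integrable circ (\<lambda>\<theta>. K * indicator Z \<theta>)"
        using Z Zfin by (auto intro!: integrable_real_indicator)
      have bd: "AE \<theta> in circ. 0 \<le> \<psi> (F \<theta>) \<and> \<psi> (F \<theta>) \<le> K"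
        using limits
      proof eventually_elim
        case (elim \<theta>)
        have "cmod (F \<theta>) \<le> 1"
          by (rule Lim_bounded[OF tendsto_norm[OF radial[OF F[OF elim]]]]) (use bound in auto)
        then show ?case using \<psi>_bounds by blast
      qed
      show "integrable circ (\<lambda>\<theta>. \<psi> (F \<theta>))"
        by (rule finite_measure.integrable_const_bound[OF finite_measure_circ, of _ K]) (use bd in auto)
      show "AE \<theta> in circ. K * indicator Z \<theta> \<le> \<psi> (F \<theta>)"
        using bd by eventually_elim (auto simp: indicator_def Z_def \<psi>0)
    qed
    moreover have "(LINT \<theta>|circ. K * indicator Z \<theta>) = K * measure circ Z"
    proof -
      have "Z \<inter> {0..2 * pi} = Z" by (auto simp: Z_def)
      then show ?thesis by simp
    qed
    ultimately show ?thesis by linarith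
  qed
  have "measure circ Z = 0"
  proof (rule ccontr)
    assume "measure circ Z \<noteq> 0"
    then have pos: "0 < measure circ Z" by (simp add: zero_less_measure_iff)
    have m0: "0 \<le> m" using ln_le[of 0] by (simp add: m_def)
    \<comment> \<open>This choice of \<open>K\<close> contradicts the bound.\<close>
    have "(2 * pi * m + 1) / measure circ Z * measure circ Z \<le> 2 * pi * m"
      using pos m0 by (intro K divide_pos_pos add_nonneg_pos) auto
    then show False using pos by simp
  qed
  then have "emeasure circ Z = 0"
    using finite_measure.emeasure_eq_measure[OF finite_measure_circ, of Z] by simp
  then have "AE \<theta> in circ. \<theta> \<notin> Z"
    using Z by (intro AE_not_in) (auto simp: null_sets_def)
  moreover have "AE \<theta> in circ. \<theta> \<in> space circ" by (rule AE_space)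
  ultimately show ?thesis
    using limits
  proof eventually_elim
    case (elim \<theta>)
    then have "F \<theta> \<noteq> 0" by (simp add: Z_def)
    then show ?case using F[OF elim(3)] by blast
  qed
qed

text \<open>This exhibits f = (f h) / h as a quotient of bounded functions. The denominator is a
  limit of functions exp (-p), where Re p majorizes log+ |f| on circles growing to the unit
  circle.\<close>

lemma log_bounded_quotient:
  assumes f: "f \<in> log_bounded 1 L"
  obtains h where "h holomorphic_on ball 0 1" "\<And>z. cmod z < 1 \<Longrightarrow> cmod (h z) \<le> 1"
    "\<And>z. cmod z < 1 \<Longrightarrow> h z \<noteq> 0" "\<And>z. cmod z < 1 \<Longrightarrow> cmod (f z * h z) \<le> 1"
proof -
  have hol: "f holomorphic_on ball 0 1" using f by (rule log_bounded_holomorphic)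
  obtain \<rho> :: "nat \<Rightarrow> real" where \<rho>: "\<And>n. 0 < \<rho> n" "\<And>n. \<rho> n < 1" "filterlim \<rho> (at_left 1) sequentially"
    using radius_sequence by metis
  have \<rho>_lim: "\<rho> \<longlonglongrightarrow> 1"
    using \<rho>(3) by (simp add: filterlim_at)
  have "\<exists>p :: complex poly. (\<forall>z. cmod z \<le> 1 \<longrightarrow> 0 \<le> Re (poly p z)) \<and>
      (\<forall>z. cmod z \<le> 1 \<longrightarrow> cmod (f (of_real (\<rho> n) * z)) \<le> exp (Re (poly p z))) \<and> Re (poly p 0) \<le> L + 1" for n
  proof -
    obtain p :: "complex poly" where p: "\<And>z. cmod z \<le> 1 \<Longrightarrow> 0 \<le> Re (poly p z)"
      "\<And>z. cmod z \<le> 1 \<Longrightarrow> 1 * cmod (f (of_real (\<rho> n) * z)) \<le> exp (Re (poly p z))"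
      "Re (poly p 0) \<le> log_mean 1 f (\<rho> n) + 1"
      using log_mean_majorant[OF hol \<rho>(1,2), of 1 1 n] by auto
    have "log_mean 1 f (\<rho> n) \<le> L" using f \<rho>(1,2)[of n] by (auto simp: log_bounded_def)
    with p show ?thesis by (intro exI[of _ p]) auto
  qed
  then obtain p :: "nat \<Rightarrow> complex poly" where
    p0: "\<And>n z. cmod z \<le> 1 \<Longrightarrow> 0 \<le> Re (poly (p n) z)"
    and pf: "\<And>n z. cmod z \<le> 1 \<Longrightarrow> cmod (f (of_real (\<rho> n) * z)) \<le> exp (Re (poly (p n) z))"
    and pL: "\<And>n. Re (poly (p n) 0) \<le> L + 1"
    by metis
  define H where "H = {h. h holomorphic_on ball 0 1 \<and> (\<forall>z\<in>ball 0 1. cmod (h z) \<le> 1)}"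
  have rng: "range (\<lambda>n z. exp (- poly (p n) z)) \<subseteq> H"
    using p0 by (auto simp: H_def intro!: holomorphic_intros)
  have bdd: "\<exists>B. \<forall>h\<in>H. \<forall>z\<in>K. cmod (h z) \<le> B" if "K \<subseteq> ball 0 1" for K
    using that by (intro exI[of _ 1]) (auto simp: H_def)
  have Hhol: "h holomorphic_on ball 0 1" if "h \<in> H" for h
    using that by (simp add: H_def)
  obtain h k where h: "h holomorphic_on ball 0 1" and k: "strict_mono (k :: nat \<Rightarrow> nat)"
    and lim: "\<And>z. z \<in> ball 0 1 \<Longrightarrow> (\<lambda>n. exp (- poly (p (k n)) z)) \<longlonglongrightarrow> h z"
    and ulim: "\<And>K. \<lbrakk>compact K; K \<subseteq> ball 0 1\<rbrakk> \<Longrightarrow> uniform_limit K ((\<lambda>n z. exp (- poly (p n) z)) \<circ> k) h sequentially"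
    by (rule Montel[OF open_ball, of H 0 1 "\<lambda>n z. exp (- poly (p n) z)"])
       (use Hhol bdd rng in auto)
  \<comment> \<open>The bound on the majorants at 0 keeps the limit from vanishing there; Hurwitz's
    theorem then excludes zeros everywhere.\<close>
  have "exp (- (L + 1)) \<le> cmod (h 0)"
  proof (rule Lim_bounded2[OF tendsto_norm[OF lim[of 0]]])
    show "\<forall>n\<ge>0. exp (- (L + 1)) \<le> cmod (exp (- poly (p (k n)) 0))"
    proof (intro allI impI)
      fix n show "exp (- (L + 1)) \<le> cmod (exp (- poly (p (k n)) 0))"
        using pL[of "k n"] by simp
    qed
  qed simp
  then have h0: "h 0 \<noteq> 0" by (metis exp_gt_zero norm_zero not_le)
  have nz: "h z \<noteq> 0" if z: "cmod z < 1" for z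
  proof (cases "h constant_on ball 0 1")
    case True
    then show ?thesis using h0 z by (metis centre_in_ball constant_on_def dist_0_norm mem_ball zero_less_one)
  next
    case False
    show ?thesis
      by (rule Hurwitz_no_zeros[OF open_ball connected_ball _ h ulim False])
         (use z in \<open>auto intro!: holomorphic_intros\<close>)
  qed
  show ?thesis
  proof (rule that[OF h _ nz])
    fix z :: complex assume z: "cmod z < 1"
    show "cmod (h z) \<le> 1"
      by (rule Lim_bounded[OF tendsto_norm[OF lim[of z]]]) (use z p0[of z] in auto)
    have "isCont f z"
      using holomorphic_on_imp_continuous_on[OF hol] z by (simp add: continuous_on_eq_continuous_at)
    moreover have "(\<lambda>n. of_real (\<rho> (k n)) * z) \<longlonglongrightarrow> of_real 1 * z"
      by (intro tendsto_intros LIMSEQ_subseq_LIMSEQ[OF \<rho>_lim k, unfolded o_def])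
    ultimately have "(\<lambda>n. f (of_real (\<rho> (k n)) * z)) \<longlonglongrightarrow> f z"
      using isCont_tendsto_compose[of z f "\<lambda>n. of_real (\<rho> (k n)) * z" sequentially] by simp
    then have "(\<lambda>n. f (of_real (\<rho> (k n)) * z) * exp (- poly (p (k n)) z)) \<longlonglongrightarrow> f z * h z"
      using lim[of z] z by (intro tendsto_mult) auto
    from Lim_bounded[OF tendsto_norm[OF this], of 0 1]
    show "cmod (f z * h z) \<le> 1"
      using pf[of z] z by (auto simp: norm_mult norm_divide exp_minus field_simps)
  qed
qed

theorem Fatou_log_bounded:
  assumes "f \<in> log_bounded 1 L"
  shows "AE \<theta> in circ. \<exists>w. nontangential_limit f (cis \<theta>) w"
proof -
  obtain h where h: "h holomorphic_on ball 0 1" "\<And>z. cmod z < 1 \<Longrightarrow> cmod (h z) \<le> 1"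
    and nz: "\<And>z. cmod z < 1 \<Longrightarrow> h z \<noteq> 0" and fh: "\<And>z. cmod z < 1 \<Longrightarrow> cmod (f z * h z) \<le> 1"
    using log_bounded_quotient[OF assms] by blast
  have "(\<lambda>z. f z * h z) holomorphic_on ball 0 1"
    by (intro holomorphic_intros h log_bounded_holomorphic[OF assms])
  then have "AE \<theta> in circ. \<exists>w. nontangential_limit (\<lambda>z. f z * h z) (cis \<theta>) w"
    by (rule Fatou_bounded[OF _ fh])
  moreover have "AE \<theta> in circ. \<exists>w. w \<noteq> 0 \<and> nontangential_limit h (cis \<theta>) w"
    by (rule zero_free_boundary_nonzero[OF h nz])
  ultimately show ?thesis
  proof eventually_elim
    case (elim \<theta>)
    then obtain a b where "nontangential_limit (\<lambda>z. f z * h z) (cis \<theta>) a"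
      "nontangential_limit h (cis \<theta>) b" "b \<noteq> 0" by blast
    then have "nontangential_limit f (cis \<theta>) (a / b)"
      by (rule nontangential_limit_divide) (simp add: nz)
    then show ?case by blast
  qed
qed

section \<open>The Nevanlinna and Smirnov classes in terms of logarithmic means\<close>

lemma circle_mean_log_mean:
  "circle_mean (\<lambda>\<zeta>. log_plus (cmod (f (of_real r * \<zeta>)))) = log_mean 1 f r"
  by (simp add: circle_mean_eq_average log_mean_def)

lemma log_bounded_mono:
  assumes "f \<in> log_bounded c L" "0 \<le> d" "d \<le> c" "L \<le> M"
  shows "f \<in> log_bounded d M"
proof -
  have "log_mean d f r \<le> log_mean c f r" if "0 < r" "r < 1" for r
    unfolding log_mean_def using that assms log_bounded_holomorphic[OF assms(1)]
    by (intro circle_average_mono continuous_on_circle_log_plus log_plus_mono mult_right_mono) auto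
  moreover have "log_mean c f r \<le> M" if "0 < r" "r < 1" for r
    using that assms(1,4) by (force simp: log_bounded_def)
  ultimately have "log_mean d f r \<le> M" if "0 < r" "r < 1" for r
    using that order_trans by blast
  then show ?thesis
    using log_bounded_holomorphic[OF assms(1)] by (simp add: log_bounded_def)
qed

text \<open>The constant function 1 lies in \<open>log_bounded (1 / c) (log_plus (1 / c))\<close>,
  and multiplying by it moves \<open>c\<close> to 1.\<close>

lemma log_bounded_normalize:
  assumes f: "f \<in> log_bounded c L" and c: "0 < c"
  shows "f \<in> log_bounded 1 (log_plus (1 / c) + L)"
proof -
  have "(\<lambda>_. 1) \<in> log_bounded (1 / c) (log_plus (1 / c))"
    by (auto simp: log_bounded_def log_mean_def)
  from log_bounded_mult[OF this f] show ?thesis using c by simp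
qed

lemma log_mean_le_limit:
  assumes f: "f holomorphic_on ball 0 1" and c: "0 \<le> c"
    and lim: "((\<lambda>r. log_mean c f r) \<longlongrightarrow> L) (at_left 1)" and r: "0 < r" "r < 1"
  shows "log_mean c f r \<le> L"
proof (rule tendsto_lowerbound[OF lim])
  have "\<forall>\<^sub>F s in at_left 1. s \<in> {r<..<1}"
    using r by (intro eventually_at_left_real)
  then show "\<forall>\<^sub>F s in at_left 1. log_mean c f r \<le> log_mean c f s"
    by eventually_elim (use r in \<open>auto intro!: log_mean_mono f c\<close>)
qed simp

lemma log_mean_tendsto:
  assumes f: "f \<in> log_bounded c L" and c: "0 \<le> c"
  shows "\<exists>M. ((\<lambda>r. log_mean c f r) \<longlongrightarrow> M) (at_left 1)"
proof -
  define M where "M = (SUP r\<in>{0<..<1}. log_mean c f r)"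
  have hol: "f holomorphic_on ball 0 1" using f by (rule log_bounded_holomorphic)
  have bdd: "bdd_above (log_mean c f ` {0<..<1})"
    using f by (intro bdd_aboveI[of _ L]) (auto simp: log_bounded_def)
  have ev: "\<forall>\<^sub>F s in at_left 1. s \<in> {r<..<1}" if "r < 1" for r :: real
    using that by (intro eventually_at_left_real)
  have ev0: "\<forall>\<^sub>F s in at_left 1. s \<in> {0<..<1::real}"
    by (rule ev) simp
  have "((\<lambda>r. log_mean c f r) \<longlongrightarrow> M) (at_left 1)"
  proof (rule increasing_tendsto)
    show "\<forall>\<^sub>F r in at_left 1. log_mean c f r \<le> M"
      using ev0 by eventually_elim (auto simp: M_def intro!: cSUP_upper bdd)
    fix x assume "x < M"
    then obtain r where r: "0 < r" "r < 1" "x < log_mean c f r"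
      unfolding M_def using less_cSUP_iff[OF _ bdd] by auto
    show "\<forall>\<^sub>F r in at_left 1. x < log_mean c f r"
      using ev[OF r(2)]
    proof eventually_elim
      case (elim s)
      then have "log_mean c f r \<le> log_mean c f s"
        using r by (intro log_mean_mono hol c) auto
      then show ?case using r by simp
    qed
  qed
  then show ?thesis by blast
qed

lemma nevanlinna_iff: "f \<in> nevanlinna \<longleftrightarrow> (\<exists>L. f \<in> log_bounded 1 L)"
proof
  assume "f \<in> nevanlinna"
  then obtain L where "f holomorphic_on ball 0 1" "((\<lambda>r. log_mean 1 f r) \<longlongrightarrow> L) (at_left 1)"
    by (auto simp: nevanlinna_def circle_mean_log_mean)
  then show "\<exists>L. f \<in> log_bounded 1 L"
    by (intro exI[of _ L]) (auto simp: log_bounded_def intro!: log_mean_le_limit)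
next
  assume "\<exists>L. f \<in> log_bounded 1 L"
  then obtain L where "f \<in> log_bounded 1 L" by blast
  then show "f \<in> nevanlinna"
    using log_mean_tendsto[of f 1 L] log_bounded_holomorphic[of f 1 L]
    by (auto simp: nevanlinna_def circle_mean_log_mean)
qed

lemma AE_radial_limit:
  assumes "f \<in> log_bounded 1 L"
  shows "AE \<theta> in circ. ((\<lambda>r. f (of_real r * cis \<theta>)) \<longlongrightarrow> boundary_value f (cis \<theta>)) (at_left 1)"
  using Fatou_log_bounded[OF assms] by eventually_elim (rule boundary_value_radial_limit)

lemma borel_measurable_dilate:
  assumes "f holomorphic_on ball 0 1" "0 < r" "r < 1"
  shows "(\<lambda>\<theta>. f (of_real r * cis \<theta>)) \<in> borel_measurable circ"
  using borel_measurable_integrable[OF integrable_circ[OF continuous_on_circle_dilate[of f r]]] assms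
  by simp

text \<open>\<open>boundary_value\<close> is a description and so not measurable by construction. It
  agrees almost everywhere with the limit along a sequence of radii, and completeness of Lebesgue
  measure transfers measurability; extension by 0 moves the question to the whole line.\<close>

lemma borel_measurable_boundary_value:
  assumes f: "f \<in> log_bounded 1 L"
  shows "(\<lambda>\<theta>. boundary_value f (cis \<theta>)) \<in> borel_measurable circ"
proof -
  obtain \<rho> :: "nat \<Rightarrow> real" where \<rho>: "\<And>n. 0 < \<rho> n" "\<And>n. \<rho> n < 1" "filterlim \<rho> (at_left 1) sequentially"
    using radius_sequence by metis
  define F where "F \<theta> = lim (\<lambda>n. f (of_real (\<rho> n) * cis \<theta>))" for \<theta>
  have [measurable]: "(\<lambda>\<theta>. f (of_real (\<rho> n) * cis \<theta>)) \<in> borel_measurable circ" for n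
    by (rule borel_measurable_dilate[OF log_bounded_holomorphic[OF f] \<rho>(1,2)])
  have Fm: "F \<in> borel_measurable circ"
    unfolding F_def by measurable
  have "AE \<theta> in circ. F \<theta> = boundary_value f (cis \<theta>)"
    using AE_radial_limit[OF f]
  proof eventually_elim
    case (elim \<theta>)
    show ?case unfolding F_def by (rule limI[OF filterlim_compose[OF elim \<rho>(3)]])
  qed
  then have "AE \<theta> in lebesgue. \<theta> \<in> {0..2 * pi} \<longrightarrow> F \<theta> = boundary_value f (cis \<theta>)"
    by (subst (asm) AE_restrict_space_iff) auto
  then have "AE \<theta> in lebesgue. (if \<theta> \<in> {0..2 * pi} then F \<theta> else 0)
      = (if \<theta> \<in> {0..2 * pi} then boundary_value f (cis \<theta>) else 0)"
    by eventually_elim auto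
  moreover have "(\<lambda>\<theta>. if \<theta> \<in> {0..2 * pi} then F \<theta> else 0) \<in> borel_measurable lebesgue"
    using Fm by (intro borel_measurable_if_I) auto
  ultimately have "(\<lambda>\<theta>. if \<theta> \<in> {0..2 * pi} then boundary_value f (cis \<theta>) else 0) \<in> borel_measurable lebesgue"
    by (rule borel_measurable_AE[rotated])
  then show ?thesis by (rule borel_measurable_if_D)
qed

lemma continuous_log_plus_cmod: "continuous_on UNIV (\<lambda>w. log_plus (c * cmod w))" if "0 \<le> c"
  using that by (intro continuous_intros) auto

lemma borel_measurable_log_plus_cmod:
  assumes "0 \<le> c" "g \<in> borel_measurable M"
  shows "(\<lambda>x. log_plus (c * cmod (g x))) \<in> borel_measurable M"
  using measurable_compose[OF assms(2) borel_measurable_continuous_onI[OF continuous_log_plus_cmod[OF assms(1)]]]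
  by simp

text \<open>Fatou's lemma along a sequence of radii.\<close>

lemma boundary_log_plus_integrable:
  assumes f: "f \<in> log_bounded 1 L"
  shows "integrable circ (\<lambda>\<theta>. log_plus (cmod (boundary_value f (cis \<theta>))))"
    and "circle_mean (\<lambda>\<zeta>. log_plus (cmod (boundary_value f \<zeta>))) \<le> L"
proof -
  let ?b = "\<lambda>\<theta>. boundary_value f (cis \<theta>)"
  obtain \<rho> :: "nat \<Rightarrow> real" where \<rho>: "\<And>n. 0 < \<rho> n" "\<And>n. \<rho> n < 1" "filterlim \<rho> (at_left 1) sequentially"
    using radius_sequence by metis
  have hol: "f holomorphic_on ball 0 1" using f by (rule log_bounded_holomorphic)
  have L0: "0 \<le> L"
    using log_mean_nonneg[of 1 f "\<rho> 0"] f \<rho>(1,2)[of 0] by (auto simp: log_bounded_def intro: order_trans)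
  note bm = borel_measurable_boundary_value[OF f]
  have bm1 [measurable]: "(\<lambda>\<theta>. log_plus (cmod (?b \<theta>))) \<in> borel_measurable circ"
    using borel_measurable_log_plus_cmod[OF _ bm, of 1] by simp
  let ?u = "\<lambda>n \<theta>. log_plus (cmod (f (of_real (\<rho> n) * cis \<theta>)))"
  have um [measurable]: "?u n \<in> borel_measurable circ" for n
    using borel_measurable_log_plus_cmod[OF _ borel_measurable_dilate[OF hol \<rho>(1,2)], of 1] by simp
  have ui: "integrable circ (?u n)" for n
    using integrable_circ[OF continuous_on_circle_log_plus[OF hol, of "\<rho> n" 1]] \<rho>(1,2)[of n] by simp
  have uL: "(\<integral>\<^sup>+ \<theta>. ennreal (?u n \<theta>) \<partial>circ) \<le> ennreal (2 * pi * L)" for n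
  proof -
    have "log_mean 1 f (\<rho> n) \<le> L" using f \<rho>(1,2)[of n] by (auto simp: log_bounded_def)
    then have "(LINT \<theta>|circ. ?u n \<theta>) \<le> 2 * pi * L"
      by (simp add: log_mean_def circle_average_def field_simps)
    then show ?thesis
      by (subst nn_integral_eq_integral[OF ui]) (auto simp: log_plus_nonneg intro: ennreal_leI)
  qed
  have "(\<integral>\<^sup>+ \<theta>. ennreal (log_plus (cmod (?b \<theta>))) \<partial>circ)
     \<le> (\<integral>\<^sup>+ \<theta>. liminf (\<lambda>n. ennreal (?u n \<theta>)) \<partial>circ)"
  proof (rule nn_integral_mono_AE)
    show "AE \<theta> in circ. ennreal (log_plus (cmod (?b \<theta>))) \<le> liminf (\<lambda>n. ennreal (?u n \<theta>))"
      using AE_radial_limit[OF f]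
    proof eventually_elim
      case (elim \<theta>)
      have "(\<lambda>n. f (of_real (\<rho> n) * cis \<theta>)) \<longlonglongrightarrow> ?b \<theta>"
        by (rule filterlim_compose[OF elim \<rho>(3)])
      then have "(\<lambda>n. ?u n \<theta>) \<longlonglongrightarrow> log_plus (cmod (?b \<theta>))"
        using isCont_tendsto_compose[of "?b \<theta>" "\<lambda>w. log_plus (1 * cmod w)"]
          continuous_log_plus_cmod[of 1] by (simp add: continuous_on_eq_continuous_at)
      then have "(\<lambda>n. ennreal (?u n \<theta>)) \<longlonglongrightarrow> ennreal (log_plus (cmod (?b \<theta>)))"
        by (rule tendsto_ennrealI)
      then show ?case by (simp add: lim_imp_Liminf)
    qed
  qed
  also have "\<dots> \<le> liminf (\<lambda>n. \<integral>\<^sup>+ \<theta>. ennreal (?u n \<theta>) \<partial>circ)"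
    by (rule nn_integral_liminf) measurable
  also have "\<dots> \<le> liminf (\<lambda>n::nat. ennreal (2 * pi * L))"
    by (intro Liminf_mono always_eventually allI uL)
  also have "\<dots> = ennreal (2 * pi * L)"
    by (rule Liminf_const) simp
  finally have fin: "(\<integral>\<^sup>+ \<theta>. ennreal (log_plus (cmod (?b \<theta>))) \<partial>circ) \<le> ennreal (2 * pi * L)" .
  show int: "integrable circ (\<lambda>\<theta>. log_plus (cmod (?b \<theta>)))"
    using fin by (intro integrableI_nonneg) (auto simp: log_plus_nonneg intro: le_less_trans)
  have "ennreal (LINT \<theta>|circ. log_plus (cmod (?b \<theta>))) \<le> ennreal (2 * pi * L)"
    using fin by (subst (asm) nn_integral_eq_integral[OF int]) (auto simp: log_plus_nonneg)
  then have "(LINT \<theta>|circ. log_plus (cmod (?b \<theta>))) \<le> 2 * pi * L"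
    using L0 by simp
  then show "circle_mean (\<lambda>\<zeta>. log_plus (cmod (boundary_value f \<zeta>))) \<le> L"
    by (simp add: circle_mean_eq_average circle_average_def field_simps)
qed

lemma log_plus_truncate:
  assumes "0 \<le> K" "0 \<le> x"
  shows "log_plus (exp (- K) * x) = log_plus x - min (log_plus x) K"
proof (cases "x = 0")
  case False
  with assms have x: "0 < x" by simp
  then have "ln (exp (- K) * x) = ln x - K" by (simp add: ln_mult)
  then show ?thesis using assms by (auto simp: log_plus_def min_def max_def)
qed (use assms in \<open>simp add: log_plus_def\<close>)

text \<open>Truncation at \<open>K\<close> provides a constant dominating function, so this
  convergence holds in the whole Nevanlinna class; only the untruncated means distinguish the
  Smirnov class.\<close>

lemma truncated_mean_tendsto:
  assumes f: "f \<in> log_bounded 1 L" and K: "0 \<le> K"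
  shows "((\<lambda>r. circle_average (\<lambda>w. min (log_plus (cmod (f (of_real r * w)))) K))
    \<longlongrightarrow> circle_average (\<lambda>\<zeta>. min (log_plus (cmod (boundary_value f \<zeta>))) K)) (at_left 1)"
proof (rule tendsto_at_left_sequentially[of 0])
  fix \<rho> :: "nat \<Rightarrow> real" assume \<rho>: "\<And>n. \<rho> n < 1" "\<And>n. 0 < \<rho> n" "incseq \<rho>" "\<rho> \<longlonglongrightarrow> 1"
  have hol: "f holomorphic_on ball 0 1" using f by (rule log_bounded_holomorphic)
  have fl: "filterlim \<rho> (at_left 1) sequentially"
    using \<rho> by (auto simp: filterlim_at less_imp_neq)
  define \<psi> where "\<psi> w = min (log_plus (1 * cmod w)) K" for w :: complex
  have \<psi>c: "continuous_on UNIV \<psi>"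
    unfolding \<psi>_def by (intro continuous_intros continuous_log_plus_cmod) auto
  then have \<psi>_iso: "isCont \<psi> w" for w by (simp add: continuous_on_eq_continuous_at)
  have [measurable]: "\<psi> \<in> borel_measurable borel"
    by (rule borel_measurable_continuous_onI[OF \<psi>c])
  have [measurable]: "(\<lambda>\<theta>. f (of_real (\<rho> n) * cis \<theta>)) \<in> borel_measurable circ" for n
    by (rule borel_measurable_dilate[OF hol \<rho>(2,1)])
  note borel_measurable_boundary_value[OF f, measurable]
  have "(\<lambda>n. LINT \<theta>|circ. \<psi> (f (of_real (\<rho> n) * cis \<theta>))) \<longlonglongrightarrow> (LINT \<theta>|circ. \<psi> (boundary_value f (cis \<theta>)))"
  proof (rule integral_dominated_convergence[where w = "\<lambda>_. K"])
    show "integrable circ (\<lambda>_. K)"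
      using finite_measure.integrable_const[OF finite_measure_circ] .
    show "AE \<theta> in circ. (\<lambda>n. \<psi> (f (of_real (\<rho> n) * cis \<theta>))) \<longlonglongrightarrow> \<psi> (boundary_value f (cis \<theta>))"
      using AE_radial_limit[OF f]
    proof eventually_elim
      case (elim \<theta>)
      show ?case
        by (rule isCont_tendsto_compose[OF \<psi>_iso filterlim_compose[OF elim fl]])
    qed
    show "AE \<theta> in circ. norm (\<psi> (f (of_real (\<rho> n) * cis \<theta>))) \<le> K" for n
      using K by (simp add: \<psi>_def log_plus_nonneg)
  qed measurable
  then show "(\<lambda>n. circle_average (\<lambda>w. min (log_plus (cmod (f (of_real (\<rho> n) * w)))) K))
    \<longlonglongrightarrow> circle_average (\<lambda>\<zeta>. min (log_plus (cmod (boundary_value f \<zeta>))) K)"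
    unfolding circle_average_def \<psi>_def by (intro tendsto_intros) simp
qed simp

lemma log_mean_truncate:
  assumes f: "f holomorphic_on ball 0 1" and K: "0 \<le> K" and r: "0 < r" "r < 1"
  shows "log_mean (exp (- K)) f r
    = log_mean 1 f r - circle_average (\<lambda>w. min (log_plus (cmod (f (of_real r * w)))) K)"
proof -
  have cont: "continuous_on (sphere 0 1) (\<lambda>w. log_plus (cmod (f (of_real r * w))))"
    using continuous_on_circle_log_plus[OF f, of r 1] r by simp
  have "log_mean (exp (- K)) f r = circle_average (\<lambda>w. log_plus (cmod (f (of_real r * w)))
      - min (log_plus (cmod (f (of_real r * w)))) K)"
    unfolding log_mean_def by (simp add: log_plus_truncate K)
  also have "\<dots> = log_mean 1 f r - circle_average (\<lambda>w. min (log_plus (cmod (f (of_real r * w)))) K)"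
    unfolding log_mean_def by (subst circle_average_diff) (auto intro!: cont continuous_intros)
  finally show ?thesis .
qed

text \<open>The Smirnov class consists of the functions whose logarithmic means are uniformly integrable.
  As \<open>log_plus (exp (-K) x)\<close> is the excess of \<open>log_plus x\<close> over \<open>K\<close>, this is expressed by the
  smallness of the means of \<open>log_plus (c \<bar>f\<bar>)\<close> for small \<open>c\<close>.\<close>

theorem smirnov_iff: "f \<in> smirnov \<longleftrightarrow> (\<forall>\<epsilon>>0. \<exists>c>0. f \<in> log_bounded c \<epsilon>)"
proof
  assume f: "f \<in> smirnov"
  then obtain L where L: "f \<in> log_bounded 1 L"
    using nevanlinna_iff by (auto simp: smirnov_def)
  have hol: "f holomorphic_on ball 0 1" using L by (rule log_bounded_holomorphic)
  define u where "u \<theta> = log_plus (cmod (boundary_value f (cis \<theta>)))" for \<theta>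
  have ui: "integrable circ u" unfolding u_def by (rule boundary_log_plus_integrable[OF L])
  have lim: "((\<lambda>r. log_mean 1 f r) \<longlongrightarrow> circle_average (\<lambda>\<zeta>. log_plus (cmod (boundary_value f \<zeta>)))) (at_left 1)"
    using f by (simp add: smirnov_def circle_mean_log_mean circle_mean_eq_average)
  show "\<forall>\<epsilon>>0. \<exists>c>0. f \<in> log_bounded c \<epsilon>"
  proof (intro allI impI)
    fix \<epsilon> :: real assume \<epsilon>: "0 < \<epsilon>"
    have um [measurable]: "u \<in> borel_measurable circ" using ui by (rule borel_measurable_integrable)
    \<comment> \<open>Integrability of the boundary function makes its excess over \<open>n\<close>
      small in mean for large \<open>n\<close>.\<close>
    have "(\<lambda>n. LINT \<theta>|circ. min (u \<theta>) (real n)) \<longlonglongrightarrow> (LINT \<theta>|circ. u \<theta>)"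
    proof (rule integral_dominated_convergence[where w = u])
      show "AE \<theta> in circ. (\<lambda>n. min (u \<theta>) (real n)) \<longlonglongrightarrow> u \<theta>"
      proof (intro AE_I2 tendsto_eventually)
        fix \<theta> :: real
        obtain N where "u \<theta> \<le> real N" using real_arch_simple by blast
        then show "\<forall>\<^sub>F n in sequentially. min (u \<theta>) (real n) = u \<theta>"
          by (intro eventually_sequentiallyI[of N]) (simp add: min_def)
      qed
      show "AE \<theta> in circ. norm (min (u \<theta>) (real n)) \<le> u \<theta>" for n
        by (auto simp: u_def log_plus_nonneg)
    qed (use ui in measurable)
    then have "(\<lambda>n. (LINT \<theta>|circ. u \<theta>) - (LINT \<theta>|circ. min (u \<theta>) (real n))) \<longlonglongrightarrow> (LINT \<theta>|circ. u \<theta>) - (LINT \<theta>|circ. u \<theta>)"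
      by (intro tendsto_intros)
    then have "\<forall>\<^sub>F n in sequentially. (LINT \<theta>|circ. u \<theta>) - (LINT \<theta>|circ. min (u \<theta>) (real n)) < 2 * pi * \<epsilon>"
      using \<epsilon> by (intro order_tendstoD(2)) auto
    then obtain n where n: "(LINT \<theta>|circ. u \<theta>) - (LINT \<theta>|circ. min (u \<theta>) (real n)) < 2 * pi * \<epsilon>"
      by (auto simp: eventually_sequentially)
    define I where "I = circle_average (\<lambda>\<zeta>. log_plus (cmod (boundary_value f \<zeta>)))
       - circle_average (\<lambda>\<zeta>. min (log_plus (cmod (boundary_value f \<zeta>))) (real n))"
    have I: "I \<le> \<epsilon>"
      using n unfolding I_def circle_average_def u_def by (simp add: field_simps)
    have "((\<lambda>r. log_mean 1 f r - circle_average (\<lambda>w. min (log_plus (cmod (f (of_real r * w)))) (real n))) \<longlongrightarrow> I) (at_left 1)"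
      unfolding I_def by (intro tendsto_diff lim truncated_mean_tendsto[OF L]) simp
    then have limI: "((\<lambda>r. log_mean (exp (- real n)) f r) \<longlongrightarrow> I) (at_left 1)"
    proof (rule Lim_transform_eventually)
      have "\<forall>\<^sub>F r in at_left 1. r \<in> {0<..<1::real}" by (rule eventually_at_left_real) simp
      then show "\<forall>\<^sub>F r in at_left 1. log_mean 1 f r - circle_average (\<lambda>w. min (log_plus (cmod (f (of_real r * w)))) (real n))
          = log_mean (exp (- real n)) f r"
        by eventually_elim (simp add: log_mean_truncate[OF hol])
    qed
    have "f \<in> log_bounded (exp (- real n)) \<epsilon>"
      using log_mean_le_limit[OF hol _ limI] I hol by (force simp: log_bounded_def)
    then show "\<exists>c>0. f \<in> log_bounded c \<epsilon>" by (intro exI[of _ "exp (- real n)"]) simp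
  qed
next
  assume S: "\<forall>\<epsilon>>0. \<exists>c>0. f \<in> log_bounded c \<epsilon>"
  then obtain c where "0 < c" "f \<in> log_bounded c 1" by (metis zero_less_one)
  from log_bounded_normalize[OF this(2,1)] obtain L where L: "f \<in> log_bounded 1 L" by blast
  have hol: "f holomorphic_on ball 0 1" using L by (rule log_bounded_holomorphic)
  obtain M where M: "((\<lambda>r. log_mean 1 f r) \<longlongrightarrow> M) (at_left 1)"
    using log_mean_tendsto[OF L] by auto
  \<comment> \<open>The limit of the means is itself a bound, and with it the boundary estimate
    gives \<open>?I \<le> M\<close>.\<close>
  have LM: "f \<in> log_bounded 1 M"
    using log_mean_le_limit[OF hol _ M] hol by (simp add: log_bounded_def)
  let ?I = "circle_mean (\<lambda>\<zeta>. log_plus (cmod (boundary_value f \<zeta>)))"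
  have "?I \<le> M" by (rule boundary_log_plus_integrable(2)[OF LM])
  moreover have "M \<le> ?I"
  proof (rule field_le_epsilon)
    fix \<epsilon> :: real assume "0 < \<epsilon>"
    with S obtain c where c: "0 < c" "f \<in> log_bounded c \<epsilon>" by blast
    \<comment> \<open>The minimum with 1 ensures K \<ge> 0, as truncation requires.\<close>
    define K where "K = ln (1 / min c 1)"
    have K: "0 \<le> K" "exp (- K) = min c 1"
      using c by (auto simp: K_def ln_div exp_minus)
    have cK: "f \<in> log_bounded (exp (- K)) \<epsilon>"
      unfolding K(2) using c by (intro log_bounded_mono[OF c(2)]) auto
    have bi: "integrable circ (\<lambda>\<theta>. log_plus (cmod (boundary_value f (cis \<theta>))))"
      by (rule boundary_log_plus_integrable(1)[OF L])
    \<comment> \<open>The excess over \<open>K\<close> contributes at most \<epsilon> at every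
      radius, and the mean of the truncated part converges to the boundary mean.\<close>
    have "M \<le> \<epsilon> + circle_average (\<lambda>\<zeta>. min (log_plus (cmod (boundary_value f \<zeta>))) K)"
    proof (rule tendsto_le[OF _ _ M])
      show "((\<lambda>r. \<epsilon> + circle_average (\<lambda>w. min (log_plus (cmod (f (of_real r * w)))) K)) \<longlongrightarrow>
          \<epsilon> + circle_average (\<lambda>\<zeta>. min (log_plus (cmod (boundary_value f \<zeta>))) K)) (at_left 1)"
        by (intro tendsto_intros truncated_mean_tendsto[OF L K(1)])
      have "\<forall>\<^sub>F r in at_left 1. r \<in> {0<..<1::real}" by (rule eventually_at_left_real) simp
      then show "\<forall>\<^sub>F r in at_left 1. log_mean 1 f r \<le> \<epsilon> + circle_average (\<lambda>w. min (log_plus (cmod (f (of_real r * w)))) K)"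
      proof eventually_elim
        case (elim r)
        then have "log_mean (exp (- K)) f r \<le> \<epsilon>" using cK by (simp add: log_bounded_def)
        then show ?case using log_mean_truncate[OF hol K(1), of r] elim by simp
      qed
    qed simp
    also have "circle_average (\<lambda>\<zeta>. min (log_plus (cmod (boundary_value f \<zeta>))) K) \<le> ?I"
      unfolding circle_mean_eq_average circle_average_def
    proof (intro scaleR_left_mono integral_mono bi)
      show "integrable circ (\<lambda>\<theta>. min (log_plus (cmod (boundary_value f (cis \<theta>)))) K)"
        by (rule Bochner_Integration.integrable_bound[OF bi])
           (use borel_measurable_integrable[OF bi] K in \<open>auto simp: log_plus_nonneg\<close>)
    qed auto
    finally show "M \<le> ?I + \<epsilon>" by simp
  qed
  ultimately have "M = ?I" by simp
  then show "f \<in> smirnov"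
    using M L nevanlinna_iff by (auto simp: smirnov_def circle_mean_log_mean)
qed

lemma nevanlinna_mult:
  assumes "f \<in> nevanlinna" "g \<in> nevanlinna"
  shows "(\<lambda>z. f z * g z) \<in> nevanlinna"
proof -
  obtain L M where "f \<in> log_bounded 1 L" "g \<in> log_bounded 1 M"
    using assms by (auto simp: nevanlinna_iff)
  from log_bounded_mult[OF this] show ?thesis by (auto simp: nevanlinna_iff)
qed

lemma smirnov_mult:
  assumes "f \<in> smirnov" "g \<in> smirnov"
  shows "(\<lambda>z. f z * g z) \<in> smirnov"
  unfolding smirnov_iff
proof (intro allI impI)
  fix \<epsilon> :: real assume "0 < \<epsilon>"
  then have "0 < \<epsilon> / 2" by simp
  then obtain c d where cd: "0 < c" "f \<in> log_bounded c (\<epsilon> / 2)" "0 < d" "g \<in> log_bounded d (\<epsilon> / 2)"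
    using assms unfolding smirnov_iff by meson
  then have "(\<lambda>z. f z * g z) \<in> log_bounded (c * d) (\<epsilon> / 2 + \<epsilon> / 2)"
    by (intro log_bounded_mult) auto
  then show "\<exists>c>0. (\<lambda>z. f z * g z) \<in> log_bounded c \<epsilon>"
    using cd by (intro exI[of _ "c * d"]) auto
qed

section \<open>Blaschke products\<close>

lemma norm_cnj_mult_less:
  assumes "cmod l < 1" "cmod z \<le> 1"
  shows "cmod (cnj l * z) < 1"
proof -
  have "cmod (cnj l * z) \<le> cmod l * 1"
    unfolding norm_mult complex_mod_cnj using assms by (intro mult_left_mono) auto
  then show ?thesis using assms by simp
qed

lemma one_minus_cnj_mult_nonzero:
  assumes "cmod l < 1" "cmod z \<le> 1"
  shows "1 - cnj l * z \<noteq> 0"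
  using norm_cnj_mult_less[OF assms] by auto

lemma norm_blaschke_factor: "cmod (blaschke_factor l z) = cmod (z - l) / cmod (1 - cnj l * z)"
  by (simp add: blaschke_factor_def norm_mult norm_divide norm_minus_commute)

lemma blaschke_factor_self [simp]: "blaschke_factor l l = 0"
  by (simp add: blaschke_factor_def)

lemma blaschke_factor_nonzero:
  assumes "cmod l < 1" "cmod z < 1" "z \<noteq> l"
  shows "blaschke_factor l z \<noteq> 0"
proof -
  have "0 < cmod (blaschke_factor l z)"
    unfolding norm_blaschke_factor using assms one_minus_cnj_mult_nonzero[of l z] by simp
  then show ?thesis by auto
qed

lemma one_minus_norm_blaschke_factor:
  assumes "cmod l < 1" "cmod z \<le> 1"
  shows "1 - (cmod (blaschke_factor l z))\<^sup>2 = (1 - (cmod l)\<^sup>2) * (1 - (cmod z)\<^sup>2) / (cmod (1 - cnj l * z))\<^sup>2"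
proof -
  have "0 < (cmod (1 - cnj l * z))\<^sup>2"
    using one_minus_cnj_mult_nonzero[OF assms] by simp
  moreover have "1 - (cmod (blaschke_factor l z))\<^sup>2 = 1 - (cmod (z - l))\<^sup>2 / (cmod (1 - cnj l * z))\<^sup>2"
    unfolding norm_blaschke_factor power_divide ..
  ultimately show ?thesis
    using one_minus_mult_cnj[of l z] by (simp add: field_simps)
qed

lemma norm_blaschke_factor_le_1:
  assumes "cmod l < 1" "cmod z \<le> 1"
  shows "cmod (blaschke_factor l z) \<le> 1"
proof -
  have "0 \<le> (1 - (cmod l)\<^sup>2) * (1 - (cmod z)\<^sup>2) / (cmod (1 - cnj l * z))\<^sup>2"
    using assms by (intro divide_nonneg_nonneg mult_nonneg_nonneg) (auto simp: abs_square_le_1)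
  then have "(cmod (blaschke_factor l z))\<^sup>2 \<le> 1"
    using one_minus_norm_blaschke_factor[OF assms] by linarith
  then show ?thesis by (simp add: abs_square_le_1)
qed

lemma norm_blaschke_prod_le_1:
  assumes "F \<subseteq> ball 0 1" "cmod z \<le> 1"
  shows "cmod (\<Prod>l\<in>F. blaschke_factor l z) \<le> 1"
  unfolding prod_norm[symmetric]
  by (rule prod_le_1) (use assms in \<open>auto intro!: norm_blaschke_factor_le_1\<close>)

lemma holomorphic_blaschke_factor:
  assumes "cmod l < 1"
  shows "blaschke_factor l holomorphic_on ball 0 1"
proof (cases "l = 0")
  case True
  then have "blaschke_factor l = (\<lambda>z. z)" by (simp add: blaschke_factor_def fun_eq_iff)
  then show ?thesis by simp
next
  case False
  then have "blaschke_factor l = (\<lambda>z. of_real (cmod l) / l * ((l - z) / (1 - cnj l * z)))"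
    by (simp add: blaschke_factor_def fun_eq_iff)
  then show ?thesis
    using one_minus_cnj_mult_nonzero[OF assms] False by (auto intro!: holomorphic_intros)
qed

text \<open>Clearing denominators, l (1 - cnj l z) (1 - b) = (1 - |l|) (l + |l| z); the normalizing
  factor |l| / l is what produces 1 - |l|. The estimate turns the Blaschke condition into
  convergence of the product.\<close>

lemma norm_one_minus_blaschke_factor:
  assumes l: "cmod l < 1" and z: "cmod z < 1"
  shows "cmod (1 - blaschke_factor l z) \<le> (1 + cmod z) / (1 - cmod z) * (1 - cmod l)"
proof (cases "l = 0")
  case True
  have "cmod (1 - z) \<le> 1 + cmod z" using norm_triangle_ineq4[of 1 z] by simp
  also have "\<dots> \<le> (1 + cmod z) / (1 - cmod z)"
    using z divide_left_mono[of "1 - cmod z" 1 "1 + cmod z"] by (simp add: add_pos_nonneg)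
  finally show ?thesis using True by (simp add: blaschke_factor_def)
next
  case False
  let ?d = "1 - cnj l * z"
  have d: "?d \<noteq> 0" using one_minus_cnj_mult_nonzero[of l z] l z by simp
  have ll: "l * cnj l = of_real (cmod l) * of_real (cmod l)"
    using complex_norm_square[of l] by (simp add: power2_eq_square)
  have "a * b * (k / a * (x / b)) = k * x" if "a \<noteq> 0" "b \<noteq> 0" for a b k x :: complex
    using that by simp
  from this[OF False d] have "l * ?d * blaschke_factor l z = of_real (cmod l) * (l - z)"
    using False by (simp only: blaschke_factor_def if_False)
  then have "l * ?d * (1 - blaschke_factor l z) = l * ?d - of_real (cmod l) * (l - z)"
    by (simp only: right_diff_distrib mult_1_right)
  also have "\<dots> = l - (l * cnj l) * z - of_real (cmod l) * (l - z)"
    by (simp add: algebra_simps)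
  also have "\<dots> = of_real (1 - cmod l) * (l + of_real (cmod l) * z)"
    unfolding ll by (simp add: algebra_simps)
  finally have "cmod (l * ?d * (1 - blaschke_factor l z)) = cmod (of_real (1 - cmod l) * (l + of_real (cmod l) * z))"
    by (rule arg_cong)
  then have "cmod l * cmod ?d * cmod (1 - blaschke_factor l z) = (1 - cmod l) * cmod (l + of_real (cmod l) * z)"
    unfolding norm_mult norm_of_real using l by simp
  also have "\<dots> \<le> (1 - cmod l) * (cmod l * (1 + cmod z))"
  proof (rule mult_left_mono)
    show "cmod (l + of_real (cmod l) * z) \<le> cmod l * (1 + cmod z)"
      using norm_triangle_ineq[of l "of_real (cmod l) * z"] by (simp add: norm_mult algebra_simps)
  qed (use l in simp)
  finally have "cmod l * (cmod ?d * cmod (1 - blaschke_factor l z)) \<le> cmod l * ((1 - cmod l) * (1 + cmod z))"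
    by (simp only: mult_ac)
  then have le: "cmod ?d * cmod (1 - blaschke_factor l z) \<le> (1 - cmod l) * (1 + cmod z)"
    using False by simp
  have "1 - cmod z \<le> cmod ?d"
  proof -
    have "cmod (cnj l * z) \<le> 1 * cmod z"
      unfolding norm_mult complex_mod_cnj using l by (intro mult_right_mono) auto
    then show ?thesis using norm_triangle_ineq2[of 1 "cnj l * z"] by simp
  qed
  then have "(1 - cmod z) * cmod (1 - blaschke_factor l z) \<le> cmod ?d * cmod (1 - blaschke_factor l z)"
    by (rule mult_right_mono) simp
  with le have "(1 - cmod z) * cmod (1 - blaschke_factor l z) \<le> (1 - cmod l) * (1 + cmod z)" by linarith
  then show ?thesis using z by (simp add: field_simps)
qed

lemma summable_on_tail:
  fixes u :: "'a \<Rightarrow> real"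
  assumes u: "u summable_on A" "\<And>x. x \<in> A \<Longrightarrow> 0 \<le> u x" and e: "0 < e"
  obtains F where "finite F" "F \<subseteq> A" "\<And>G. finite G \<Longrightarrow> G \<subseteq> A - F \<Longrightarrow> sum u G \<le> e"
proof -
  obtain F where F: "finite F" "F \<subseteq> A" "dist (sum u F) (infsum u A) \<le> e"
    using has_sum_finite_approximation[OF has_sum_infsum[OF u(1)] e] by blast
  show ?thesis
  proof (rule that[OF F(1,2)])
    fix G assume G: "finite G" "G \<subseteq> A - F"
    then have "sum u F + sum u G = sum u (F \<union> G)"
      using F by (intro sum.union_disjoint[symmetric]) auto
    also have "\<dots> \<le> infsum u A"
      using F G u by (intro finite_sum_le_infsum) auto
    finally show "sum u G \<le> e" using F(3) by (simp add: dist_real_def)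
  qed
qed

text \<open>With factors of modulus at most 1, the finite products over \<open>F \<supseteq> F0\<close> differ from the product over
  \<open>F0\<close> by at most the sum of \<open>\<bar>1 - x l\<bar>\<close> over \<open>F - F0\<close>.\<close>

lemma unordered_prod_converges:
  fixes x :: "'a \<Rightarrow> complex"
  assumes summable: "(\<lambda>l. cmod (1 - x l)) summable_on A" and le1: "\<And>l. l \<in> A \<Longrightarrow> cmod (x l) \<le> 1"
  shows "\<exists>P. ((\<lambda>F. \<Prod>l\<in>F. x l) \<longlongrightarrow> P) (finite_subsets_at_top A)"
proof -
  have "\<exists>P. eventually P (finite_subsets_at_top A) \<and>
      (\<forall>F G. P F \<and> P G \<longrightarrow> dist (\<Prod>l\<in>F. x l) (\<Prod>l\<in>G. x l) < e)" if e: "e > 0" for e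
  proof -
    obtain F0 where F0: "finite F0" "F0 \<subseteq> A"
      "\<And>G. finite G \<Longrightarrow> G \<subseteq> A - F0 \<Longrightarrow> (\<Sum>l\<in>G. cmod (1 - x l)) \<le> e / 3"
      using summable_on_tail[OF summable, of "e / 3"] e by auto
    have close: "dist (\<Prod>l\<in>F. x l) (\<Prod>l\<in>F0. x l) \<le> e / 3" if F: "finite F" "F0 \<subseteq> F" "F \<subseteq> A" for F
    proof -
      have "(\<Prod>l\<in>F. x l) = (\<Prod>l\<in>F - F0. x l) * (\<Prod>l\<in>F0. x l)"
        using F F0 by (intro prod.subset_diff)
      then have "(\<Prod>l\<in>F. x l) - (\<Prod>l\<in>F0. x l) = ((\<Prod>l\<in>F - F0. x l) - (\<Prod>l\<in>F - F0. 1)) * (\<Prod>l\<in>F0. x l)"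
        by (simp add: algebra_simps)
      then have "dist (\<Prod>l\<in>F. x l) (\<Prod>l\<in>F0. x l)
          = cmod ((\<Prod>l\<in>F - F0. x l) - (\<Prod>l\<in>F - F0. 1)) * cmod (\<Prod>l\<in>F0. x l)"
        by (simp only: dist_norm norm_mult)
      also have "\<dots> \<le> (\<Sum>l\<in>F - F0. cmod (x l - 1)) * 1"
      proof (rule mult_mono)
        show "cmod ((\<Prod>l\<in>F - F0. x l) - (\<Prod>l\<in>F - F0. 1)) \<le> (\<Sum>l\<in>F - F0. cmod (x l - 1))"
          by (rule norm_prod_diff) (use le1 F in auto)
        show "cmod (\<Prod>l\<in>F0. x l) \<le> 1"
          unfolding prod_norm[symmetric] by (rule prod_le_1) (use le1 F0 in auto)
      qed (auto intro: sum_nonneg)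
      also have "\<dots> = (\<Sum>l\<in>F - F0. cmod (1 - x l))"
        by (simp add: norm_minus_commute)
      also have "\<dots> \<le> e / 3"
        using F by (intro F0(3)) auto
      finally show ?thesis .
    qed
    show ?thesis
    proof (intro exI[of _ "\<lambda>F. finite F \<and> F0 \<subseteq> F \<and> F \<subseteq> A"] conjI allI impI)
      show "\<forall>\<^sub>F F in finite_subsets_at_top A. finite F \<and> F0 \<subseteq> F \<and> F \<subseteq> A"
        unfolding eventually_finite_subsets_at_top using F0 by blast
      fix F G assume FG: "(finite F \<and> F0 \<subseteq> F \<and> F \<subseteq> A) \<and> (finite G \<and> F0 \<subseteq> G \<and> G \<subseteq> A)"
      have "dist (\<Prod>l\<in>F. x l) (\<Prod>l\<in>G. x l)
          \<le> dist (\<Prod>l\<in>F. x l) (\<Prod>l\<in>F0. x l) + dist (\<Prod>l\<in>G. x l) (\<Prod>l\<in>F0. x l)"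
        by (rule dist_triangle2)
      also have "\<dots> \<le> e / 3 + e / 3" using FG by (intro add_mono close) auto
      finally show "dist (\<Prod>l\<in>F. x l) (\<Prod>l\<in>G. x l) < e" using e by simp
    qed
  qed
  then have "cauchy_filter (filtermap (\<lambda>F. \<Prod>l\<in>F. x l) (finite_subsets_at_top A))"
    by (simp add: cauchy_filter_metric_filtermap)
  then obtain P where "filtermap (\<lambda>F. \<Prod>l\<in>F. x l) (finite_subsets_at_top A) \<le> nhds P"
    using cauchy_filter_complete_converges[of "filtermap (\<lambda>F. \<Prod>l\<in>F. x l) (finite_subsets_at_top A)" UNIV]
      complete_UNIV by (auto simp: filtermap_bot_iff)
  then show ?thesis by (auto simp: filterlim_def)
qed

locale blaschke_sequence =
  fixes \<Lambda> :: "complex set"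
  assumes in_disc: "\<Lambda> \<subseteq> ball 0 1" and blaschke: "(\<lambda>l. 1 - cmod l) summable_on \<Lambda>"
begin

lemma norm_less_1: "l \<in> \<Lambda> \<Longrightarrow> cmod l < 1"
  using in_disc by auto

text \<open>The terms 1 - |l| are nonzero, and a summable family has countable support.\<close>

lemma countable: "countable \<Lambda>"
proof -
  have "countable {l \<in> \<Lambda>. 1 - cmod l \<noteq> 0}" by (rule summable_countable_real[OF blaschke])
  also have "{l \<in> \<Lambda>. 1 - cmod l \<noteq> 0} = \<Lambda>" using norm_less_1 by force
  finally show ?thesis .
qed

lemma summable_one_minus_factor:
  assumes z: "cmod z < 1" and A: "A \<subseteq> \<Lambda>"
  shows "(\<lambda>l. cmod (1 - blaschke_factor l z)) summable_on A"
proof (rule summable_on_comparison_test)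
  show "(\<lambda>l. (1 + cmod z) / (1 - cmod z) * (1 - cmod l)) summable_on A"
    by (intro summable_on_cmult_right summable_on_subset_banach[OF blaschke A])
qed (use A z norm_less_1 norm_one_minus_blaschke_factor in auto)

definition B :: "complex \<Rightarrow> real" where
  "B l = cmod (blaschke_product_without \<Lambda> l l)"

lemma B_tendsto:
  assumes l: "l \<in> \<Lambda>"
  shows "((\<lambda>F. cmod (\<Prod>l'\<in>F. blaschke_factor l' l)) \<longlongrightarrow> B l) (finite_subsets_at_top (\<Lambda> - {l}))"
proof -
  have "\<exists>P. ((\<lambda>F. \<Prod>l'\<in>F. blaschke_factor l' l) \<longlongrightarrow> P) (finite_subsets_at_top (\<Lambda> - {l}))"
    using norm_less_1 l
    by (intro unordered_prod_converges summable_one_minus_factor norm_blaschke_factor_le_1) (auto simp: less_imp_le)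
  then obtain P where P: "((\<lambda>F. \<Prod>l'\<in>F. blaschke_factor l' l) \<longlongrightarrow> P) (finite_subsets_at_top (\<Lambda> - {l}))" ..
  then have "blaschke_product_without \<Lambda> l l = P"
    unfolding blaschke_product_without_def by (intro tendsto_Lim) auto
  then show ?thesis using tendsto_norm[OF P] by (simp add: B_def)
qed

lemma B_lower:
  assumes "l \<in> \<Lambda>" and "\<And>F. finite F \<Longrightarrow> F \<subseteq> \<Lambda> - {l} \<Longrightarrow> m \<le> cmod (\<Prod>l'\<in>F. blaschke_factor l' l)"
  shows "m \<le> B l"
  by (rule tendsto_lowerbound[OF B_tendsto[OF assms(1)]])
     (use assms(2) in \<open>auto simp: eventually_finite_subsets_at_top\<close>)

text \<open>Factors have modulus at most 1, so the moduli of finite subproducts decrease. Together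
  with \<open>B_lower\<close> this makes \<open>B l\<close> their infimum, and statements about the
  infinite product become statements about finite ones.\<close>

lemma B_le_prod:
  assumes l: "l \<in> \<Lambda>" and F: "finite F" "F \<subseteq> \<Lambda> - {l}"
  shows "B l \<le> cmod (\<Prod>l'\<in>F. blaschke_factor l' l)"
proof (rule tendsto_upperbound[OF B_tendsto[OF l]])
  show "\<forall>\<^sub>F G in finite_subsets_at_top (\<Lambda> - {l}).
      cmod (\<Prod>l'\<in>G. blaschke_factor l' l) \<le> cmod (\<Prod>l'\<in>F. blaschke_factor l' l)"
    unfolding eventually_finite_subsets_at_top
  proof (intro exI[of _ F] conjI allI impI F)
    fix G assume G: "finite G \<and> F \<subseteq> G \<and> G \<subseteq> \<Lambda> - {l}"
    then have "(\<Prod>l'\<in>G. blaschke_factor l' l) = (\<Prod>l'\<in>G - F. blaschke_factor l' l) * (\<Prod>l'\<in>F. blaschke_factor l' l)"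
      using F by (intro prod.subset_diff) auto
    then have "cmod (\<Prod>l'\<in>G. blaschke_factor l' l)
        = cmod (\<Prod>l'\<in>G - F. blaschke_factor l' l) * cmod (\<Prod>l'\<in>F. blaschke_factor l' l)"
      by (simp only: norm_mult)
    also have "\<dots> \<le> 1 * cmod (\<Prod>l'\<in>F. blaschke_factor l' l)"
      using G in_disc norm_less_1[OF l] by (intro mult_right_mono norm_blaschke_prod_le_1) auto
    finally show "cmod (\<Prod>l'\<in>G. blaschke_factor l' l) \<le> cmod (\<Prod>l'\<in>F. blaschke_factor l' l)" by simp
  qed
qed simp

lemma B_le_1: "l \<in> \<Lambda> \<Longrightarrow> B l \<le> 1"
  using B_le_prod[of l "{}"] by simp

text \<open>Beyond a finite set \<open>F0\<close> the sum of |1 - b| is at most 1 / 2, so the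
  remaining factors multiply to modulus at least 1 / 2. Positivity makes
  \<open>ln (inverse (B l))\<close> a genuine logarithm.\<close>

lemma B_pos:
  assumes l: "l \<in> \<Lambda>"
  shows "0 < B l"
proof -
  let ?b = "\<lambda>l'. blaschke_factor l' l"
  have l1: "cmod l < 1" using l by (rule norm_less_1)
  obtain F0 where F0: "finite F0" "F0 \<subseteq> \<Lambda> - {l}"
    "\<And>G. finite G \<Longrightarrow> G \<subseteq> \<Lambda> - {l} - F0 \<Longrightarrow> (\<Sum>l'\<in>G. cmod (1 - ?b l')) \<le> 1 / 2"
    using summable_on_tail[OF summable_one_minus_factor[OF l1, of "\<Lambda> - {l}"], of "1 / 2"] by auto
  have "1 / 2 * cmod (\<Prod>l'\<in>F0. ?b l') \<le> B l"
  proof (rule B_lower[OF l])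
    fix F assume F: "finite F" "F \<subseteq> \<Lambda> - {l}"
    have "cmod ((\<Prod>l'\<in>F - F0. 1) - (\<Prod>l'\<in>F - F0. ?b l')) \<le> (\<Sum>l'\<in>F - F0. cmod (1 - ?b l'))"
      by (rule norm_prod_diff) (use F norm_less_1 l in \<open>auto intro!: norm_blaschke_factor_le_1 simp: less_imp_le\<close>)
    also have "\<dots> \<le> 1 / 2" using F by (intro F0(3)) auto
    finally have half: "1 / 2 \<le> cmod (\<Prod>l'\<in>F - F0. ?b l')"
      using norm_triangle_ineq2[of 1 "\<Prod>l'\<in>F - F0. ?b l'"] by simp
    \<comment> \<open>\<open>F\<close> need not contain \<open>F0\<close>, so the product over the
      union is compared with the products over both sets.\<close>
    have "(\<Prod>l'\<in>F \<union> F0. ?b l') = (\<Prod>l'\<in>F - F0. ?b l') * (\<Prod>l'\<in>F0. ?b l')"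
      using F F0 prod.subset_diff[of F0 "F \<union> F0" ?b] by (simp add: Un_Diff)
    then have "1 / 2 * cmod (\<Prod>l'\<in>F0. ?b l') \<le> cmod (\<Prod>l'\<in>F \<union> F0. ?b l')"
      unfolding norm_mult using half by (simp only: norm_mult) (intro mult_right_mono, auto)
    also have "(\<Prod>l'\<in>F \<union> F0. ?b l') = (\<Prod>l'\<in>F0 - F. ?b l') * (\<Prod>l'\<in>F. ?b l')"
      using F F0 prod.subset_diff[of F "F \<union> F0" ?b] by (simp add: Un_Diff)
    also have "cmod \<dots> \<le> 1 * cmod (\<Prod>l'\<in>F. ?b l')"
      unfolding norm_mult using F0 in_disc l1 by (intro mult_right_mono norm_blaschke_prod_le_1) auto
    finally show "1 / 2 * cmod (\<Prod>l'\<in>F0. ?b l') \<le> cmod (\<Prod>l'\<in>F. ?b l')" by simp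
  qed
  moreover have "?b a \<noteq> 0" if "a \<in> F0" for a
    using that F0(2) norm_less_1 l1 by (intro blaschke_factor_nonzero) auto
  then have "(\<Prod>l'\<in>F0. ?b l') \<noteq> 0"
    using F0(1) by simp
  ultimately show ?thesis by (meson less_le_trans mult_pos_pos zero_less_norm_iff half_gt_zero zero_less_one)
qed

end

section \<open>Division by Blaschke factors\<close>

text \<open>Division costs at most -ln (Q s) on the circle of radius s, because |b| \<ge> Q s there.
  As Q tends to 1 and the means increase with the radius, the loss disappears in the limit and
  \<open>L\<close> is unchanged.\<close>

lemma log_bounded_divide_factor:
  assumes f: "f \<in> log_bounded c L" and c: "0 \<le> c" and l: "cmod l < 1" and fl: "f l = 0"
  obtains g where "g \<in> log_bounded c L" "\<And>z. cmod z < 1 \<Longrightarrow> f z = g z * blaschke_factor l z"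
proof -
  have hol: "f holomorphic_on ball 0 1" using f by (rule log_bounded_holomorphic)
  \<comment> \<open>The cofactor in e b = z - l, so that f / b becomes q e, with q the quotient of f
    by z - l after removing its singularity.\<close>
  define e where "e z = (if l = 0 then 1 else - (l / of_real (cmod l)) * (1 - cnj l * z))" for z
  have e: "e z * blaschke_factor l z = z - l" if "cmod z < 1" for z
    using one_minus_cnj_mult_nonzero[OF l, of z] that
    by (simp add: e_def blaschke_factor_def)
  define q where "q z = (if z = l then deriv f l else (f z - f l) / (z - l))" for z
  have "q holomorphic_on ball 0 1"
    unfolding q_def by (rule pole_lemma[OF hol]) (use l in auto)
  then have hol_g: "(\<lambda>z. q z * e z) holomorphic_on ball 0 1"
    unfolding e_def by (cases "l = 0") (auto intro!: holomorphic_intros)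
  have fq: "f z = q z * (z - l)" for z
    using fl by (simp add: q_def)
  have fg: "f z = (q z * e z) * blaschke_factor l z" if "cmod z < 1" for z
    using e[OF that] fq[of z] by (simp add: mult.assoc)
  \<comment> \<open>From the formula for 1 - |b|^2 with |1 - cnj l z| \<ge> 1 - |l|, followed by |b|
    \<ge> |b|^2. It may be negative for small s and is used only near 1.\<close>
  define Q where "Q s = 1 - (1 - s\<^sup>2) / (1 - cmod l)\<^sup>2" for s
  have Q: "Q (cmod z) \<le> cmod (blaschke_factor l z)" if z: "cmod z < 1" for z
  proof -
    have "1 - cmod l \<le> cmod (1 - cnj l * z)"
    proof -
      have "cmod (cnj l * z) \<le> cmod l * 1"
        unfolding norm_mult complex_mod_cnj using z by (intro mult_left_mono) auto
      then show ?thesis using norm_triangle_ineq2[of 1 "cnj l * z"] by simp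
    qed
    then have sq: "(1 - cmod l)\<^sup>2 \<le> (cmod (1 - cnj l * z))\<^sup>2"
      using l by (intro power_mono) auto
    have "(1 - (cmod l)\<^sup>2) * (1 - (cmod z)\<^sup>2) / (cmod (1 - cnj l * z))\<^sup>2 \<le> (1 - (cmod z)\<^sup>2) / (1 - cmod l)\<^sup>2"
    proof (rule frac_le)
      show "(1 - (cmod l)\<^sup>2) * (1 - (cmod z)\<^sup>2) \<le> 1 - (cmod z)\<^sup>2"
        using z by (intro mult_left_le_one_le) (auto simp: abs_square_le_1 l less_imp_le)
    qed (use z l sq in \<open>auto simp: abs_square_le_1\<close>)
    then have "Q (cmod z) \<le> (cmod (blaschke_factor l z))\<^sup>2"
      using one_minus_norm_blaschke_factor[OF l, of z] z by (simp add: Q_def)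
    also have "\<dots> \<le> cmod (blaschke_factor l z)"
      using norm_blaschke_factor_le_1[OF l, of z] z by (simp add: power2_eq_square mult_left_le_one_le)
    finally show ?thesis .
  qed
  have mean: "log_mean c (\<lambda>z. q z * e z) s \<le> L - ln (Q s)" if s: "0 < s" "s < 1" "0 < Q s" for s
  proof -
    have Q1: "Q s \<le> 1" using s by (simp add: Q_def abs_square_le_1)
    have "log_mean c (\<lambda>z. q z * e z) s \<le> circle_average (\<lambda>w. log_plus (c * cmod (f (of_real s * w))) + (- ln (Q s)))"
      unfolding log_mean_def
    proof (rule circle_average_mono)
      fix w :: complex assume w: "cmod w = 1"
      let ?z = "of_real s * w"
      have zs: "cmod ?z = s" using w s by (simp add: norm_mult)
      have pos: "0 < cmod (blaschke_factor l ?z)" using Q[of ?z] s unfolding zs by linarith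
      then have "c * cmod (q ?z * e ?z) = c * cmod (f ?z) * (1 / cmod (blaschke_factor l ?z))"
        using fg[of ?z] s unfolding zs by (simp add: norm_mult)
      also have "log_plus \<dots> \<le> log_plus (c * cmod (f ?z)) + log_plus (1 / cmod (blaschke_factor l ?z))"
        using c by (intro log_plus_mult_le) auto
      also have "log_plus (1 / cmod (blaschke_factor l ?z)) \<le> log_plus (1 / Q s)"
        using Q[of ?z] s pos unfolding zs by (intro log_plus_mono divide_left_mono mult_pos_pos) auto
      also have "log_plus (1 / Q s) = - ln (Q s)"
        using s Q1 by (simp add: log_plus_def ln_div)
      finally show "log_plus (c * cmod (q ?z * e ?z)) \<le> log_plus (c * cmod (f ?z)) + (- ln (Q s))" by simp
    qed (use s c in \<open>auto intro!: continuous_intros continuous_on_circle_log_plus hol hol_g continuous_on_circle_dilate[OF hol_g] continuous_on_circle_dilate[OF hol]\<close>)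
    also have "\<dots> = log_mean c f s + (- ln (Q s))"
      unfolding log_mean_def using s c
      by (subst circle_average_add) (auto intro!: continuous_on_circle_log_plus hol)
    also have "log_mean c f s \<le> L" using f s by (simp add: log_bounded_def)
    finally show ?thesis by simp
  qed
  have "log_mean c (\<lambda>z. q z * e z) r \<le> L" if r: "0 < r" "r < 1" for r
  proof -
    have Qlim: "(Q \<longlongrightarrow> 1) (at_left 1)"
    proof -
      have "((\<lambda>s. 1 - (1 - s\<^sup>2) / (1 - cmod l)\<^sup>2) \<longlongrightarrow> 1 - (1 - 1\<^sup>2) / (1 - cmod l)\<^sup>2) (at_left 1)"
        using l by (intro tendsto_intros) auto
      then show ?thesis by (simp add: Q_def[abs_def])
    qed
    have "((\<lambda>s. L - ln (Q s)) \<longlongrightarrow> L - ln 1) (at_left 1)"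
      by (intro tendsto_intros Qlim) auto
    moreover have "\<forall>\<^sub>F s in at_left 1. 0 < Q s"
      using order_tendstoD(1)[OF Qlim, of 0] by simp
    moreover have "\<forall>\<^sub>F s in at_left 1. s \<in> {r<..<1}"
      using r by (intro eventually_at_left_real)
    ultimately have "log_mean c (\<lambda>z. q z * e z) r \<le> L - ln 1"
    proof (intro tendsto_lowerbound)
      assume "\<forall>\<^sub>F s in at_left 1. 0 < Q s" "\<forall>\<^sub>F s in at_left 1. s \<in> {r<..<1}"
      then show "\<forall>\<^sub>F s in at_left 1. log_mean c (\<lambda>z. q z * e z) r \<le> L - ln (Q s)"
      proof eventually_elim
        case (elim s)
        have "log_mean c (\<lambda>z. q z * e z) r \<le> log_mean c (\<lambda>z. q z * e z) s"
          using elim r by (intro log_mean_mono hol_g c) auto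
        also have "\<dots> \<le> L - ln (Q s)" using elim r by (intro mean) auto
        finally show ?case .
      qed
    qed auto
    then show ?thesis by simp
  qed
  then have "(\<lambda>z. q z * e z) \<in> log_bounded c L"
    using hol_g by (simp add: log_bounded_def)
  then show ?thesis using fg by (rule that)
qed

text \<open>The other factors do not vanish at \<open>l\<close>, so the zero of f at
  \<open>l\<close> survives each division.\<close>

lemma log_bounded_divide_prod:
  assumes "finite F" "F \<subseteq> ball 0 1" and f: "f \<in> log_bounded c L" and c: "0 \<le> c"
    and "\<And>l. l \<in> F \<Longrightarrow> f l = 0"
  shows "\<exists>g\<in>log_bounded c L. \<forall>z. cmod z < 1 \<longrightarrow> f z = g z * (\<Prod>l\<in>F. blaschke_factor l z)"
  using assms(1,2,5)
proof (induction F)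
  case empty
  then show ?case using f by auto
next
  case (insert l F)
  then obtain g where g: "g \<in> log_bounded c L" "\<And>z. cmod z < 1 \<Longrightarrow> f z = g z * (\<Prod>l\<in>F. blaschke_factor l z)"
    by auto
  have l: "cmod l < 1" using insert.prems by auto
  have "blaschke_factor a l \<noteq> 0" if "a \<in> F" for a
    using that insert.hyps insert.prems(1) l by (intro blaschke_factor_nonzero) auto
  then have "(\<Prod>l'\<in>F. blaschke_factor l' l) \<noteq> 0"
    using insert.hyps(1) by simp
  then have "g l = 0"
    using g(2)[OF l] insert.prems(2)[of l] by simp
  then obtain h where h: "h \<in> log_bounded c L" "\<And>z. cmod z < 1 \<Longrightarrow> g z = h z * blaschke_factor l z"
    using log_bounded_divide_factor[OF g(1) c l] by blast
  show ?case
    using insert.hyps g(2) h by (intro bexI[of _ h]) (auto simp: mult_ac)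
qed

text \<open>Division of f by a finite subproduct stays within the same class, so its value at
  \<open>l\<close>, the reciprocal of that subproduct, obeys the pointwise bound. The factor 2 comes
  from (1 + |l|) / (1 - |l|) after multiplication by 1 - |l|.\<close>

lemma (in blaschke_sequence) B_lower_of_peak:
  assumes f: "f \<in> log_bounded c L" and c: "0 < c" and l: "l \<in> \<Lambda>"
    and fl: "f l = 1" "\<And>l'. l' \<in> \<Lambda> - {l} \<Longrightarrow> f l' = 0"
  shows "(1 - cmod l) * ln (inverse (B l)) \<le> (1 - cmod l) * ln (1 / c) + 2 * L"
proof -
  have l1: "cmod l < 1" using l by (rule norm_less_1)
  have L0: "0 \<le> L"
    using log_boundedD[OF f, of "1 / 2"] log_mean_nonneg[of c f "1 / 2"] by simp
  define E where "E = exp ((1 + cmod l) / (1 - cmod l) * L)"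
  have "c / E \<le> B l"
  proof (rule B_lower[OF l])
    fix F assume F: "finite F" "F \<subseteq> \<Lambda> - {l}"
    obtain g where g: "g \<in> log_bounded c L" "\<And>z. cmod z < 1 \<Longrightarrow> f z = g z * (\<Prod>l\<in>F. blaschke_factor l z)"
    proof -
      have "\<exists>g\<in>log_bounded c L. \<forall>z. cmod z < 1 \<longrightarrow> f z = g z * (\<Prod>l\<in>F. blaschke_factor l z)"
        using F in_disc c fl(2) by (intro log_bounded_divide_prod f) auto
      then show ?thesis using that by blast
    qed
    have "c * cmod (g l) \<le> E"
      unfolding E_def using c by (intro log_bounded_pointwise[OF g(1) _ l1]) simp
    then have "c * cmod (g l) * cmod (\<Prod>l'\<in>F. blaschke_factor l' l) \<le> E * cmod (\<Prod>l'\<in>F. blaschke_factor l' l)"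
      by (intro mult_right_mono) auto
    moreover have "c * cmod (g l) * cmod (\<Prod>l'\<in>F. blaschke_factor l' l) = c"
      using g(2)[OF l1] fl(1) by (simp add: mult.assoc flip: norm_mult)
    ultimately have "c \<le> cmod (\<Prod>l'\<in>F. blaschke_factor l' l) * E"
      by (simp only: mult.commute)
    moreover have "0 < E" by (simp add: E_def)
    ultimately show "c / E \<le> cmod (\<Prod>l'\<in>F. blaschke_factor l' l)"
      by (simp only: pos_divide_le_eq)
  qed
  moreover have "0 < c / E" using c by (simp add: E_def)
  ultimately have "ln (c / E) \<le> ln (B l)" "0 < B l" by auto
  then have "ln (inverse (B l)) \<le> ln (1 / c) + (1 + cmod l) / (1 - cmod l) * L"
    using c by (simp add: ln_inverse ln_div E_def)
  then have "(1 - cmod l) * ln (inverse (B l)) \<le> (1 - cmod l) * (ln (1 / c) + (1 + cmod l) / (1 - cmod l) * L)"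
    using l1 by (intro mult_left_mono) auto
  also have "\<dots> = (1 - cmod l) * ln (1 / c) + (1 + cmod l) * L"
    using l1 by (simp add: distrib_left)
  also have "\<dots> \<le> (1 - cmod l) * ln (1 / c) + 2 * L"
    using l1 L0 by (intro add_left_mono mult_right_mono) auto
  finally show ?thesis .
qed

section \<open>Interpolation\<close>

lemma countable_exhaustion:
  assumes "countable A"
  shows "\<exists>E :: nat \<Rightarrow> 'a set. (\<forall>n. finite (E n) \<and> E n \<subseteq> A) \<and>
    (\<forall>x\<in>A. \<forall>\<^sub>F n in sequentially. x \<in> E n)"
proof (intro exI conjI allI ballI)
  let ?E = "\<lambda>n. {x \<in> A. to_nat_on A x < n}"
  show "finite (?E n)" for n
  proof (rule finite_imageD[of "to_nat_on A"])
    show "finite (to_nat_on A ` ?E n)" by (rule finite_subset[of _ "{..<n}"]) auto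
    show "inj_on (to_nat_on A) (?E n)" by (rule inj_on_subset[OF inj_on_to_nat_on[OF assms]]) auto
  qed
  show "\<forall>\<^sub>F n in sequentially. x \<in> ?E n" if "x \<in> A" for x
    using that by (intro eventually_sequentiallyI[of "Suc (to_nat_on A x)"]) auto
qed auto

text \<open>A Baire category argument in the space of subsets of \<open>A\<close>: the sets of functions bounded by
  \<open>(c n, L n)\<close> are normal families, so the subsets whose indicator is interpolated within the \<open>n\<close>-th
  bound form a closed set. If these closed sets cover everything, one of them contains a cylinder,
  in which two subsets may differ by a single point.\<close>

lemma uniform_peak_functions:
  fixes c L :: "nat \<Rightarrow> real" and A :: "complex set"
  assumes A: "countable A" "A \<subseteq> ball 0 1" and c: "\<And>n. 0 < c n"
    and cover: "\<And>S. S \<subseteq> A \<Longrightarrow> \<exists>n. \<exists>f\<in>log_bounded (c n) (L n). \<forall>x\<in>A. f x = of_bool (x \<in> S)"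
  shows "\<exists>n F. finite F \<and> F \<subseteq> A \<and>
    (\<forall>x\<in>A - F. \<exists>f\<in>log_bounded (c n / 2) (2 * L n). f x = 1 \<and> (\<forall>y\<in>A - {x}. f y = 0))"
proof -
  define K where "K n = {S. S \<subseteq> A \<and> (\<exists>f\<in>log_bounded (c n) (L n). \<forall>x\<in>A. f x = of_bool (x \<in> S))}" for n
  \<comment> \<open>Otherwise sets in \<open>K n\<close> agree with \<open>S\<close> on larger and
    larger finite sets, and a normal-family limit of their functions interpolates the indicator of
    \<open>S\<close>.\<close>
  have closed: "\<exists>F. finite F \<and> F \<subseteq> A \<and> (\<forall>S'\<subseteq>A. S' \<inter> F = S \<inter> F \<longrightarrow> S' \<notin> K n)"
    if S: "S \<subseteq> A" "S \<notin> K n" for S n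
  proof (rule ccontr)
    assume neg: "\<not> ?thesis"
    obtain E where E: "\<And>k. finite (E k)" "\<And>k. E k \<subseteq> A" "\<And>x. x \<in> A \<Longrightarrow> \<forall>\<^sub>F k in sequentially. x \<in> E k"
      using countable_exhaustion[OF A(1)] by metis
    have "\<exists>S'. S' \<inter> E k = S \<inter> E k \<and> S' \<in> K n" for k
    proof -
      have "\<not> (\<forall>S'\<subseteq>A. S' \<inter> E k = S \<inter> E k \<longrightarrow> S' \<notin> K n)"
        using neg E(1,2)[of k] by simp
      then show ?thesis by auto
    qed
    then obtain S' where S': "\<And>k. S' k \<inter> E k = S \<inter> E k" and S'K: "\<And>k. S' k \<in> K n"
      by metis
    have "\<forall>k. \<exists>f. f \<in> log_bounded (c n) (L n) \<and> (\<forall>x\<in>A. f x = of_bool (x \<in> S' k))"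
      using S'K unfolding K_def by blast
    from choice[OF this] obtain f where f: "\<And>k. f k \<in> log_bounded (c n) (L n)"
      and fS': "\<And>k x. x \<in> A \<Longrightarrow> f k x = of_bool (x \<in> S' k)"
      by blast
    have "\<exists>g r. strict_mono (r :: nat \<Rightarrow> nat) \<and> (\<forall>z. cmod z < 1 \<longrightarrow> (\<lambda>n. f (r n) z) \<longlonglongrightarrow> g z) \<and>
        (\<forall>d M. 0 \<le> d \<longrightarrow> (\<forall>n. f n \<in> log_bounded d M) \<longrightarrow> g \<in> log_bounded d M)"
      by (rule log_bounded_Montel[OF f c])
    then obtain g r where g: "strict_mono (r :: nat \<Rightarrow> nat)" "\<And>z. cmod z < 1 \<Longrightarrow> (\<lambda>k. f (r k) z) \<longlonglongrightarrow> g z"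
      and gK: "\<forall>d M. 0 \<le> d \<longrightarrow> (\<forall>n. f n \<in> log_bounded d M) \<longrightarrow> g \<in> log_bounded d M"
      by blast
    have "g x = of_bool (x \<in> S)" if x: "x \<in> A" for x
    proof (rule LIMSEQ_unique)
      show "(\<lambda>k. f (r k) x) \<longlonglongrightarrow> g x" using x A(2) by (intro g(2)) auto
      have "\<forall>\<^sub>F k in sequentially. x \<in> E (r k)"
        using eventually_subseq[OF g(1) E(3)[OF x]] .
      then have "\<forall>\<^sub>F k in sequentially. f (r k) x = of_bool (x \<in> S)"
      proof eventually_elim
        case (elim k)
        then have "x \<in> S' (r k) \<longleftrightarrow> x \<in> S" using S'[of "r k"] by blast
        then show ?case by (simp add: fS'[OF x])
      qed
      then show "(\<lambda>k. f (r k) x) \<longlonglongrightarrow> of_bool (x \<in> S)" by (rule tendsto_eventually)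
    qed
    moreover have "g \<in> log_bounded (c n) (L n)"
      using f less_imp_le[OF c] gK by blast
    ultimately show False using S by (auto simp: K_def)
  qed
  \<comment> \<open>The Baire step: otherwise every cylinder shrinks to one that avoids
    \<open>K n\<close>, and a set in the intersection of nested cylinders lies in no
    \<open>K n\<close>.\<close>
  have "\<exists>n F P. finite F \<and> P \<subseteq> F \<and> F \<subseteq> A \<and> (\<forall>S\<subseteq>A. S \<inter> F = P \<longrightarrow> S \<in> K n)"
  proof (rule ccontr)
    assume "\<not> ?thesis"
    then have "\<forall>n F P. finite F \<and> P \<subseteq> F \<and> F \<subseteq> A \<longrightarrow> \<not> (\<forall>S\<subseteq>A. S \<inter> F = P \<longrightarrow> S \<in> K n)"
      by simp
    then have nowhere: "\<exists>S\<subseteq>A. S \<inter> F = P \<and> S \<notin> K n" if "finite F" "P \<subseteq> F" "F \<subseteq> A" for n F P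
      using that by simp
    \<comment> \<open>A pair (F, P) stands for the cylinder of all sets whose trace on F is
      P.\<close>
    define good where "good X \<longleftrightarrow> finite (fst X) \<and> snd X \<subseteq> fst X \<and> fst X \<subseteq> A" for X :: "complex set \<times> complex set"
    define step where "step n X Y \<longleftrightarrow> fst X \<subseteq> fst Y \<and> snd Y \<inter> fst X = snd X \<and>
        (\<forall>S\<subseteq>A. S \<inter> fst Y = snd Y \<longrightarrow> S \<notin> K n)" for n and X Y :: "complex set \<times> complex set"
    have "\<exists>X. \<forall>n. good (X n) \<and> step n (X n) (X (Suc n))"
    proof (rule dependent_nat_choice)
      show "\<exists>X. good X" by (intro exI[of _ "({}, {})"]) (simp add: good_def)
      fix X n assume X: "good X"
      then obtain S where S: "S \<subseteq> A" "S \<inter> fst X = snd X" "S \<notin> K n"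
        using nowhere[of "fst X" "snd X" n] by (auto simp: good_def)
      obtain F where F: "finite F" "F \<subseteq> A" "\<forall>S'\<subseteq>A. S' \<inter> F = S \<inter> F \<longrightarrow> S' \<notin> K n"
        using closed[OF S(1,3)] by blast
      show "\<exists>Y. good Y \<and> step n X Y"
      proof (intro exI[of _ "(fst X \<union> F, S \<inter> (fst X \<union> F))"] conjI)
        show "good (fst X \<union> F, S \<inter> (fst X \<union> F))" using X F by (simp add: good_def)
        have "S' \<notin> K n" if "S' \<subseteq> A" "S' \<inter> (fst X \<union> F) = S \<inter> (fst X \<union> F)" for S'
          using F(3) that by blast
        then show "step n X (fst X \<union> F, S \<inter> (fst X \<union> F))"
          using S(2) by (auto simp: step_def)
      qed
    qed
    then obtain X where X: "\<And>n. good (X n)" "\<And>n. step n (X n) (X (Suc n))" by blast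
    define S where "S = (\<Union>n. snd (X n))"
    have later: "fst (X m) \<subseteq> fst (X n) \<and> snd (X n) \<inter> fst (X m) = snd (X m)" if "m \<le> n" for m n
      using that
    proof (induction n rule: dec_induct)
      case base
      then show ?case using X(1)[of m] by (auto simp: good_def)
    next
      case (step n)
      then show ?case using X(2)[of n] unfolding step_def by blast
    qed
    have trace: "S \<inter> fst (X n) = snd (X n)" for n
    proof
      show "S \<inter> fst (X n) \<subseteq> snd (X n)"
      proof
        fix x assume x: "x \<in> S \<inter> fst (X n)"
        then obtain m where m: "x \<in> snd (X m)" by (auto simp: S_def)
        show "x \<in> snd (X n)"
        proof (cases "m \<le> n")
          case True
          then show ?thesis using later[OF True] m by blast
        next
          case False
          then show ?thesis using later[of n m] m x by auto
        qed
      qed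
      show "snd (X n) \<subseteq> S \<inter> fst (X n)" using X(1)[of n] by (auto simp: S_def good_def)
    qed
    have SA: "S \<subseteq> A" using X(1) by (auto simp: S_def good_def)
    then obtain n where "S \<in> K n" using cover unfolding K_def by blast
    then show False using X(2)[of n] SA trace[of "Suc n"] by (auto simp: step_def)
  qed
  then obtain n F P where F: "finite F" "P \<subseteq> F" "F \<subseteq> A" and K: "\<And>S. S \<subseteq> A \<Longrightarrow> S \<inter> F = P \<Longrightarrow> S \<in> K n"
    by blast
  show ?thesis
  proof (intro exI[of _ n] exI[of _ F] conjI F(1,3) ballI)
    fix x assume x: "x \<in> A - F"
    \<comment> \<open>Both sets lie in the cylinder because x \<notin> F; the difference of their
      functions is the peak at x.\<close>
    have "P \<in> K n" "insert x P \<in> K n" using F x by (auto intro!: K)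
    then obtain f g where f: "f \<in> log_bounded (c n) (L n)" "\<forall>y\<in>A. f y = of_bool (y \<in> insert x P)"
      and g: "g \<in> log_bounded (c n) (L n)" "\<forall>y\<in>A. g y = of_bool (y \<in> P)"
      by (auto simp: K_def)
    show "\<exists>f\<in>log_bounded (c n / 2) (2 * L n). f x = 1 \<and> (\<forall>y\<in>A - {x}. f y = 0)"
    proof (intro bexI conjI ballI)
      show "(\<lambda>z. f z - g z) \<in> log_bounded (c n / 2) (2 * L n)"
        using log_bounded_diff[OF f(1) g(1)] c by (simp add: less_imp_le)
      show "f x - g x = 1" using f(2) g(2) x F(2) by auto
      show "f y - g y = 0" if "y \<in> A - {x}" for y using f(2) g(2) that by auto
    qed
  qed
qed

section \<open>Free interpolation and the necessary conditions\<close>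

lemma one_in_log_bounded: "(\<lambda>_. 1) \<in> log_bounded c (log_plus c)" if "0 \<le> c"
  using that by (auto simp: log_bounded_def log_mean_def)

lemma one_in_smirnov: "(\<lambda>_. 1) \<in> smirnov"
  unfolding smirnov_iff
proof (intro allI impI)
  fix \<epsilon> :: real assume "0 < \<epsilon>"
  then show "\<exists>c>0. (\<lambda>_. 1) \<in> log_bounded c \<epsilon>"
    using one_in_log_bounded[of 1]
    by (intro exI[of _ 1]) (auto simp: log_plus_def intro: log_bounded_mono)
qed

lemma smirnov_subset_nevanlinna: "smirnov \<subseteq> nevanlinna"
  by (auto simp: smirnov_def)

text \<open>The ideal property is applied to the trace of the constant function 1.\<close>

lemma free_interpolating_bounded:
  assumes free: "free_interpolating X A" and one: "(\<lambda>_. 1) \<in> X" and \<omega>: "bounded (\<omega> ` A)"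
  shows "\<exists>f\<in>X. \<forall>x\<in>A. f x = \<omega> x"
proof -
  have "restrict (\<lambda>_. 1) A \<in> trace_space X A"
    using one by (auto simp: trace_space_def)
  then have "restrict (\<lambda>l. \<omega> l * restrict (\<lambda>_. 1) A l) A \<in> trace_space X A"
    using free \<omega> unfolding free_interpolating_def by blast
  then obtain f where f: "f \<in> X" "restrict (\<lambda>l. \<omega> l * restrict (\<lambda>_. 1) A l) A = restrict f A"
    by (auto simp: trace_space_def)
  have "f x = \<omega> x" if "x \<in> A" for x
    using fun_cong[OF f(2), of x] that by simp
  then show ?thesis using f(1) by blast
qed

text \<open>When X is closed under multiplication, it is enough to realize the bounded multiplier
  itself as a trace.\<close>

lemma free_interpolatingI:
  assumes mult: "\<And>f g. f \<in> X \<Longrightarrow> g \<in> X \<Longrightarrow> (\<lambda>z. f z * g z) \<in> X"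
    and interp: "\<And>\<omega>. bounded (\<omega> ` A) \<Longrightarrow> \<exists>f\<in>X. \<forall>x\<in>A. f x = \<omega> x"
  shows "free_interpolating X A"
  unfolding free_interpolating_def
proof (intro ballI allI impI)
  fix a :: "complex \<Rightarrow> complex" and \<omega> :: "complex \<Rightarrow> complex"
  assume a: "a \<in> trace_space X A" and \<omega>: "bounded (\<omega> ` A)"
  obtain f where f: "f \<in> X" "a = restrict f A" using a by (auto simp: trace_space_def)
  obtain g where g: "g \<in> X" "\<forall>x\<in>A. g x = \<omega> x" using interp[OF \<omega>] by blast
  have "restrict (\<lambda>l. \<omega> l * a l) A = restrict (\<lambda>z. g z * f z) A"
    using f g by (auto simp: restrict_def fun_eq_iff)
  then show "restrict (\<lambda>l. \<omega> l * a l) A \<in> trace_space X A"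
    using mult[OF g(1) f(1)] by (auto simp: trace_space_def)
qed

context blaschke_sequence
begin

lemma ln_inverse_B_nonneg: "l \<in> \<Lambda> \<Longrightarrow> 0 \<le> ln (inverse (B l))"
  using B_pos[of l] B_le_1[of l] by (simp add: ln_inverse)

text \<open>Peak functions with a uniform bound exist off a finite set, and finitely many points
  cannot affect boundedness.\<close>

lemma nevanlinna_necessary:
  assumes "free_interpolating nevanlinna \<Lambda>"
  shows "bdd_above ((\<lambda>l. (1 - cmod l) * ln (inverse (B l))) ` \<Lambda>)"
proof -
  have cover: "\<exists>n. \<exists>f\<in>log_bounded 1 (real n). \<forall>x\<in>\<Lambda>. f x = of_bool (x \<in> S)" if "S \<subseteq> \<Lambda>" for S
  proof -
    have bd: "bounded ((\<lambda>x. of_bool (x \<in> S) :: complex) ` \<Lambda>)"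
      by (intro boundedI[of _ 1]) auto
    have one: "(\<lambda>_. 1) \<in> nevanlinna"
      using one_in_smirnov smirnov_subset_nevanlinna by (rule subsetD[rotated])
    obtain f where f: "f \<in> nevanlinna" "\<forall>x\<in>\<Lambda>. f x = of_bool (x \<in> S)"
      using free_interpolating_bounded[OF assms one bd] by metis
    obtain L where L: "f \<in> log_bounded 1 L" using f(1) unfolding nevanlinna_iff ..
    obtain n where "L \<le> real n" using real_arch_simple by blast
    then have "f \<in> log_bounded 1 (real n)" by (intro log_bounded_mono[OF L]) auto
    with f(2) show ?thesis by (intro exI bexI)
  qed
  have "\<exists>n F. finite F \<and> F \<subseteq> \<Lambda> \<and>
      (\<forall>x\<in>\<Lambda> - F. \<exists>f\<in>log_bounded (1 / 2) (2 * real n). f x = 1 \<and> (\<forall>y\<in>\<Lambda> - {x}. f y = 0))"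
    by (rule uniform_peak_functions[OF countable in_disc _ cover]) simp
  then obtain n F where F: "finite F" "F \<subseteq> \<Lambda>"
    "\<And>x. x \<in> \<Lambda> - F \<Longrightarrow> \<exists>f\<in>log_bounded (1 / 2) (2 * real n). f x = 1 \<and> (\<forall>y\<in>\<Lambda> - {x}. f y = 0)"
    by blast
  let ?u = "\<lambda>l. (1 - cmod l) * ln (inverse (B l))"
  have "?u l \<le> ln 2 + 4 * real n" if l: "l \<in> \<Lambda> - F" for l
  proof -
    obtain f where f: "f \<in> log_bounded (1 / 2) (2 * real n)" "f l = 1" "\<And>y. y \<in> \<Lambda> - {l} \<Longrightarrow> f y = 0"
      using F(3)[OF l] by auto
    have "?u l \<le> (1 - cmod l) * ln (1 / (1 / 2)) + 2 * (2 * real n)"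
      using l f by (intro B_lower_of_peak[OF f(1)]) auto
    also have "(1 - cmod l) * ln (1 / (1 / 2)) \<le> 1 * ln 2"
      using norm_less_1[of l] l by (intro mult_mono) auto
    finally show ?thesis by simp
  qed
  then have "bdd_above (?u ` (\<Lambda> - F))" by (intro bdd_aboveI2)
  moreover have "bdd_above (?u ` F)" using F(1) by simp
  ultimately have "bdd_above (?u ` (\<Lambda> - F) \<union> ?u ` F)" by simp
  then show ?thesis by (rule bdd_above_mono) auto
qed

text \<open>Here \<open>L\<close> is fixed in advance as small as desired and only \<open>c\<close>
  varies in the Baire argument; \<open>c\<close> contributes the term (1 - |l|) C, which vanishes at
  the circle.\<close>

lemma smirnov_necessary:
  assumes "free_interpolating smirnov \<Lambda>"
  shows "((\<lambda>l. (1 - cmod l) * ln (inverse (B l))) \<longlongrightarrow> 0) (inf (filtercomap cmod (at_left 1)) (principal \<Lambda>))"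
proof (rule tendstoI)
  fix e :: real assume e: "0 < e"
  \<comment> \<open>The peak functions have bound 2 \<epsilon>, and \<open>B_lower_of_peak\<close>
    doubles it: 4 \<epsilon> = e / 2.\<close>
  define \<epsilon> where "\<epsilon> = e / 8"
  have \<epsilon>: "0 < \<epsilon>" using e by (simp add: \<epsilon>_def)
  have cover: "\<exists>n. \<exists>f\<in>log_bounded (1 / (real n + 1)) \<epsilon>. \<forall>x\<in>\<Lambda>. f x = of_bool (x \<in> S)" if "S \<subseteq> \<Lambda>" for S
  proof -
    have bd: "bounded ((\<lambda>x. of_bool (x \<in> S) :: complex) ` \<Lambda>)"
      by (intro boundedI[of _ 1]) auto
    obtain f where f: "f \<in> smirnov" "\<forall>x\<in>\<Lambda>. f x = of_bool (x \<in> S)"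
      using free_interpolating_bounded[OF assms one_in_smirnov bd] by metis
    have "\<exists>c>0. f \<in> log_bounded c \<epsilon>" using f(1) \<epsilon> unfolding smirnov_iff by simp
    then obtain c where c: "0 < c" "f \<in> log_bounded c \<epsilon>" by (elim exE conjE)
    obtain n where "1 / c \<le> real n" using real_arch_simple by blast
    then have "1 / (real n + 1) \<le> c" using c(1) by (simp add: field_simps)
    then have "f \<in> log_bounded (1 / (real n + 1)) \<epsilon>" by (intro log_bounded_mono[OF c(2)]) auto
    with f(2) show ?thesis by (intro exI bexI)
  qed
  have "\<exists>n F. finite F \<and> F \<subseteq> \<Lambda> \<and>
      (\<forall>x\<in>\<Lambda> - F. \<exists>f\<in>log_bounded (1 / (real n + 1) / 2) (2 * \<epsilon>). f x = 1 \<and> (\<forall>y\<in>\<Lambda> - {x}. f y = 0))"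
    by (rule uniform_peak_functions[OF countable in_disc _ cover]) simp
  then obtain n F where F: "finite F" "F \<subseteq> \<Lambda>"
    "\<And>x. x \<in> \<Lambda> - F \<Longrightarrow> \<exists>f\<in>log_bounded (1 / (real n + 1) / 2) (2 * \<epsilon>). f x = 1 \<and> (\<forall>y\<in>\<Lambda> - {x}. f y = 0)"
    by blast
  let ?u = "\<lambda>l. (1 - cmod l) * ln (inverse (B l))"
  define C where "C = ln (2 * (real n + 1))"
  have C: "0 < C" by (simp add: C_def)
  have bound: "?u l \<le> (1 - cmod l) * C + e / 2" if l: "l \<in> \<Lambda> - F" for l
  proof -
    obtain f where f: "f \<in> log_bounded (1 / (real n + 1) / 2) (2 * \<epsilon>)" "f l = 1" "\<And>y. y \<in> \<Lambda> - {l} \<Longrightarrow> f y = 0"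
      using F(3)[OF l] by auto
    have "?u l \<le> (1 - cmod l) * ln (1 / (1 / (real n + 1) / 2)) + 2 * (2 * \<epsilon>)"
      using l f by (intro B_lower_of_peak[OF f(1)]) auto
    then show ?thesis by (simp add: C_def \<epsilon>_def mult.commute)
  qed
  \<comment> \<open>Beyond radius \<open>R\<close> no point of \<open>F\<close> remains and (1 -
    |l|) C < e / 2.\<close>
  define R where "R = Max (insert (1 - e / (2 * C)) (insert 0 (cmod ` F)))"
  have R1: "R < 1"
    unfolding R_def using F norm_less_1 e C by (subst Max_less_iff) auto
  have R2: "x \<le> R" if "x \<in> insert (1 - e / (2 * C)) (insert 0 (cmod ` F))" for x
    unfolding R_def by (rule Max_ge[OF _ that]) (use F(1) in simp)
  have "\<forall>\<^sub>F l in filtercomap cmod (at_left 1). R < cmod l"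
    by (rule eventually_filtercomapI) (use eventually_at_left_real[OF R1] in \<open>auto elim: eventually_mono\<close>)
  then show "\<forall>\<^sub>F l in inf (filtercomap cmod (at_left 1)) (principal \<Lambda>). dist (?u l) 0 < e"
    unfolding eventually_inf_principal
  proof (rule eventually_mono, intro impI)
    fix l assume R: "R < cmod l" and l: "l \<in> \<Lambda>"
    have "l \<notin> F" using R R2[of "cmod l"] by auto
    then have "?u l \<le> (1 - cmod l) * C + e / 2" using bound l by blast
    also have "(1 - cmod l) * C < e / (2 * C) * C"
      using R R2[of "1 - e / (2 * C)"] C by (intro mult_strict_right_mono) auto
    also have "e / (2 * C) * C = e / 2" using C by simp
    finally have "?u l < e" by simp
    moreover have "0 \<le> ?u l"
      using ln_inverse_B_nonneg[OF l] norm_less_1[OF l] by simp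
    ultimately show "dist (?u l) 0 < e" by (simp add: dist_real_def)
  qed
qed

end

section \<open>Kernels for the sufficiency part\<close>

lemma Re_cayley: "Re ((1 + u) / (1 - u)) = (1 - (cmod u)\<^sup>2) / (cmod (1 - u))\<^sup>2"
proof -
  have "Re ((1 + u) * cnj (1 - u)) = 1 - (cmod u)\<^sup>2"
    unfolding cmod_power2 by (simp add: power2_eq_square algebra_simps)
  moreover have "(1 + u) / (1 - u) = ((1 + u) * cnj (1 - u)) / of_real ((cmod (1 - u))\<^sup>2)"
    using complex_div_cnj[of "1 + u" "1 - u"] by simp
  ultimately show ?thesis by (simp only: Re_divide_of_real)
qed

text \<open>On the unit circle its real part is the Poisson kernel of \<open>l\<close>. Unlike the
  Herglotz kernel of a boundary point it is bounded on the disc, and its value 1 at 0 makes the mean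
  of the real part 1 on every circle of radius less than 1.\<close>

definition herglotz_kernel :: "complex \<Rightarrow> complex \<Rightarrow> complex" where
  "herglotz_kernel l z = (1 + cnj l * z) / (1 - cnj l * z)"

lemma herglotz_kernel_0 [simp]: "herglotz_kernel l 0 = 1"
  by (simp add: herglotz_kernel_def)

lemma Re_herglotz_kernel_nonneg:
  assumes "cmod l < 1" "cmod z \<le> 1"
  shows "0 \<le> Re (herglotz_kernel l z)"
  unfolding herglotz_kernel_def
  using norm_cnj_mult_less[OF assms] unfolding Re_cayley by (simp add: abs_square_le_1)

lemma Re_herglotz_kernel_le:
  assumes "cmod l < 1" "cmod z \<le> 1"
  shows "Re (herglotz_kernel l z) \<le> 2 / (1 - cmod l)"
proof -
  have le: "cmod (cnj l * z) \<le> cmod l"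
    unfolding norm_mult complex_mod_cnj using assms by (simp add: mult_left_le)
  have "Re (herglotz_kernel l z) \<le> cmod (herglotz_kernel l z)" by (rule complex_Re_le_cmod)
  also have "\<dots> = cmod (1 + cnj l * z) / cmod (1 - cnj l * z)"
    by (simp add: herglotz_kernel_def norm_divide)
  also have "\<dots> \<le> 2 / (1 - cmod l)"
  proof (rule frac_le)
    show "cmod (1 + cnj l * z) \<le> 2"
      using norm_triangle_ineq[of 1 "cnj l * z"] le assms by simp
    show "1 - cmod l \<le> cmod (1 - cnj l * z)"
      using norm_triangle_ineq2[of 1 "cnj l * z"] le by simp
  qed (use assms in auto)
  finally show ?thesis .
qed

text \<open>The real part at \<open>l\<close> equals (1 + |l|^2) / (1 - |l|^2). This is where the
  factor 2 in the weights of \<open>majorant\<close> comes from.\<close>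

lemma Re_herglotz_kernel_diag:
  assumes l: "cmod l < 1"
  shows "1 \<le> 2 * (1 - cmod l) * Re (herglotz_kernel l l)"
proof -
  have ll: "cnj l * l = of_real ((cmod l)\<^sup>2)"
    using complex_norm_square[of l] by (simp add: mult.commute)
  have lt: "(cmod l)\<^sup>2 < 1" using l by (simp add: abs_square_less_1)
  have "herglotz_kernel l l = of_real ((1 + (cmod l)\<^sup>2) / (1 - (cmod l)\<^sup>2))"
    unfolding herglotz_kernel_def ll by simp
  then have "Re (herglotz_kernel l l) = (1 + (cmod l)\<^sup>2) / (1 - (cmod l)\<^sup>2)"
    by (simp only: Re_complex_of_real)
  also have "1 - (cmod l)\<^sup>2 = (1 - cmod l) * (1 + cmod l)"
    by (simp add: power2_eq_square algebra_simps)
  finally have *: "Re (herglotz_kernel l l) = (1 + (cmod l)\<^sup>2) / ((1 - cmod l) * (1 + cmod l))" .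
  have "2 * a * (n / (a * d)) = 2 * n / d" if "a \<noteq> 0" for a n d :: real
    using that by simp
  from this[of "1 - cmod l"]
  have eq: "2 * (1 - cmod l) * Re (herglotz_kernel l l) = 2 * (1 + (cmod l)\<^sup>2) / (1 + cmod l)"
    unfolding * using l by simp
  have "1 + cmod l \<le> 2 * (1 + (cmod l)\<^sup>2)"
    using l by (simp add: add_mono order_trans[of _ 1])
  then show ?thesis unfolding eq by (simp add: add_pos_nonneg)
qed

lemma holomorphic_herglotz_kernel: "cmod l < 1 \<Longrightarrow> herglotz_kernel l holomorphic_on ball 0 1"
  unfolding herglotz_kernel_def using one_minus_cnj_mult_nonzero[of l]
  by (intro holomorphic_intros) (auto simp: less_imp_le)

lemma log_plus_exp: "log_plus (exp x) = max 0 x"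
  by (simp add: log_plus_def)

text \<open>From log+ x \<le> x. Because the bound \<open>c * M\<close> tends to 0 with
  \<open>c\<close>, bounded means of |f| already give the Smirnov condition.\<close>

lemma log_boundedI_mean:
  assumes hol: "f holomorphic_on ball 0 1" and c: "0 \<le> c"
    and mean: "\<And>r. 0 < r \<Longrightarrow> r < 1 \<Longrightarrow> circle_average (\<lambda>w. cmod (f (of_real r * w))) \<le> M"
  shows "f \<in> log_bounded c (c * M)"
  unfolding log_bounded_def
proof (intro CollectI conjI hol ballI)
  fix r :: real assume r: "r \<in> {0<..<1}"
  have "log_mean c f r \<le> circle_average (\<lambda>w. c * cmod (f (of_real r * w)))"
    unfolding log_mean_def using r c
    by (intro circle_average_mono continuous_intros continuous_on_circle_log_plus continuous_on_circle_dilate hol log_plus_le_self) auto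
  also have "\<dots> \<le> c * M"
    unfolding circle_average_mult_left using c r by (intro mult_left_mono mean) auto
  finally show "log_mean c f r \<le> c * M" .
qed

definition peak_kernel :: "complex \<Rightarrow> complex \<Rightarrow> complex" where
  "peak_kernel l z = (of_real (1 - (cmod l)\<^sup>2) / (1 - cnj l * z))\<^sup>2"

lemma holomorphic_peak_kernel: "cmod l < 1 \<Longrightarrow> peak_kernel l holomorphic_on ball 0 1"
  unfolding peak_kernel_def using one_minus_cnj_mult_nonzero[of l]
  by (intro holomorphic_intros) (auto simp: less_imp_le)

lemma peak_kernel_diag:
  assumes l: "cmod l < 1"
  shows "peak_kernel l l = 1"
proof -
  have "1 - cnj l * l = of_real (1 - (cmod l)\<^sup>2)"
    using complex_norm_square[of l] by (simp add: mult.commute)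
  moreover have "1 - (cmod l)\<^sup>2 \<noteq> 0" using abs_square_less_1[of "cmod l"] l by simp
  then have "complex_of_real (1 - (cmod l)\<^sup>2) \<noteq> 0" by (simp only: of_real_eq_0_iff not_False_eq_True)
  ultimately show ?thesis by (simp only: peak_kernel_def divide_self power_one not_False_eq_True)
qed

text \<open>On the circle of radius r the modulus is a constant times the Poisson kernel of r l, and
  that constant is at most 1 - |l|^2.\<close>

lemma norm_peak_kernel_mean:
  assumes l: "cmod l < 1" and r: "0 < r" "r < 1"
  shows "circle_average (\<lambda>w. cmod (peak_kernel l (of_real r * w))) \<le> 2 * (1 - cmod l)"
proof -
  let ?a = "of_real r * l"
  have a: "cmod ?a < 1" "cmod ?a \<le> cmod l"
    using l r mult_strict_mono[of r 1 "cmod l" 1] by (auto simp: norm_mult mult_le_cancel_right1 mult_left_le_one_le)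
  have lt: "(cmod l)\<^sup>2 < 1" "(cmod ?a)\<^sup>2 < 1" using l a by (auto simp: abs_square_less_1)
  have "circle_average (\<lambda>w. cmod (peak_kernel l (of_real r * w)))
      = circle_average (\<lambda>w. (1 - (cmod l)\<^sup>2)\<^sup>2 / (1 - (cmod ?a)\<^sup>2) * poisson_kernel ?a w)"
  proof (rule circle_average_cong)
    fix w :: complex assume w: "cmod w = 1"
    have "cmod (1 - cnj l * (of_real r * w)) = cmod (1 - cnj ?a * w)" by (simp add: mult_ac)
    also have "\<dots> = cmod (w - ?a)" by (rule norm_one_minus_cnj_mult[OF w])
    finally have eq: "cmod (1 - cnj l * (of_real r * w)) = cmod (w - ?a)" .
    have "cmod (peak_kernel l (of_real r * w)) = (1 - (cmod l)\<^sup>2)\<^sup>2 / (cmod (w - ?a))\<^sup>2"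
      unfolding peak_kernel_def norm_power norm_divide norm_of_real eq by (simp add: power_divide)
    then show "cmod (peak_kernel l (of_real r * w)) = (1 - (cmod l)\<^sup>2)\<^sup>2 / (1 - (cmod ?a)\<^sup>2) * poisson_kernel ?a w"
      using lt by (simp add: poisson_kernel_def)
  qed
  also have "\<dots> = (1 - (cmod l)\<^sup>2)\<^sup>2 / (1 - (cmod ?a)\<^sup>2)"
    unfolding circle_average_mult_left circle_average_poisson_kernel[OF a(1)] by simp
  also have "\<dots> \<le> (1 - (cmod l)\<^sup>2)\<^sup>2 / (1 - (cmod l)\<^sup>2)"
    using lt a power_mono[OF a(2), of 2] by (intro divide_left_mono mult_pos_pos) auto
  also have "\<dots> = 1 - (cmod l)\<^sup>2"
    using lt by (simp only: power2_eq_square[of "1 - (cmod l)\<^sup>2"]) simp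
  also have "\<dots> = (1 - cmod l) * (1 + cmod l)"
    by (simp add: power2_eq_square algebra_simps)
  also have "\<dots> \<le> (1 - cmod l) * 2"
    using l by (intro mult_left_mono) auto
  finally show ?thesis by simp
qed

section \<open>Construction of the interpolating functions\<close>

context blaschke_sequence
begin

text \<open>The outer factors \<open>exp (majorant F)\<close> dominate \<open>1 / B\<close> on \<open>F\<close>, while their logarithms are
  uniformly integrable, uniformly in \<open>F\<close>: up to a bounded part, the mean of the harmonic function
  \<open>Re (majorant F)\<close> is a tail of the given series.\<close>

definition majorant :: "complex set \<Rightarrow> complex \<Rightarrow> complex" where
  "majorant F z = (\<Sum>l\<in>F. of_real (2 * ((1 - cmod l) * ln (inverse (B l)))) * herglotz_kernel l z)"

lemma weight_nonneg: "l \<in> \<Lambda> \<Longrightarrow> 0 \<le> 2 * ((1 - cmod l) * ln (inverse (B l)))"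
  using ln_inverse_B_nonneg[of l] norm_less_1[of l] by simp

lemma holomorphic_majorant: "F \<subseteq> \<Lambda> \<Longrightarrow> majorant F holomorphic_on ball 0 1"
  unfolding majorant_def using norm_less_1
  by (intro holomorphic_intros holomorphic_herglotz_kernel) auto

lemma Re_majorant: "Re (majorant F z) = (\<Sum>l\<in>F. 2 * ((1 - cmod l) * ln (inverse (B l))) * Re (herglotz_kernel l z))"
  unfolding majorant_def by simp

lemma Re_majorant_nonneg:
  assumes "F \<subseteq> \<Lambda>" "cmod z \<le> 1"
  shows "0 \<le> Re (majorant F z)"
  unfolding Re_majorant using assms norm_less_1
  by (intro sum_nonneg mult_nonneg_nonneg weight_nonneg Re_herglotz_kernel_nonneg) auto

text \<open>The term of \<open>l\<close> alone suffices by \<open>Re_herglotz_kernel_diag\<close>;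
  the others are nonnegative.\<close>

lemma majorant_lower:
  assumes F: "finite F" "F \<subseteq> \<Lambda>" and l: "l \<in> F"
  shows "exp (- Re (majorant F l)) \<le> B l"
proof -
  have lL: "l \<in> \<Lambda>" "cmod l < 1" using F l norm_less_1 by auto
  have "ln (inverse (B l)) * 1 \<le> ln (inverse (B l)) * (2 * (1 - cmod l) * Re (herglotz_kernel l l))"
    by (rule mult_left_mono[OF Re_herglotz_kernel_diag[OF lL(2)] ln_inverse_B_nonneg[OF lL(1)]])
  also have "\<dots> = 2 * ((1 - cmod l) * ln (inverse (B l))) * Re (herglotz_kernel l l)"
    by (simp only: mult_ac)
  also have "\<dots> \<le> Re (majorant F l)"
    unfolding Re_majorant using F l norm_less_1 lL(2)
    by (intro member_le_sum mult_nonneg_nonneg weight_nonneg Re_herglotz_kernel_nonneg) (auto simp: less_imp_le)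
  finally have "- Re (majorant F l) \<le> ln (B l)"
    using B_pos[OF lL(1)] by (simp add: ln_inverse)
  then have "exp (- Re (majorant F l)) \<le> exp (ln (B l))" by (simp only: exp_le_cancel_iff)
  then show ?thesis using B_pos[OF lL(1)] by simp
qed

text \<open>Outside a finite set \<open>F0\<close> the weights sum to at most \<epsilon>, and this
  sum is the mean of the tail because the kernels are 1 at 0. The part in \<open>F0\<close> is
  bounded by a constant \<open>K\<close> that does not depend on \<open>F\<close> and is absorbed
  into c = exp (-K).\<close>

lemma exp_majorant_uniformly_bounded:
  assumes summable: "(\<lambda>l. (1 - cmod l) * ln (inverse (B l))) summable_on \<Lambda>" and \<epsilon>: "0 < \<epsilon>"
  shows "\<exists>c>0. \<forall>F. finite F \<longrightarrow> F \<subseteq> \<Lambda> \<longrightarrow> (\<lambda>z. exp (majorant F z)) \<in> log_bounded c \<epsilon>"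
proof -
  let ?v = "\<lambda>l. 2 * ((1 - cmod l) * ln (inverse (B l)))"
  obtain F0 where F0: "finite F0" "F0 \<subseteq> \<Lambda>" "\<And>G. finite G \<Longrightarrow> G \<subseteq> \<Lambda> - F0 \<Longrightarrow> sum ?v G \<le> \<epsilon>"
    using summable_on_tail[OF summable_on_cmult_right[OF summable, of 2] weight_nonneg \<epsilon>] by auto
  define K where "K = (\<Sum>l\<in>F0. ?v l * (2 / (1 - cmod l)))"
  have "(\<lambda>z. exp (majorant F z)) \<in> log_bounded (exp (- K)) \<epsilon>" if F: "finite F" "F \<subseteq> \<Lambda>" for F
    unfolding log_bounded_def
  proof (intro CollectI conjI ballI)
    show hol: "(\<lambda>z. exp (majorant F z)) holomorphic_on ball 0 1"
      using holomorphic_majorant[OF F(2)] by (intro holomorphic_intros)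
    fix r :: real assume r: "r \<in> {0<..<1}"
    have tail: "F - F0 \<subseteq> \<Lambda>" "finite (F - F0)" using F by auto
    note hol_tail = holomorphic_majorant[OF tail(1)]
    have cont: "continuous_on (sphere 0 1) (\<lambda>w. majorant (F - F0) (of_real r * w))"
      using r by (intro continuous_on_circle_dilate hol_tail) auto
    have "log_mean (exp (- K)) (\<lambda>z. exp (majorant F z)) r \<le> circle_average (\<lambda>w. Re (majorant (F - F0) (of_real r * w)))"
      unfolding log_mean_def
    proof (rule circle_average_mono)
      show "continuous_on (sphere 0 1) (\<lambda>w. log_plus (exp (- K) * cmod (exp (majorant F (of_real r * w)))))"
        using r by (intro continuous_on_circle_log_plus[OF hol]) auto
      show "continuous_on (sphere 0 1) (\<lambda>w. Re (majorant (F - F0) (of_real r * w)))"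
        by (intro continuous_intros cont)
      fix w :: complex assume "cmod w = 1"
      then have z: "cmod (of_real r * w) \<le> 1" using r by (simp add: norm_mult)
      let ?z = "of_real r * w"
      have "Re (majorant F ?z) = Re (majorant (F - F0) ?z) + Re (majorant (F \<inter> F0) ?z)"
        unfolding Re_majorant using F(1) by (subst sum.Int_Diff[of _ _ F0]) auto
      moreover have "Re (majorant (F \<inter> F0) ?z) \<le> K"
      proof -
        have "Re (majorant (F \<inter> F0) ?z) \<le> (\<Sum>l\<in>F \<inter> F0. ?v l * (2 / (1 - cmod l)))"
          unfolding Re_majorant using F norm_less_1 z
          by (intro sum_mono mult_left_mono Re_herglotz_kernel_le weight_nonneg) auto
        also have "\<dots> \<le> K"
          unfolding K_def using F0 norm_less_1
          by (intro sum_mono2 mult_nonneg_nonneg weight_nonneg) (auto simp: less_imp_le)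
        finally show ?thesis .
      qed
      ultimately have "- K + Re (majorant F ?z) \<le> Re (majorant (F - F0) ?z)" by simp
      moreover have "0 \<le> Re (majorant (F - F0) ?z)" by (rule Re_majorant_nonneg[OF tail(1) z])
      moreover have "exp (- K) * cmod (exp (majorant F ?z)) = exp (- K + Re (majorant F ?z))"
        by (simp only: norm_exp_eq_Re exp_add)
      ultimately show "log_plus (exp (- K) * cmod (exp (majorant F ?z))) \<le> Re (majorant (F - F0) ?z)"
        by (simp only: log_plus_exp max.bounded_iff)
    qed
    also have "\<dots> = Re (circle_average (\<lambda>w. majorant (F - F0) (of_real r * w)))"
      by (rule circle_average_bounded_linear[OF bounded_linear_Re cont])
    also have "circle_average (\<lambda>w. majorant (F - F0) (of_real r * w)) = majorant (F - F0) (of_real r * 0)"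
      by (rule mean_value_property[OF holomorphic_dilate[OF hol_tail]]) (use r in auto)
    also have "Re \<dots> = sum ?v (F - F0)"
      unfolding Re_majorant by simp
    also have "\<dots> \<le> \<epsilon>" using tail F by (intro F0(3)) auto
    finally show "log_mean (exp (- K)) (\<lambda>z. exp (majorant F z)) r \<le> \<epsilon>" .
  qed
  then show ?thesis by (intro exI[of _ "exp (- K)"]) auto
qed

text \<open>The Blaschke quotient is 1 at \<open>l\<close> and 0 at the other points of
  \<open>F\<close>, as in Lagrange interpolation. The factor \<open>exp (- majorant F l)\<close>
  cancels the outer factor at \<open>l\<close> and offsets the small denominator; the peak kernels
  keep the sum bounded in mean.\<close>

definition interpolant :: "(complex \<Rightarrow> complex) \<Rightarrow> complex set \<Rightarrow> complex \<Rightarrow> complex" where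
  "interpolant \<omega> F z = (\<Sum>l\<in>F. \<omega> l * exp (- majorant F l) *
     ((\<Prod>l'\<in>F - {l}. blaschke_factor l' z) / (\<Prod>l'\<in>F - {l}. blaschke_factor l' l)) * peak_kernel l z)"

lemma prod_factor_nonzero:
  assumes F: "finite F" "F \<subseteq> \<Lambda>" and l: "l \<in> F"
  shows "(\<Prod>l'\<in>F - {l}. blaschke_factor l' l) \<noteq> 0"
proof -
  have "blaschke_factor a l \<noteq> 0" if "a \<in> F - {l}" for a
    using that F l norm_less_1 by (intro blaschke_factor_nonzero) auto
  then show ?thesis using F(1) by simp
qed

lemma holomorphic_interpolant:
  assumes F: "finite F" "F \<subseteq> \<Lambda>"
  shows "interpolant \<omega> F holomorphic_on ball 0 1"
  unfolding interpolant_def using F norm_less_1 prod_factor_nonzero[OF F]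
  by (intro holomorphic_intros holomorphic_peak_kernel holomorphic_blaschke_factor) auto

lemma interpolant_value:
  assumes F: "finite F" "F \<subseteq> \<Lambda>" and l: "l \<in> F"
  shows "exp (majorant F l) * interpolant \<omega> F l = \<omega> l"
proof -
  have "interpolant \<omega> F l = (\<Sum>k\<in>{l}. \<omega> k * exp (- majorant F k) *
     ((\<Prod>l'\<in>F - {k}. blaschke_factor l' l) / (\<Prod>l'\<in>F - {k}. blaschke_factor l' k)) * peak_kernel k l)"
    unfolding interpolant_def
  proof (rule sum.mono_neutral_right)
    show "\<forall>k\<in>F - {l}. \<omega> k * exp (- majorant F k) *
       ((\<Prod>l'\<in>F - {k}. blaschke_factor l' l) / (\<Prod>l'\<in>F - {k}. blaschke_factor l' k)) * peak_kernel k l = 0"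
    proof
      fix k assume "k \<in> F - {l}"
      then have "(\<Prod>l'\<in>F - {k}. blaschke_factor l' l) = 0"
        using F l by (intro prod_zero bexI[of _ l]) auto
      then show "\<omega> k * exp (- majorant F k) *
       ((\<Prod>l'\<in>F - {k}. blaschke_factor l' l) / (\<Prod>l'\<in>F - {k}. blaschke_factor l' k)) * peak_kernel k l = 0"
        by simp
    qed
  qed (use F l in auto)
  also have "\<dots> = \<omega> l * exp (- majorant F l)"
    using prod_factor_nonzero[OF F l] peak_kernel_diag[of l] norm_less_1[of l] F l by auto
  finally show ?thesis by (simp add: exp_minus)
qed

lemma interpolant_mean:
  assumes F: "finite F" "F \<subseteq> \<Lambda>" and W: "0 \<le> W" "\<And>l. l \<in> \<Lambda> \<Longrightarrow> cmod (\<omega> l) \<le> W" and r: "0 < r" "r < 1"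
  shows "circle_average (\<lambda>w. cmod (interpolant \<omega> F (of_real r * w))) \<le> 2 * W * infsum (\<lambda>l. 1 - cmod l) \<Lambda>"
proof -
  have cont: "continuous_on (sphere 0 1) (\<lambda>w. peak_kernel l (of_real r * w))" if "l \<in> F" for l
    using that F norm_less_1 r by (intro continuous_on_circle_dilate holomorphic_peak_kernel) auto
  have "circle_average (\<lambda>w. cmod (interpolant \<omega> F (of_real r * w)))
     \<le> circle_average (\<lambda>w. W * (\<Sum>l\<in>F. cmod (peak_kernel l (of_real r * w))))"
  proof (rule circle_average_mono)
    show "continuous_on (sphere 0 1) (\<lambda>w. cmod (interpolant \<omega> F (of_real r * w)))"
      using r by (intro continuous_intros continuous_on_circle_dilate holomorphic_interpolant F) auto
    show "continuous_on (sphere 0 1) (\<lambda>w. W * (\<Sum>l\<in>F. cmod (peak_kernel l (of_real r * w))))"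
      by (intro continuous_intros cont)
    fix w :: complex assume "cmod w = 1"
    then have z: "cmod (of_real r * w) \<le> 1" using r by (simp add: norm_mult)
    let ?z = "of_real r * w"
    have "cmod (interpolant \<omega> F ?z) \<le> (\<Sum>l\<in>F. W * cmod (peak_kernel l ?z))"
      unfolding interpolant_def
    proof (rule sum_norm_le)
      fix l assume l: "l \<in> F"
      then have lL: "l \<in> \<Lambda>" using F by auto
      define d where "d = cmod (\<Prod>l'\<in>F - {l}. blaschke_factor l' l)"
      have d: "0 < d" unfolding d_def using prod_factor_nonzero[OF F l] by simp
      \<comment> \<open>The chain is exp (- Re (majorant F l)) \<le> B l \<le> d, the second step
        being a comparison with the finite subproduct over F - {l}.\<close>
      have "exp (- Re (majorant F l)) \<le> d"
        unfolding d_def using majorant_lower[OF F l] B_le_prod[OF lL, of "F - {l}"] F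
        by (meson Diff_mono finite_Diff order_refl order_trans)
      then have e: "exp (- Re (majorant F l)) / d \<le> 1" using d by simp
      have p: "cmod (\<Prod>l'\<in>F - {l}. blaschke_factor l' ?z) \<le> 1"
        using F in_disc by (intro norm_blaschke_prod_le_1 z) auto
      have "cmod (\<omega> l * exp (- majorant F l) *
         ((\<Prod>l'\<in>F - {l}. blaschke_factor l' ?z) / (\<Prod>l'\<in>F - {l}. blaschke_factor l' l)) * peak_kernel l ?z)
        = cmod (\<omega> l) * ((exp (- Re (majorant F l)) / d) * cmod (\<Prod>l'\<in>F - {l}. blaschke_factor l' ?z)) * cmod (peak_kernel l ?z)"
        unfolding d_def by (simp only: norm_mult norm_divide norm_exp_eq_Re uminus_complex.sel) simp
      also have "\<dots> \<le> W * (1 * 1) * cmod (peak_kernel l ?z)"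
        using W(1) W(2)[OF lL] e p d by (intro mult_mono mult_nonneg_nonneg) auto
      finally show "cmod (\<omega> l * exp (- majorant F l) *
         ((\<Prod>l'\<in>F - {l}. blaschke_factor l' ?z) / (\<Prod>l'\<in>F - {l}. blaschke_factor l' l)) * peak_kernel l ?z)
        \<le> W * cmod (peak_kernel l ?z)" by simp
    qed
    then show "cmod (interpolant \<omega> F ?z) \<le> W * (\<Sum>l\<in>F. cmod (peak_kernel l ?z))"
      by (simp only: sum_distrib_left)
  qed
  also have "\<dots> = W * (\<Sum>l\<in>F. circle_average (\<lambda>w. cmod (peak_kernel l (of_real r * w))))"
    unfolding circle_average_mult_left by (subst circle_average_sum) (auto intro!: continuous_intros cont)
  also have "\<dots> \<le> W * (\<Sum>l\<in>F. 2 * (1 - cmod l))"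
    using F norm_less_1 r by (intro mult_left_mono[OF _ W(1)] sum_mono norm_peak_kernel_mean) auto
  also have "(\<Sum>l\<in>F. 2 * (1 - cmod l)) = 2 * (\<Sum>l\<in>F. 1 - cmod l)" by (simp only: sum_distrib_left)
  also have "W * (2 * (\<Sum>l\<in>F. 1 - cmod l)) \<le> W * (2 * infsum (\<lambda>l. 1 - cmod l) \<Lambda>)"
    using F norm_less_1 W(1) by (intro mult_left_mono finite_sum_le_infsum blaschke) (auto simp: less_imp_le)
  finally show ?thesis by (simp only: mult_ac)
qed

text \<open>For each \<epsilon>, the functions built for a finite exhaustion of \<Lambda> share one
  bound, with \<open>c\<close> independent of the finite set; a normal-family limit keeps all these
  bounds and all the values.\<close>

lemma bounded_interpolation:
  assumes summable: "(\<lambda>l. (1 - cmod l) * ln (inverse (B l))) summable_on \<Lambda>"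
    and \<omega>: "bounded (\<omega> ` \<Lambda>)"
  shows "\<exists>f\<in>smirnov. \<forall>l\<in>\<Lambda>. f l = \<omega> l"
proof -
  obtain W where W: "0 < W" "\<forall>l\<in>\<Lambda>. cmod (\<omega> l) \<le> W"
    using \<omega> by (auto simp: bounded_pos)
  obtain E where E: "\<And>n::nat. finite (E n)" "\<And>n. E n \<subseteq> \<Lambda>" "\<And>l. l \<in> \<Lambda> \<Longrightarrow> \<forall>\<^sub>F n in sequentially. l \<in> E n"
    using countable_exhaustion[OF countable] by metis
  define f where "f n z = exp (majorant (E n) z) * interpolant \<omega> (E n) z" for n z
  define M where "M = 2 * W * infsum (\<lambda>l. 1 - cmod l) \<Lambda>"
  have M: "0 \<le> M"
    unfolding M_def using W norm_less_1 by (intro mult_nonneg_nonneg infsum_nonneg) (auto simp: less_imp_le)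
  have uniform: "\<exists>c>0. \<forall>n. f n \<in> log_bounded c \<epsilon>" if \<epsilon>: "0 < \<epsilon>" for \<epsilon>
  proof -
    have "0 < \<epsilon> / 2" using \<epsilon> by simp
    from exp_majorant_uniformly_bounded[OF summable this] obtain c where
      c: "0 < c" "\<forall>F. finite F \<longrightarrow> F \<subseteq> \<Lambda> \<longrightarrow> (\<lambda>z. exp (majorant F z)) \<in> log_bounded c (\<epsilon> / 2)"
      by blast
    \<comment> \<open>Makes the bound d M of the second factor at most \<epsilon> / 2;
      \<open>M + 1\<close> avoids division by 0.\<close>
    define d where "d = \<epsilon> / (2 * (M + 1))"
    have d: "0 < d" "d * M \<le> \<epsilon> / 2"
      using \<epsilon> M by (auto simp: d_def field_simps)
    have "f n \<in> log_bounded (c * d) (\<epsilon> / 2 + d * M)" for n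
      unfolding f_def
    proof (rule log_bounded_mult)
      show "(\<lambda>z. exp (majorant (E n) z)) \<in> log_bounded c (\<epsilon> / 2)"
        using c(2) E(1,2) by simp
      show "interpolant \<omega> (E n) \<in> log_bounded d (d * M)"
        unfolding M_def using W d E(1,2)
        by (intro log_boundedI_mean holomorphic_interpolant interpolant_mean) (auto simp: less_imp_le)
    qed (use c d in auto)
    then have "f n \<in> log_bounded (c * d) \<epsilon>" for n
      by (rule log_bounded_mono) (use c d in auto)
    then show ?thesis using c(1) d(1) by (intro exI[of _ "c * d"]) simp
  qed
  obtain c1 where c1: "0 < c1" "\<And>n. f n \<in> log_bounded c1 1"
    using uniform[of 1] by auto
  have "\<exists>g r. strict_mono (r :: nat \<Rightarrow> nat) \<and> (\<forall>z. cmod z < 1 \<longrightarrow> (\<lambda>n. f (r n) z) \<longlonglongrightarrow> g z) \<and>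
      (\<forall>d M. 0 \<le> d \<longrightarrow> (\<forall>n. f n \<in> log_bounded d M) \<longrightarrow> g \<in> log_bounded d M)"
    by (rule log_bounded_Montel[OF c1(2,1)])
  then obtain g r where g: "strict_mono (r :: nat \<Rightarrow> nat)" "\<And>z. cmod z < 1 \<Longrightarrow> (\<lambda>n. f (r n) z) \<longlonglongrightarrow> g z"
    and gK: "\<forall>d M. 0 \<le> d \<longrightarrow> (\<forall>n. f n \<in> log_bounded d M) \<longrightarrow> g \<in> log_bounded d M"
    by blast
  have "g \<in> smirnov"
    unfolding smirnov_iff
  proof (intro allI impI)
    fix \<epsilon> :: real assume "0 < \<epsilon>"
    from uniform[OF this] obtain c where "0 < c" "\<forall>n. f n \<in> log_bounded c \<epsilon>" by blast
    then show "\<exists>c>0. g \<in> log_bounded c \<epsilon>" using gK by (intro exI[of _ c]) simp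
  qed
  moreover have "g l = \<omega> l" if l: "l \<in> \<Lambda>" for l
  proof (rule LIMSEQ_unique)
    show "(\<lambda>n. f (r n) l) \<longlonglongrightarrow> g l" by (rule g(2)[OF norm_less_1[OF l]])
    have "\<forall>\<^sub>F n in sequentially. l \<in> E (r n)"
      by (rule eventually_subseq[OF g(1) E(3)[OF l]])
    then have "\<forall>\<^sub>F n in sequentially. f (r n) l = \<omega> l"
      by eventually_elim (simp add: f_def interpolant_value E(1,2))
    then show "(\<lambda>n. f (r n) l) \<longlonglongrightarrow> \<omega> l" by (rule tendsto_eventually)
  qed
  ultimately show ?thesis by blast
qed

end

theorem corollary1p10:
  fixes \<Lambda> :: "complex set"
  assumes "disc_sequence \<Lambda>"
    and "blaschke_condition \<Lambda>"
  shows "(free_interpolating smirnov \<Lambda> \<longrightarrow>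
            ((\<lambda>l. (1 - cmod l) * ln (inverse (cmod (blaschke_product_without \<Lambda> l l)))) \<longlongrightarrow> 0)
              (inf (filtercomap cmod (at_left 1)) (principal \<Lambda>)))
       \<and> (free_interpolating nevanlinna \<Lambda> \<longrightarrow>
            bdd_above ((\<lambda>l. (1 - cmod l) * ln (inverse (cmod (blaschke_product_without \<Lambda> l l)))) ` \<Lambda>))
       \<and> ((\<lambda>l. (1 - cmod l) * ln (inverse (cmod (blaschke_product_without \<Lambda> l l)))) summable_on \<Lambda> \<longrightarrow>
            free_interpolating smirnov \<Lambda> \<and> free_interpolating nevanlinna \<Lambda>)"
proof -
  interpret blaschke_sequence \<Lambda>
    using assms by unfold_locales (auto simp: disc_sequence_def blaschke_condition_def)
  have "free_interpolating smirnov \<Lambda> \<and> free_interpolating nevanlinna \<Lambda>"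
    if summable: "(\<lambda>l. (1 - cmod l) * ln (inverse (B l))) summable_on \<Lambda>"
  proof
    show "free_interpolating smirnov \<Lambda>"
      by (intro free_interpolatingI smirnov_mult bounded_interpolation[OF summable])
    \<comment> \<open>Freeness does not pass to larger spaces by inclusion; what passes is
      solvability for bounded data, from which it is derived again.\<close>
    show "free_interpolating nevanlinna \<Lambda>"
    proof (intro free_interpolatingI nevanlinna_mult)
      fix \<omega> :: "complex \<Rightarrow> complex" assume "bounded (\<omega> ` \<Lambda>)"
      from bounded_interpolation[OF summable this]
      show "\<exists>f\<in>nevanlinna. \<forall>l\<in>\<Lambda>. f l = \<omega> l"
        by (rule bexE) (use smirnov_subset_nevanlinna in \<open>intro bexI\<close>, auto)
    qed
  qed
  then show ?thesis
    using smirnov_necessary nevanlinna_necessary unfolding B_def by blast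
qed

end
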